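(* Let $T$ be a complete first-order theory, let $N\models T$ be Lascar-complete over $A\subseteq N$ and let $p\in S(N)$ be an NIP type. Then $p$ does not Lascar-split over $A$ if and only if $p$ does not KP-split over $A$.
   Context: $T$ is a complete first-order theory in a language $\mathcal{L}$ with monster model $\mathfrak{C}$; sets and models are contained in $\mathfrak{C}$. For a property $t$, $\varphi^{(t)}$ is $\varphi$ if $t$ holds and $\neg\varphi$ otherwise. $a\equiv^{Ls}_A b$ means that $a,b$ have the same Lascar-strong type over $A$ (they are equivalent under the finest bounded $A$-invariant equivalence relation), and $a\equiv^{KP}_A b$ means that they have the same Kim--Pillay strong type over $A$ (equivalent under the finest bounded $A$-type-definable equivalence relation). A set $B$ is Lascar-complete over $A\subseteq B$ if for every finite tuple $a$ there is a tuple $a'$ in $B$ with $a\equiv^{Ls}_A a'$. A type $p(x)\in S(N)$ Lascar-splits (respectively KP-splits) over $A\subseteq N$ if there are a formula $\varphi(x,y)$ and tuples $a,b$ in $N$ with $a\equiv^{Ls}_A b$ (respectively $a\equiv^{KP}_A b$) such that $\varphi(x,a)\in p$ and $\neg\varphi(x,b)\in p$. A partial type $\pi(x)$ has IP if there are a formula $\varphi(x,y)\in\mathcal{L}$ and a sequence $(a_i)_{i<\omega}$ of realizations of $\pi$ such that for every $s\subseteq\omega$ the set $\{\varphi(a_i,y)^{(i\in s)} : i<\omega\}$ is consistent; $\pi$ is NIP if it does not have IP. *)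

theory Defs
  imports Main
begin

unbundle cardinal_syntax

section \<open>First-order languages, formulas with parameters, structures\<close>

text \<open>A language declares an arity for some of the symbols in \<open>'f\<close> and \<open>'r\<close>; symbols mapped to
  \<open>None\<close> do not belong to it, so either kind of symbol may be absent.\<close>

record ('f, 'r) language =
  fun_ar :: "'f \<Rightarrow> nat option"
  rel_ar :: "'r \<Rightarrow> nat option"

text \<open>\<open>Par a\<close> is the constant naming the element \<open>a\<close>. The formulas of the language itself are
  those without parameters; the \<open>\<L>(B)\<close>-formulas are those with parameters in \<open>B\<close>.\<close>

datatype ('f, tvars: 'v, tpars: 'a) trm =
  Var 'v | Par 'a | Fn 'f "('f, 'v, 'a) trm list"

datatype ('f, 'r, 'v, pars: 'a) form =
    Eq "('f, 'v, 'a) trm" "('f, 'v, 'a) trm"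
  | Rel 'r "('f, 'v, 'a) trm list"
  | Neg "('f, 'r, 'v, 'a) form"
  | Conj "('f, 'r, 'v, 'a) form" "('f, 'r, 'v, 'a) form"
  | Ex 'v "('f, 'r, 'v, 'a) form"

fun wf_trm :: "('f, 'r) language \<Rightarrow> ('f, 'v, 'a) trm \<Rightarrow> bool" where
  "wf_trm L (Var v) \<longleftrightarrow> True"
| "wf_trm L (Par a) \<longleftrightarrow> True"
| "wf_trm L (Fn f ts) \<longleftrightarrow> fun_ar L f = Some (length ts) \<and> (\<forall>t \<in> set ts. wf_trm L t)"

fun wf_form :: "('f, 'r) language \<Rightarrow> ('f, 'r, 'v, 'a) form \<Rightarrow> bool" where
  "wf_form L (Eq s t) \<longleftrightarrow> wf_trm L s \<and> wf_trm L t"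
| "wf_form L (Rel r ts) \<longleftrightarrow> rel_ar L r = Some (length ts) \<and> (\<forall>t \<in> set ts. wf_trm L t)"
| "wf_form L (Neg \<phi>) \<longleftrightarrow> wf_form L \<phi>"
| "wf_form L (Conj \<phi> \<psi>) \<longleftrightarrow> wf_form L \<phi> \<and> wf_form L \<psi>"
| "wf_form L (Ex v \<phi>) \<longleftrightarrow> wf_form L \<phi>"

fun fv :: "('f, 'r, 'v, 'a) form \<Rightarrow> 'v set" where
  "fv (Eq s t) = tvars s \<union> tvars t"
| "fv (Rel r ts) = (\<Union>t \<in> set ts. tvars t)"
| "fv (Neg \<phi>) = fv \<phi>"
| "fv (Conj \<phi> \<psi>) = fv \<phi> \<union> fv \<psi>"
| "fv (Ex v \<phi>) = fv \<phi> - {v}"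

definition formulas :: "('f, 'r) language \<Rightarrow> 'a set \<Rightarrow> 'v set \<Rightarrow> ('f, 'r, 'v, 'a) form set" where
  "formulas L B V = {\<phi>. wf_form L \<phi> \<and> pars \<phi> \<subseteq> B \<and> fv \<phi> \<subseteq> V}"

text \<open>\<open>inst \<rho> \<phi>\<close> substitutes the parameter \<open>a\<close> for the free occurrences of \<open>v\<close>
  whenever \<open>\<rho> v = Some a\<close>.\<close>

fun inst_trm :: "('v \<Rightarrow> 'a option) \<Rightarrow> ('f, 'v, 'a) trm \<Rightarrow> ('f, 'v, 'a) trm" where
  "inst_trm \<rho> (Var v) = (case \<rho> v of None \<Rightarrow> Var v | Some a \<Rightarrow> Par a)"
| "inst_trm \<rho> (Par a) = Par a"
| "inst_trm \<rho> (Fn f ts) = Fn f (map (inst_trm \<rho>) ts)"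

fun inst :: "('v \<Rightarrow> 'a option) \<Rightarrow> ('f, 'r, 'v, 'a) form \<Rightarrow> ('f, 'r, 'v, 'a) form" where
  "inst \<rho> (Eq s t) = Eq (inst_trm \<rho> s) (inst_trm \<rho> t)"
| "inst \<rho> (Rel r ts) = Rel r (map (inst_trm \<rho>) ts)"
| "inst \<rho> (Neg \<phi>) = Neg (inst \<rho> \<phi>)"
| "inst \<rho> (Conj \<phi> \<psi>) = Conj (inst \<rho> \<phi>) (inst \<rho> \<psi>)"
| "inst \<rho> (Ex v \<phi>) = Ex v (inst (\<rho>(v := None)) \<phi>)"

record ('f, 'r, 'a) struct =
  univ :: "'a set"
  fint :: "'f \<Rightarrow> 'a list \<Rightarrow> 'a"
  rint :: "'r \<Rightarrow> 'a list \<Rightarrow> bool"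

definition tuples :: "('f, 'r, 'a) struct \<Rightarrow> nat \<Rightarrow> 'a list set" where
  "tuples M n = {a. length a = n \<and> set a \<subseteq> univ M}"

definition structure_of :: "('f, 'r) language \<Rightarrow> ('f, 'r, 'a) struct \<Rightarrow> bool" where
  "structure_of L M \<longleftrightarrow> univ M \<noteq> {} \<and>
    (\<forall>f n. fun_ar L f = Some n \<longrightarrow> (\<forall>a \<in> tuples M n. fint M f a \<in> univ M))"

fun eval :: "('f, 'r, 'a) struct \<Rightarrow> ('v \<Rightarrow> 'a) \<Rightarrow> ('f, 'v, 'a) trm \<Rightarrow> 'a" where
  "eval M e (Var v) = e v"
| "eval M e (Par a) = a"
| "eval M e (Fn f ts) = fint M f (map (eval M e) ts)"

fun sat :: "('f, 'r, 'a) struct \<Rightarrow> ('v \<Rightarrow> 'a) \<Rightarrow> ('f, 'r, 'v, 'a) form \<Rightarrow> bool" where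
  "sat M e (Eq s t) \<longleftrightarrow> eval M e s = eval M e t"
| "sat M e (Rel r ts) \<longleftrightarrow> rint M r (map (eval M e) ts)"
| "sat M e (Neg \<phi>) \<longleftrightarrow> \<not> sat M e \<phi>"
| "sat M e (Conj \<phi> \<psi>) \<longleftrightarrow> sat M e \<phi> \<and> sat M e \<psi>"
| "sat M e (Ex v \<phi>) \<longleftrightarrow> (\<exists>a \<in> univ M. sat M (e(v := a)) \<phi>)"

definition vals :: "('f, 'r, 'a) struct \<Rightarrow> ('v \<Rightarrow> 'a) set" where
  "vals M = {e. range e \<subseteq> univ M}"

definition holds :: "('f, 'r, 'a) struct \<Rightarrow> ('f, 'r, 'v, 'a) form \<Rightarrow> bool" where
  "holds M \<sigma> \<longleftrightarrow> (\<forall>e \<in> vals M. sat M e \<sigma>)"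

definition models :: "('f, 'r, 'a) struct \<Rightarrow> ('f, 'r, 'v, 'a) form set \<Rightarrow> bool" where
  "models M T \<longleftrightarrow> (\<forall>\<sigma> \<in> T. holds M \<sigma>)"

text \<open>Entailment quantifies over structures with universe contained in the type \<open>'a\<close>. In the
  presence of an infinite monster model inside \<open>'a\<close> this is full semantic entailment, by
  Loewenheim--Skolem. In any case it makes \<open>complete_theory\<close>, used below only as a hypothesis
  on a theory having a model in \<open>'a\<close>, no stronger than the usual notion.\<close>

definition entails ::
  "('f, 'r) language \<Rightarrow> ('f, 'r, 'v, 'a) form set \<Rightarrow> ('f, 'r, 'v, 'a) form \<Rightarrow> bool" where
  "entails L T \<sigma> \<longleftrightarrow> (\<forall>M. structure_of L M \<and> models M T \<longrightarrow> holds M \<sigma>)"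

definition complete_theory :: "('f, 'r) language \<Rightarrow> ('f, 'r, 'v, 'a) form set \<Rightarrow> bool" where
  "complete_theory L T \<longleftrightarrow> T \<subseteq> formulas L {} {} \<and>
    (\<exists>M. structure_of L M \<and> models M T) \<and>
    (\<forall>\<sigma> \<in> formulas L {} {}. entails L T \<sigma> \<or> entails L T (Neg \<sigma>))"

definition elementary_sub :: "('f, 'r) language \<Rightarrow> ('f, 'r, 'a) struct \<Rightarrow> 'a set \<Rightarrow> bool" where
  "elementary_sub L M N \<longleftrightarrow> N \<subseteq> univ M \<and> structure_of L (M\<lparr>univ := N\<rparr>) \<and>
    (\<forall>\<phi> :: ('f, 'r, nat, 'a) form. \<phi> \<in> formulas L {} UNIV \<longrightarrow>
      (\<forall>e \<in> vals (M\<lparr>univ := N\<rparr>). sat (M\<lparr>univ := N\<rparr>) e \<phi> \<longleftrightarrow> sat M e \<phi>))"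

section \<open>The monster model\<close>

text \<open>For formulas with parameters from \<open>univ M\<close>, finite satisfiability in \<open>M\<close> is consistency with
  the elementary diagram of \<open>M\<close>.\<close>

definition consistent_in :: "('f, 'r, 'a) struct \<Rightarrow> ('f, 'r, 'v, 'a) form set \<Rightarrow> bool" where
  "consistent_in M \<Sigma> \<longleftrightarrow> (\<forall>F. finite F \<and> F \<subseteq> \<Sigma> \<longrightarrow> (\<exists>e \<in> vals M. \<forall>\<phi> \<in> F. sat M e \<phi>))"

definition saturated :: "('f, 'r) language \<Rightarrow> ('f, 'r, 'a) struct \<Rightarrow> 'k rel \<Rightarrow> bool" where
  "saturated L M \<kappa> \<longleftrightarrow>
    (\<forall>B \<subseteq> univ M. |B| <o \<kappa> \<longrightarrow>
      (\<forall>\<Sigma> :: ('f, 'r, nat, 'a) form set. \<Sigma> \<subseteq> formulas L B {0} \<and> consistent_in M \<Sigma> \<longrightarrow>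
        (\<exists>e \<in> vals M. \<forall>\<phi> \<in> \<Sigma>. sat M e \<phi>)))"

definition automorphisms ::
  "('f, 'r) language \<Rightarrow> ('f, 'r, 'a) struct \<Rightarrow> 'a set \<Rightarrow> ('a \<Rightarrow> 'a) set" where
  "automorphisms L M A = {g. bij_betw g (univ M) (univ M) \<and> (\<forall>a \<in> A. g a = a) \<and>
    (\<forall>f n. fun_ar L f = Some n \<longrightarrow> (\<forall>a \<in> tuples M n. g (fint M f a) = fint M f (map g a))) \<and>
    (\<forall>r n. rel_ar L r = Some n \<longrightarrow> (\<forall>a \<in> tuples M n. rint M r (map g a) \<longleftrightarrow> rint M r a))}"

definition elementary_map ::
  "('f, 'r) language \<Rightarrow> ('f, 'r, 'a) struct \<Rightarrow> 'a set \<Rightarrow> ('a \<Rightarrow> 'a) \<Rightarrow> bool" where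
  "elementary_map L M B h \<longleftrightarrow> h ` B \<subseteq> univ M \<and>
    (\<forall>\<phi> :: ('f, 'r, nat, 'a) form. \<phi> \<in> formulas L {} UNIV \<longrightarrow>
      (\<forall>e. e ` fv \<phi> \<subseteq> B \<longrightarrow> (sat M e \<phi> \<longleftrightarrow> sat M (h \<circ> e) \<phi>)))"

definition strongly_homogeneous ::
  "('f, 'r) language \<Rightarrow> ('f, 'r, 'a) struct \<Rightarrow> 'k rel \<Rightarrow> bool" where
  "strongly_homogeneous L M \<kappa> \<longleftrightarrow>
    (\<forall>B \<subseteq> univ M. |B| <o \<kappa> \<longrightarrow>
      (\<forall>h. elementary_map L M B h \<longrightarrow> (\<exists>g \<in> automorphisms L M {}. \<forall>b \<in> B. g b = h b)))"

text \<open>The number of \<open>\<L>(B)\<close>-formulas is \<open>\<lambda> = |\<L>| + |B| + \<aleph>\<^sub>0\<close>, so smallness of \<open>B\<close> means that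
  \<open>2\<^sup>\<lambda> < \<kappa>\<close>. This is how large \<open>\<kappa>\<close> must be taken for the finest bounded invariant equivalence
  relations over \<open>B\<close> to exist (with at most \<open>2\<^sup>\<lambda>\<close> classes). It is automatic from
  \<open>\<lambda> < \<kappa>\<close> when \<open>\<kappa>\<close> is a strong limit, but does not require \<open>\<kappa>\<close> to be one.\<close>

definition small ::
  "('f, 'r) language \<Rightarrow> ('f, 'r, 'a) struct \<Rightarrow> 'k rel \<Rightarrow> 'a set \<Rightarrow> bool" where
  "small L M \<kappa> B \<longleftrightarrow> B \<subseteq> univ M \<and>
    |Pow (formulas L B UNIV :: ('f, 'r, nat, 'a) form set)| <o \<kappa>"

definition monster ::
  "('f, 'r) language \<Rightarrow> ('f, 'r, 'v, 'a) form set \<Rightarrow> ('f, 'r, 'a) struct \<Rightarrow> 'k rel \<Rightarrow> bool" where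
  "monster L T C \<kappa> \<longleftrightarrow> structure_of L C \<and> models C T \<and> Card_order \<kappa> \<and> small L C \<kappa> {} \<and>
    saturated L C \<kappa> \<and> strongly_homogeneous L C \<kappa>"

section \<open>Lascar and Kim--Pillay strong types of finite tuples\<close>

definition bounded_equiv :: "('f, 'r, 'a) struct \<Rightarrow> 'k rel \<Rightarrow> nat \<Rightarrow> 'a list rel \<Rightarrow> bool" where
  "bounded_equiv C \<kappa> n E \<longleftrightarrow> equiv (tuples C n) E \<and> |tuples C n // E| <o \<kappa>"

definition invariant_rel ::
  "('f, 'r) language \<Rightarrow> ('f, 'r, 'a) struct \<Rightarrow> 'a set \<Rightarrow> 'a list rel \<Rightarrow> bool" where
  "invariant_rel L C A E \<longleftrightarrow>
    (\<forall>g \<in> automorphisms L C A. \<forall>(a, b) \<in> E. (map g a, map g b) \<in> E)"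

definition type_definable_rel ::
  "('f, 'r) language \<Rightarrow> ('f, 'r, 'a) struct \<Rightarrow> 'a set \<Rightarrow> nat \<Rightarrow> 'a list rel \<Rightarrow> bool" where
  "type_definable_rel L C A n E \<longleftrightarrow>
    (\<exists>\<Sigma> :: ('f, 'r, nat, 'a) form set. \<Sigma> \<subseteq> formulas L A {..<2 * n} \<and>
      E = {(a, b). a \<in> tuples C n \<and> b \<in> tuples C n \<and>
             (\<forall>\<sigma> \<in> \<Sigma>. holds C (inst [[0..<2 * n] [\<mapsto>] a @ b] \<sigma>))})"

text \<open>\<open>LEAST\<close> is with respect to inclusion, i.e. it denotes the finest such relation.\<close>

definition Lascar_equiv ::
  "('f, 'r) language \<Rightarrow> ('f, 'r, 'a) struct \<Rightarrow> 'k rel \<Rightarrow> 'a set \<Rightarrow> nat \<Rightarrow> 'a list rel" where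
  "Lascar_equiv L C \<kappa> A n = (LEAST E. bounded_equiv C \<kappa> n E \<and> invariant_rel L C A E)"

definition KP_equiv ::
  "('f, 'r) language \<Rightarrow> ('f, 'r, 'a) struct \<Rightarrow> 'k rel \<Rightarrow> 'a set \<Rightarrow> nat \<Rightarrow> 'a list rel" where
  "KP_equiv L C \<kappa> A n = (LEAST E. bounded_equiv C \<kappa> n E \<and> type_definable_rel L C A n E)"

definition Lascar_complete ::
  "('f, 'r) language \<Rightarrow> ('f, 'r, 'a) struct \<Rightarrow> 'k rel \<Rightarrow> 'a set \<Rightarrow> 'a set \<Rightarrow> bool" where
  "Lascar_complete L C \<kappa> A B \<longleftrightarrow> A \<subseteq> B \<and>
    (\<forall>n. \<forall>a \<in> tuples C n. \<exists>a'. set a' \<subseteq> B \<and> (a, a') \<in> Lascar_equiv L C \<kappa> A n)"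

section \<open>Types, NIP, splitting\<close>

text \<open>The tuple of variables \<open>x\<close> of a type is a set \<open>X\<close> of variables, finite or infinite; the
  variables outside \<open>X\<close> are available for \<open>y\<close> in \<open>\<phi>(x,y)\<close>. A value of the tuple \<open>x\<close> is the
  restriction to \<open>X\<close> of a valuation.\<close>

definition complete_types ::
  "('f, 'r) language \<Rightarrow> ('f, 'r, 'a) struct \<Rightarrow> 'v set \<Rightarrow> 'a set \<Rightarrow> ('f, 'r, 'v, 'a) form set set" where
  "complete_types L C X N = {p. p \<subseteq> formulas L N X \<and> consistent_in C p \<and>
    (\<forall>\<phi> \<in> formulas L N X. \<phi> \<in> p \<or> Neg \<phi> \<in> p)}"

definition has_IP ::
  "('f, 'r) language \<Rightarrow> ('f, 'r, 'a) struct \<Rightarrow> 'v set \<Rightarrow> ('f, 'r, 'v, 'a) form set \<Rightarrow> bool" where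
  "has_IP L C X \<pi> \<longleftrightarrow>
    (\<exists>\<phi> \<in> formulas L {} UNIV. \<exists>a :: nat \<Rightarrow> 'v \<Rightarrow> 'a.
      (\<forall>i. a i \<in> vals C \<and> (\<forall>\<psi> \<in> \<pi>. sat C (a i) \<psi>)) \<and>
      (\<forall>s :: nat set. consistent_in C
        (range (\<lambda>i. let \<phi>i = inst (\<lambda>v. if v \<in> X then Some (a i v) else None) \<phi>
                    in if i \<in> s then \<phi>i else Neg \<phi>i))))"

definition NIP_type ::
  "('f, 'r) language \<Rightarrow> ('f, 'r, 'a) struct \<Rightarrow> 'v set \<Rightarrow> ('f, 'r, 'v, 'a) form set \<Rightarrow> bool" where
  "NIP_type L C X \<pi> \<longleftrightarrow> \<not> has_IP L C X \<pi>"

definition splits_wrt ::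
  "(nat \<Rightarrow> 'a list rel) \<Rightarrow> ('f, 'r) language \<Rightarrow> 'v set \<Rightarrow> 'a set \<Rightarrow> ('f, 'r, 'v, 'a) form set \<Rightarrow> bool"
  where
  "splits_wrt R L X N p \<longleftrightarrow>
    (\<exists>ys a b \<phi>. distinct ys \<and> set ys \<inter> X = {} \<and> \<phi> \<in> formulas L {} (X \<union> set ys) \<and>
      length a = length ys \<and> length b = length ys \<and> set a \<subseteq> N \<and> set b \<subseteq> N \<and>
      (a, b) \<in> R (length ys) \<and> inst [ys [\<mapsto>] a] \<phi> \<in> p \<and> Neg (inst [ys [\<mapsto>] b] \<phi>) \<in> p)"

definition Lascar_splits ::
  "('f, 'r) language \<Rightarrow> ('f, 'r, 'a) struct \<Rightarrow> 'k rel \<Rightarrow> 'v set \<Rightarrow> 'a set \<Rightarrow> 'a set \<Rightarrow>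
    ('f, 'r, 'v, 'a) form set \<Rightarrow> bool" where
  "Lascar_splits L C \<kappa> X A N p \<longleftrightarrow> splits_wrt (Lascar_equiv L C \<kappa> A) L X N p"

definition KP_splits ::
  "('f, 'r) language \<Rightarrow> ('f, 'r, 'a) struct \<Rightarrow> 'k rel \<Rightarrow> 'v set \<Rightarrow> 'a set \<Rightarrow> 'a set \<Rightarrow>
    ('f, 'r, 'v, 'a) form set \<Rightarrow> bool" where
  "KP_splits L C \<kappa> X A N p \<longleftrightarrow> splits_wrt (KP_equiv L C \<kappa> A) L X N p"

end

theory Submission
  imports Defs
begin

text \<open>
  Lascar equivalence refines Kim--Pillay equivalence, so a type that Lascar-splits also KP-splits.
  For the converse suppose that \<open>p\<close> does not Lascar-split over \<open>A\<close>. Since \<open>N\<close> contains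
  a tuple of every Lascar strong type over \<open>A\<close>, the type \<open>p\<close> extends to a global type that
  is invariant under Lascar equivalence over \<open>A\<close>, and this type has Morley sequences over \<open>N\<close>, which are
  indiscernible over \<open>N\<close>. The proof has three ideas.

  First, on the conjugates of Morley sequences of a given finite length, Lascar equivalence
  is type-definable: two of them are equivalent if and only if they have a common continuation
  to a longer one (\<open>Ls_iff_common_continuation\<close>).

  Second, Kim--Pillay equivalent tuples \<open>y\<close> and \<open>y'\<close> see the same Morley sequences: for each conjugate \<open>I\<close> of a
  Morley sequence there is a Lascar equivalent \<open>I'\<close> such that \<open>(I, y)\<close> and \<open>(I', y')\<close>
  have the same type over \<open>A\<close>. By the first idea, and since \<open>N\<close> represents all Lascar classes, this defines
  a relation on pairs \<open>(y, y')\<close> that is bounded and type-definable over \<open>A\<close>, so it contains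
  Kim--Pillay equivalence (\<open>KP_subset_Morley_rel\<close>).

  Third, let \<open>\<phi>(x, a)\<close> and \<open>\<not>\<phi>(x, b)\<close> belong to \<open>p\<close> with \<open>a\<close> and \<open>b\<close> Kim--Pillay equivalent. Consider finite
  sequences, Lascar equivalent to Morley sequences, along which the truth value of \<open>\<phi>(x, b)\<close> alternates.
  One that ends with the value true is prolonged by a realization of the global type,
  at which \<open>\<phi>(x, b)\<close> is false. By the second idea there is an equally long sequence alternating in
  the same way for \<open>\<phi>(x, a)\<close>; it ends with the value false and is prolonged by a realization at which
  \<open>\<phi>(x, a)\<close> is true. Going back and forth produces alternations of every length
  (\<open>KP_split_imp_alternates\<close>). By indiscernibility every pattern of truth values is then realized along
  Morley sequences (\<open>alternates_imp_all_patterns\<close>), so \<open>p\<close> has IP.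

  The existence of the two strong types is part of the argument. Every bounded \<open>A\<close>-invariant equivalence
  relation identifies tuples of the same type over \<open>N\<close> (\<open>bounded_invariant_contains_orb_N\<close>), hence the
  finest one is generated by equality of types over the conjugates of \<open>N\<close> (\<open>Lascar_equiv_eq_Ls\<close>).
\<close>

section \<open>Substitution and coincidence\<close>

fun avars :: "('f, 'r, 'v, 'a) form \<Rightarrow> 'v set" where
  "avars (Eq s t) = tvars s \<union> tvars t"
| "avars (Rel r ts) = (\<Union>t \<in> set ts. tvars t)"
| "avars (Neg \<phi>) = avars \<phi>"
| "avars (Conj \<phi> \<psi>) = avars \<phi> \<union> avars \<psi>"
| "avars (Ex v \<phi>) = insert v (avars \<phi>)"

fun subst_trm ::
  "('v \<Rightarrow> ('f, 'w, 'b) trm) \<Rightarrow> ('a \<Rightarrow> ('f, 'w, 'b) trm) \<Rightarrow> ('f, 'v, 'a) trm \<Rightarrow> ('f, 'w, 'b) trm"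
  where
  "subst_trm \<sigma> \<pi> (Var v) = \<sigma> v"
| "subst_trm \<sigma> \<pi> (Par a) = \<pi> a"
| "subst_trm \<sigma> \<pi> (Fn f ts) = Fn f (map (subst_trm \<sigma> \<pi>) ts)"

text \<open>\<open>\<sigma>\<close> replaces free variables, \<open>\<pi>\<close> replaces parameters and \<open>g\<close> renames bound variables. Renaming
  variables, turning parameters into variables and identifying variables are all instances, so
  a single semantic lemma serves for all of them.\<close>

fun subst ::
  "('v \<Rightarrow> 'w) \<Rightarrow> ('v \<Rightarrow> ('f, 'w, 'b) trm) \<Rightarrow> ('a \<Rightarrow> ('f, 'w, 'b) trm) \<Rightarrow>
    ('f, 'r, 'v, 'a) form \<Rightarrow> ('f, 'r, 'w, 'b) form"
  where
  "subst g \<sigma> \<pi> (Eq s t) = Eq (subst_trm \<sigma> \<pi> s) (subst_trm \<sigma> \<pi> t)"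
| "subst g \<sigma> \<pi> (Rel r ts) = Rel r (map (subst_trm \<sigma> \<pi>) ts)"
| "subst g \<sigma> \<pi> (Neg \<phi>) = Neg (subst g \<sigma> \<pi> \<phi>)"
| "subst g \<sigma> \<pi> (Conj \<phi> \<psi>) = Conj (subst g \<sigma> \<pi> \<phi>) (subst g \<sigma> \<pi> \<psi>)"
| "subst g \<sigma> \<pi> (Ex v \<phi>) = Ex (g v) (subst g (\<sigma>(v := Var (g v))) \<pi> \<phi>)"

lemma finite_tvars [simp]: "finite (tvars t)"
  by (induction t) auto

lemma finite_tpars [simp]: "finite (tpars t)"
  by (induction t) auto

lemma finite_avars [simp]: "finite (avars \<phi>)"
  by (induction \<phi>) auto

lemma finite_pars [simp]: "finite (pars \<phi>)"
  by (induction \<phi>) auto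

lemma fv_subset_avars: "fv \<phi> \<subseteq> avars \<phi>"
  by (induction \<phi>) auto

lemma finite_fv [simp]: "finite (fv \<phi>)"
  using fv_subset_avars finite_avars by (rule finite_subset)

lemma eval_cong: "(\<And>v. v \<in> tvars t \<Longrightarrow> e v = e' v) \<Longrightarrow> eval M e t = eval M e' t"
proof (induction t)
  case (Fn f ts)
  then have "map (eval M e) ts = map (eval M e') ts" by (auto intro!: map_cong)
  then show ?case by (simp only: eval.simps)
qed auto

lemma sat_cong: "(\<And>v. v \<in> fv \<phi> \<Longrightarrow> e v = e' v) \<Longrightarrow> sat M e \<phi> \<longleftrightarrow> sat M e' \<phi>"
proof (induction \<phi> arbitrary: e e')
  case (Eq s t)
  then show ?case using eval_cong[of s e e' M] eval_cong[of t e e' M] by auto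
next
  case (Rel r ts)
  then have "map (eval M e) ts = map (eval M e') ts" by (auto intro!: map_cong eval_cong)
  then show ?case by (simp only: sat.simps)
next
  case (Conj \<phi> \<psi>)
  show ?case using Conj.IH(1)[of e e'] Conj.IH(2)[of e e'] Conj.prems by auto
next
  case (Ex v \<phi>)
  have "sat M (e(v := x)) \<phi> \<longleftrightarrow> sat M (e'(v := x)) \<phi>" for x
    by (rule Ex.IH) (use Ex.prems in auto)
  then show ?case by simp
next
  case (Neg \<phi>)
  show ?case using Neg.IH[of e e'] Neg.prems by simp
qed

lemma eval_subst_trm:
  assumes "\<And>a. a \<in> tpars t \<Longrightarrow> eval M e (\<pi> a) = a"
  shows "eval M e (subst_trm \<sigma> \<pi> t) = eval M (\<lambda>v. eval M e (\<sigma> v)) t"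
  using assms
proof (induction t)
  case (Fn f ts)
  then have "map (eval M e) (map (subst_trm \<sigma> \<pi>) ts) = map (eval M (\<lambda>v. eval M e (\<sigma> v))) ts"
    by auto
  then show ?case by (simp only: eval.simps subst_trm.simps)
qed auto

text \<open>No capture occurs because the new terms avoid the range of \<open>g\<close>. The exception
  \<open>\<sigma> v = Var (g v)\<close> is what the induction creates below the quantifier over \<open>v\<close>; there the
  injectivity of \<open>g\<close> keeps the other free variables apart from \<open>g v\<close>.\<close>

lemma sat_subst:
  assumes "inj_on g V" "avars \<phi> \<subseteq> V"
    and "\<And>v. v \<in> fv \<phi> \<Longrightarrow> \<sigma> v = Var (g v) \<or> tvars (\<sigma> v) \<inter> g ` V = {}"
    and "\<And>a. a \<in> pars \<phi> \<Longrightarrow> tvars (\<pi> a) \<inter> g ` V = {} \<and> eval M e (\<pi> a) = a"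
  shows "sat M e (subst g \<sigma> \<pi> \<phi>) \<longleftrightarrow> sat M (\<lambda>v. eval M e (\<sigma> v)) \<phi>"
  using assms
proof (induction \<phi> arbitrary: e \<sigma>)
  case (Eq s t)
  then show ?case by (simp add: eval_subst_trm)
next
  case (Rel r ts)
  have "eval M e (subst_trm \<sigma> \<pi> t) = eval M (\<lambda>v. eval M e (\<sigma> v)) t" if "t \<in> set ts" for t
    by (rule eval_subst_trm) (use Rel.prems(4) that in auto)
  then have "map (eval M e) (map (subst_trm \<sigma> \<pi>) ts) = map (eval M (\<lambda>v. eval M e (\<sigma> v))) ts"
    by auto
  then show ?case by (simp only: sat.simps subst.simps)
next
  case (Neg \<phi>)
  then show ?case by simp
next
  case (Conj \<phi> \<psi>)
  show ?case using Conj.IH(1)[of \<sigma> e] Conj.IH(2)[of \<sigma> e] Conj.prems by auto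
next
  case (Ex v \<phi>)
  have v: "v \<in> V" using Ex.prems(2) by auto
  have "sat M (e(g v := x)) (subst g (\<sigma>(v := Var (g v))) \<pi> \<phi>) \<longleftrightarrow>
      sat M ((\<lambda>v. eval M e (\<sigma> v))(v := x)) \<phi>" for x
  proof -
    have "sat M (e(g v := x)) (subst g (\<sigma>(v := Var (g v))) \<pi> \<phi>) \<longleftrightarrow>
      sat M (\<lambda>w. eval M (e(g v := x)) ((\<sigma>(v := Var (g v))) w)) \<phi>"
    proof (rule Ex.IH)
      show "inj_on g V" "avars \<phi> \<subseteq> V" using Ex.prems by auto
      show "(\<sigma>(v := Var (g v))) w = Var (g w) \<or> tvars ((\<sigma>(v := Var (g v))) w) \<inter> g ` V = {}"
        if "w \<in> fv \<phi>" for w using Ex.prems(3)[of w] that by auto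
      fix a assume "a \<in> pars \<phi>"
      then have a: "tvars (\<pi> a) \<inter> g ` V = {} \<and> eval M e (\<pi> a) = a" using Ex.prems(4)[of a] by simp
      have "eval M (e(g v := x)) (\<pi> a) = eval M e (\<pi> a)"
        by (rule eval_cong) (use a v in auto)
      with a show "tvars (\<pi> a) \<inter> g ` V = {} \<and> eval M (e(g v := x)) (\<pi> a) = a" by simp
    qed
    also have "\<dots> \<longleftrightarrow> sat M ((\<lambda>v. eval M e (\<sigma> v))(v := x)) \<phi>"
    proof (rule sat_cong)
      fix w assume w: "w \<in> fv \<phi>"
      show "eval M (e(g v := x)) ((\<sigma>(v := Var (g v))) w) = ((\<lambda>v. eval M e (\<sigma> v))(v := x)) w"
      proof (cases "w = v")
        case False
        have "w \<in> V" using w fv_subset_avars[of \<phi>] Ex.prems(2) by auto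
        then have "g w \<noteq> g v" using False v Ex.prems(1) by (auto dest: inj_onD)
        moreover have "\<sigma> w = Var (g w) \<or> tvars (\<sigma> w) \<inter> g ` V = {}"
          using Ex.prems(3)[of w] w False by auto
        ultimately have "eval M (e(g v := x)) (\<sigma> w) = eval M e (\<sigma> w)"
          using v by (intro eval_cong) auto
        then show ?thesis using False by simp
      qed simp
    qed
    finally show ?thesis .
  qed
  then show ?case by simp
qed

lemma wf_subst_trm:
  "wf_trm L t \<Longrightarrow> (\<And>v. v \<in> tvars t \<Longrightarrow> wf_trm L (\<sigma> v)) \<Longrightarrow>
    (\<And>a. a \<in> tpars t \<Longrightarrow> wf_trm L (\<pi> a)) \<Longrightarrow> wf_trm L (subst_trm \<sigma> \<pi> t)"
proof (induction t)
  case (Fn f ts)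
  have "wf_trm L (subst_trm \<sigma> \<pi> t)" if "t \<in> set ts" for t
    by (rule Fn.IH) (use Fn.prems that in auto)
  then show ?case using Fn.prems(1) by simp
qed auto

lemma wf_subst:
  "wf_form L \<phi> \<Longrightarrow> (\<And>v. v \<in> fv \<phi> \<Longrightarrow> wf_trm L (\<sigma> v)) \<Longrightarrow>
    (\<And>a. a \<in> pars \<phi> \<Longrightarrow> wf_trm L (\<pi> a)) \<Longrightarrow> wf_form L (subst g \<sigma> \<pi> \<phi>)"
  by (induction \<phi> arbitrary: \<sigma>) (auto intro!: wf_subst_trm)

lemma tvars_subst_trm:
  "tvars (subst_trm \<sigma> \<pi> t) \<subseteq> (\<Union>v\<in>tvars t. tvars (\<sigma> v)) \<union> (\<Union>a\<in>tpars t. tvars (\<pi> a))"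
  by (induction t) (auto, blast)

lemma tpars_subst_trm:
  "tpars (subst_trm \<sigma> \<pi> t) \<subseteq> (\<Union>v\<in>tvars t. tpars (\<sigma> v)) \<union> (\<Union>a\<in>tpars t. tpars (\<pi> a))"
  by (induction t) (auto, blast)

lemma fv_subst:
  "fv (subst g \<sigma> \<pi> \<phi>) \<subseteq> (\<Union>v\<in>fv \<phi>. tvars (\<sigma> v)) \<union> (\<Union>a\<in>pars \<phi>. tvars (\<pi> a))"
proof (induction \<phi> arbitrary: \<sigma>)
  case (Eq s t)
  then show ?case using tvars_subst_trm[of \<sigma> \<pi> s] tvars_subst_trm[of \<sigma> \<pi> t] by auto
next
  case (Rel r ts)
  show ?case by (auto dest!: subsetD[OF tvars_subst_trm])
next
  case (Ex v \<phi>)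
  have "fv (subst g (\<sigma>(v := Var (g v))) \<pi> \<phi>) - {g v}
    \<subseteq> (\<Union>w\<in>fv \<phi> - {v}. tvars (\<sigma> w)) \<union> (\<Union>a\<in>pars \<phi>. tvars (\<pi> a))"
  proof
    fix x assume x: "x \<in> fv (subst g (\<sigma>(v := Var (g v))) \<pi> \<phi>) - {g v}"
    then consider w where "w \<in> fv \<phi>" "x \<in> tvars ((\<sigma>(v := Var (g v))) w)"
      | "x \<in> (\<Union>a\<in>pars \<phi>. tvars (\<pi> a))"
      using Ex.IH[of "\<sigma>(v := Var (g v))"] by blast
    then show "x \<in> (\<Union>w\<in>fv \<phi> - {v}. tvars (\<sigma> w)) \<union> (\<Union>a\<in>pars \<phi>. tvars (\<pi> a))"
    proof cases
      case (1 w)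
      then show ?thesis using x by (cases "w = v") auto
    qed simp
  qed
  then show ?case by simp
qed (auto, blast+)

lemma pars_subst:
  "pars (subst g \<sigma> \<pi> \<phi>) \<subseteq> (\<Union>v\<in>fv \<phi>. tpars (\<sigma> v)) \<union> (\<Union>a\<in>pars \<phi>. tpars (\<pi> a))"
proof (induction \<phi> arbitrary: \<sigma>)
  case (Eq s t)
  then show ?case using tpars_subst_trm[of \<sigma> \<pi> s] tpars_subst_trm[of \<sigma> \<pi> t] by auto
next
  case (Rel r ts)
  show ?case by (auto dest!: subsetD[OF tpars_subst_trm])
next
  case (Ex v \<phi>)
  have "pars (subst g (\<sigma>(v := Var (g v))) \<pi> \<phi>)
    \<subseteq> (\<Union>w\<in>fv \<phi> - {v}. tpars (\<sigma> w)) \<union> (\<Union>a\<in>pars \<phi>. tpars (\<pi> a))"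
  proof
    fix x assume x: "x \<in> pars (subst g (\<sigma>(v := Var (g v))) \<pi> \<phi>)"
    then consider w where "w \<in> fv \<phi>" "x \<in> tpars ((\<sigma>(v := Var (g v))) w)"
      | "x \<in> (\<Union>a\<in>pars \<phi>. tpars (\<pi> a))"
      using Ex.IH[of "\<sigma>(v := Var (g v))"] by blast
    then show "x \<in> (\<Union>w\<in>fv \<phi> - {v}. tpars (\<sigma> w)) \<union> (\<Union>a\<in>pars \<phi>. tpars (\<pi> a))"
    proof cases
      case (1 w)
      then show ?thesis using x by (cases "w = v") auto
    qed simp
  qed
  then show ?case by simp
qed (auto, blast+)

lemma eval_inst_trm:
  "eval M e (inst_trm \<rho> t) = eval M (\<lambda>v. case \<rho> v of None \<Rightarrow> e v | Some a \<Rightarrow> a) t"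
proof (induction t)
  case (Fn f ts)
  then have "map (eval M e) (map (inst_trm \<rho>) ts) =
      map (eval M (\<lambda>v. case \<rho> v of None \<Rightarrow> e v | Some a \<Rightarrow> a)) ts" by auto
  then show ?case by (simp only: eval.simps inst_trm.simps)
qed (auto split: option.splits)

lemma sat_inst:
  "sat M e (inst \<rho> \<phi>) \<longleftrightarrow> sat M (\<lambda>v. case \<rho> v of None \<Rightarrow> e v | Some a \<Rightarrow> a) \<phi>"
proof (induction \<phi> arbitrary: e \<rho>)
  case (Rel r ts)
  have "map (eval M e) (map (inst_trm \<rho>) ts) =
      map (eval M (\<lambda>v. case \<rho> v of None \<Rightarrow> e v | Some a \<Rightarrow> a)) ts"
    by (auto simp: eval_inst_trm)
  then show ?case by (simp only: sat.simps inst.simps)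
next
  case (Ex v \<phi>)
  have *: "(\<lambda>w. case (\<rho>(v := None)) w of None \<Rightarrow> (e(v := x)) w | Some a \<Rightarrow> a) =
      (\<lambda>w. case \<rho> w of None \<Rightarrow> e w | Some a \<Rightarrow> a)(v := x)" for x
    by (rule ext) (auto split: option.splits)
  show ?case by (simp only: inst.simps sat.simps Ex.IH *)
qed (auto simp: eval_inst_trm)

lemma inst_trm_props:
  "wf_trm L t \<Longrightarrow> wf_trm L (inst_trm \<rho> t)"
  "tpars (inst_trm \<rho> t) \<subseteq> tpars t \<union> ran \<rho>"
  "tvars (inst_trm \<rho> t) = tvars t - dom \<rho>"
  by (induction t) (auto split: option.splits simp: ranI dom_def)

lemma wf_inst: "wf_form L \<phi> \<Longrightarrow> wf_form L (inst \<rho> \<phi>)"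
  by (induction \<phi> arbitrary: \<rho>) (auto simp: inst_trm_props)

lemma pars_inst: "pars (inst \<rho> \<phi>) \<subseteq> pars \<phi> \<union> ran \<rho>"
proof (induction \<phi> arbitrary: \<rho>)
  case (Eq s t)
  then show ?case using inst_trm_props(2)[of \<rho> s] inst_trm_props(2)[of \<rho> t] by auto
next
  case (Rel r ts)
  show ?case by (auto dest!: subsetD[OF inst_trm_props(2)])
next
  case (Ex v \<phi>)
  have "ran (\<rho>(v := None)) \<subseteq> ran \<rho>" by (auto simp: ran_def)
  then show ?case using Ex[of "\<rho>(v := None)"] by (simp del: fun_upd_apply, blast)
next
  case (Neg \<phi>)
  then show ?case by simp
next
  case (Conj \<phi> \<psi>)
  show ?case using Conj(1)[of \<rho>] Conj(2)[of \<rho>] by auto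
qed

lemma fv_inst: "fv (inst \<rho> \<phi>) = fv \<phi> - dom \<rho>"
  by (induction \<phi> arbitrary: \<rho>) (auto simp: inst_trm_props(3))

lemma inj_on_into:
  assumes "finite W" "infinite Z"
  shows "\<exists>g. inj_on g W \<and> g ` W \<subseteq> Z"
proof -
  obtain B where B: "finite B" "card B = card W" "B \<subseteq> Z"
    using infinite_arbitrarily_large[OF assms(2)] by blast
  then obtain h where "bij_betw h W B"
    using finite_same_card_bij[OF assms(1)] by metis
  then show ?thesis using B unfolding bij_betw_def by blast
qed

section \<open>The monster model: cardinals and automorphisms\<close>

locale monster_model =
  fixes L :: "('f, 'r) language"
    and C :: "('f, 'r, 'a) struct"
    and \<kappa> :: "'k rel"
  assumes structure_C: "structure_of L C"
    and Card_order_\<kappa>: "Card_order \<kappa>"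
    and small_empty: "small L C \<kappa> {}"
    and saturated_C: "saturated L C \<kappa>"
    and homogeneous_C: "strongly_homogeneous L C \<kappa>"
begin

lemma univ_nonempty: "univ C \<noteq> {}"
  using structure_C unfolding structure_of_def by blast

text \<open>The formulas \<open>v\<^sub>n = v\<^sub>n\<close> are infinitely many, so smallness of the empty set makes \<open>\<kappa>\<close> uncountable.\<close>

lemma infinite_Field: "infinite (Field \<kappa>)"
proof
  assume fin: "finite (Field \<kappa>)"
  let ?F = "formulas L {} UNIV :: ('f, 'r, nat, 'a) form set"
  have "|Pow ?F| <o \<kappa>" using small_empty unfolding small_def by simp
  then have "|Pow ?F| \<le>o |Field \<kappa>|"
    using card_of_Field_ordIso[OF Card_order_\<kappa>] ordIso_symmetric ordLeq_ordIso_trans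
      ordLess_imp_ordLeq by blast
  then have "finite (Pow ?F)" using fin card_of_ordLeq_finite by blast
  then have "finite ?F" by simp
  moreover have "inj (\<lambda>n. Eq (Var n) (Var n) :: ('f, 'r, nat, 'a) form)" by (auto intro: injI)
  moreover have "range (\<lambda>n. Eq (Var n) (Var n) :: ('f, 'r, nat, 'a) form) \<subseteq> ?F"
    by (auto simp: formulas_def)
  ultimately show False by (meson finite_imageD finite_subset infinite_UNIV_nat)
qed

lemma finite_less: "finite B \<Longrightarrow> |B| <o \<kappa>"
  using finite_ordLess_infinite[OF card_of_Well_order
      card_order_on_well_order_on[OF Card_order_\<kappa>], of B] infinite_Field
  by (simp add: Field_card_of)

lemma Un_less: "|A| <o \<kappa> \<Longrightarrow> |B| <o \<kappa> \<Longrightarrow> |A \<union> B| <o \<kappa>"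
  using card_of_Un_ordLess_infinite_Field[OF infinite_Field Card_order_\<kappa>] .

lemma image_less: "|A| <o \<kappa> \<Longrightarrow> |f ` A| <o \<kappa>"
  using card_of_image ordLeq_ordLess_trans by blast

lemma subset_less: "A \<subseteq> B \<Longrightarrow> |B| <o \<kappa> \<Longrightarrow> |A| <o \<kappa>"
  using card_of_mono1 ordLeq_ordLess_trans by blast

lemma small_imp_less:
  assumes "small L C \<kappa> B" shows "|B| <o \<kappa>"
proof -
  let ?F = "formulas L B UNIV :: ('f, 'r, nat, 'a) form set"
  let ?h = "\<lambda>b. {Eq (Par b) (Par b)} :: ('f, 'r, nat, 'a) form set"
  have "?h ` B \<subseteq> Pow ?F" by (auto simp: formulas_def)
  moreover have "inj_on ?h B" by (auto intro: inj_onI)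
  ultimately have "|B| \<le>o |Pow ?F|" using card_of_ordLeq[of B "Pow ?F"] by blast
  then show ?thesis using assms ordLeq_ordLess_trans unfolding small_def by blast
qed

lemma small_imp_subset: "small L C \<kappa> B \<Longrightarrow> B \<subseteq> univ C"
  unfolding small_def by simp

abbreviation Auts :: "'a set \<Rightarrow> ('a \<Rightarrow> 'a) set" where
  "Auts \<equiv> automorphisms L C"

lemma Auts_univ: "g \<in> Auts A \<Longrightarrow> x \<in> univ C \<Longrightarrow> g x \<in> univ C"
  unfolding automorphisms_def bij_betw_def by blast

lemma Auts_fix: "g \<in> Auts A \<Longrightarrow> x \<in> A \<Longrightarrow> g x = x"
  unfolding automorphisms_def by blast

lemma Auts_map_fix: "g \<in> Auts A \<Longrightarrow> set a \<subseteq> A \<Longrightarrow> map g a = a"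
  by (simp add: Auts_fix map_idI subset_iff)

lemma Auts_mono: "A \<subseteq> B \<Longrightarrow> Auts B \<subseteq> Auts A"
  unfolding automorphisms_def by auto

lemma Auts_tuples: "g \<in> Auts A \<Longrightarrow> a \<in> tuples C n \<Longrightarrow> map g a \<in> tuples C n"
  using Auts_univ unfolding tuples_def by fastforce

lemma Auts_id: "id \<in> Auts A"
  unfolding automorphisms_def by simp

lemma Auts_comp:
  assumes "g \<in> Auts A" "h \<in> Auts A" shows "g \<circ> h \<in> Auts A"
proof -
  have "bij_betw (g \<circ> h) (univ C) (univ C)"
    using assms bij_betw_trans unfolding automorphisms_def by blast
  moreover have "g (h (fint C f a)) = fint C f (map (g \<circ> h) a)"
    if "fun_ar L f = Some n" "a \<in> tuples C n" for f n a
    using assms that Auts_tuples[OF assms(2) that(2)] unfolding automorphisms_def by simp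
  moreover have "rint C r (map (g \<circ> h) a) \<longleftrightarrow> rint C r a"
    if "rel_ar L r = Some n" "a \<in> tuples C n" for r n a
    using assms that Auts_tuples[OF assms(2) that(2)] unfolding automorphisms_def
    by (simp flip: map_map)
  ultimately show ?thesis using assms unfolding automorphisms_def by simp
qed

lemma Auts_inverse:
  assumes "g \<in> Auts A" "A \<subseteq> univ C"
  obtains h where "h \<in> Auts A" "\<And>x. x \<in> univ C \<Longrightarrow> h (g x) = x" "\<And>x. x \<in> univ C \<Longrightarrow> g (h x) = x"
proof -
  let ?h = "inv_into (univ C) g"
  have bij: "bij_betw g (univ C) (univ C)" using assms unfolding automorphisms_def by blast
  have hg: "?h (g x) = x" if "x \<in> univ C" for x
    using bij that by (simp add: bij_betw_def)
  have gh: "g (?h x) = x" if "x \<in> univ C" for x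
    using bij that by (simp add: bij_betw_inv_into_right)
  have bijh: "bij_betw ?h (univ C) (univ C)" using bij bij_betw_inv_into by blast
  then have hu: "?h x \<in> univ C" if "x \<in> univ C" for x using that unfolding bij_betw_def by blast
  have ht: "map ?h a \<in> tuples C n" and ght: "map g (map ?h a) = a" if "a \<in> tuples C n" for a n
    using that hu gh unfolding tuples_def by (auto intro!: map_idI)
  have "?h (fint C f a) = fint C f (map ?h a)" if "fun_ar L f = Some n" "a \<in> tuples C n" for f n a
  proof -
    have "fint C f (map ?h a) \<in> univ C"
      using structure_C that(1) ht[OF that(2)] unfolding structure_of_def by blast
    moreover have "g (fint C f (map ?h a)) = fint C f (map g (map ?h a))"
      using assms(1) that(1) ht[OF that(2)] unfolding automorphisms_def by blast
    ultimately show ?thesis using ght[OF that(2)] hg by metis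
  qed
  moreover have "rint C r (map ?h a) \<longleftrightarrow> rint C r a" if "rel_ar L r = Some n" "a \<in> tuples C n" for r n a
  proof -
    have "rint C r (map g (map ?h a)) \<longleftrightarrow> rint C r (map ?h a)"
      using assms(1) that(1) ht[OF that(2)] unfolding automorphisms_def by blast
    then show ?thesis using ght[OF that(2)] by metis
  qed
  moreover have "?h a = a" if "a \<in> A" for a
    using hg[of a] assms that Auts_fix[OF assms(1) that] by auto
  ultimately have "?h \<in> Auts A" using bijh unfolding automorphisms_def by blast
  then show ?thesis using that hg gh by blast
qed

text \<open>Conjugacy over \<open>B\<close> takes the place of equality of types over \<open>B\<close>: by strong homogeneity the two
  agree for \<open>|B| <o \<kappa>\<close>, and conjugacy needs no formulas.\<close>

definition orb :: "'a set \<Rightarrow> 'a list \<Rightarrow> 'a list \<Rightarrow> bool" where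
  "orb B a b \<longleftrightarrow> (\<exists>g \<in> Auts B. b = map g a)"

lemma orb_refl: "orb B a a"
  unfolding orb_def using Auts_id by (metis list.map_id)

lemma orb_trans: "orb B a b \<Longrightarrow> orb B b c \<Longrightarrow> orb B a c"
  unfolding orb_def using Auts_comp by (metis list.map_comp)

text \<open>The inverse of an automorphism is available only on \<open>univ C\<close>.\<close>

lemma orb_sym:
  assumes "orb B a b" "B \<subseteq> univ C" "set a \<subseteq> univ C" shows "orb B b a"
proof -
  obtain g where g: "g \<in> Auts B" "b = map g a" using assms unfolding orb_def by blast
  obtain h where h: "h \<in> Auts B" "\<And>x. x \<in> univ C \<Longrightarrow> h (g x) = x"
    using Auts_inverse[OF g(1) assms(2)] by blast
  have "map h b = a" using g h assms(3) by (auto intro!: map_idI)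
  then show ?thesis using h(1) unfolding orb_def by metis
qed

lemma orb_mono: "A \<subseteq> B \<Longrightarrow> orb B a b \<Longrightarrow> orb A a b"
  unfolding orb_def using Auts_mono by blast

lemma orb_tuples: "orb B a b \<Longrightarrow> a \<in> tuples C n \<Longrightarrow> b \<in> tuples C n"
  unfolding orb_def using Auts_tuples by blast

lemma orb_fix: "orb B a b \<Longrightarrow> set c \<subseteq> B \<Longrightarrow> orb B (a @ c) (b @ c)"
  unfolding orb_def by (auto simp: Auts_fix subset_iff intro!: bexI map_idI[symmetric])

section \<open>Definable sets\<close>

text \<open>Variables beyond the length of the tuple get an element of the model, so that the result is
  a valuation.\<close>

definition nenv :: "'a list \<Rightarrow> nat \<Rightarrow> 'a" where
  "nenv a i = (if i < length a then a ! i else (SOME u. u \<in> univ C))"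

lemma nenv_nth [simp]: "i < length a \<Longrightarrow> nenv a i = a ! i"
  by (simp add: nenv_def)

lemma nenv_vals: "a \<in> tuples C n \<Longrightarrow> nenv a \<in> vals C"
proof -
  assume a: "a \<in> tuples C n"
  have "(SOME u. u \<in> univ C) \<in> univ C" using univ_nonempty by (simp add: some_in_eq)
  then show ?thesis using a unfolding vals_def nenv_def tuples_def
    by (auto simp: in_set_conv_nth subset_iff)
qed

lemma take_drop_tuples:
  assumes "x \<in> tuples C (k + l)"
  shows "take k x \<in> tuples C k" "drop k x \<in> tuples C l"
  using assms set_take_subset[of k x] set_drop_subset[of k x] by (auto simp: tuples_def)

text \<open>Definable sets of tuples and their closure properties let the arguments about types be carried out
  with sets and conjugacy in place of formulas.\<close>

definition dset :: "'a set \<Rightarrow> nat \<Rightarrow> 'a list set \<Rightarrow> bool" where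
  "dset B n S \<longleftrightarrow> (\<exists>\<phi> :: ('f, 'r, nat, 'a) form. \<phi> \<in> formulas L B {..<n} \<and>
    S = {a \<in> tuples C n. sat C (nenv a) \<phi>})"

lemma dset_subset: "dset B n S \<Longrightarrow> S \<subseteq> tuples C n"
  unfolding dset_def by blast

lemma dset_mono: "dset A n S \<Longrightarrow> A \<subseteq> B \<Longrightarrow> dset B n S"
  unfolding dset_def formulas_def by blast

lemma dset_Int:
  assumes "dset B n S" "dset B n S'" shows "dset B n (S \<inter> S')"
proof -
  obtain \<phi> \<psi> :: "('f, 'r, nat, 'a) form" where
    "\<phi> \<in> formulas L B {..<n}" "S = {a \<in> tuples C n. sat C (nenv a) \<phi>}"
    "\<psi> \<in> formulas L B {..<n}" "S' = {a \<in> tuples C n. sat C (nenv a) \<psi>}"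
    using assms unfolding dset_def by blast
  then show ?thesis unfolding dset_def
    by (intro exI[of _ "Conj \<phi> \<psi>"]) (auto simp: formulas_def)
qed

lemma dset_Compl:
  assumes "dset B n S" shows "dset B n (tuples C n - S)"
proof -
  obtain \<phi> :: "('f, 'r, nat, 'a) form" where
    "\<phi> \<in> formulas L B {..<n}" "S = {a \<in> tuples C n. sat C (nenv a) \<phi>}"
    using assms unfolding dset_def by blast
  then show ?thesis unfolding dset_def
    by (intro exI[of _ "Neg \<phi>"]) (auto simp: formulas_def)
qed

lemma dset_tuples: "dset B n (tuples C n)"
  using univ_nonempty unfolding dset_def
  by (intro exI[of _ "Ex 0 (Eq (Var 0) (Var 0))"]) (auto simp: formulas_def)

lemma dset_Un:
  assumes "dset B n S" "dset B n S'" shows "dset B n (S \<union> S')"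
proof -
  have "S \<union> S' = tuples C n - ((tuples C n - S) \<inter> (tuples C n - S'))"
    using assms dset_subset by blast
  then show ?thesis using assms dset_Compl dset_Int by metis
qed

lemma dset_INT:
  "finite F \<Longrightarrow> (\<And>D. D \<in> F \<Longrightarrow> dset B n D) \<Longrightarrow> dset B n {a \<in> tuples C n. \<forall>D \<in> F. a \<in> D}"
proof (induction F rule: finite_induct)
  case empty
  then show ?case by (simp add: dset_tuples)
next
  case (insert D F)
  have "{a \<in> tuples C n. \<forall>D \<in> insert D F. a \<in> D} = D \<inter> {a \<in> tuples C n. \<forall>D \<in> F. a \<in> D}"
    using insert.prems dset_subset by blast
  then show ?case using insert dset_Int by simp
qed

text \<open>Bound variables are renamed to indices \<open>\<ge> n\<close>, which keeps them away from the variables of the tuple;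
  hence several free variables may be sent to the same index.\<close>

lemma dset_formula:
  fixes \<phi> :: "('f, 'r, 'v, 'a) form"
  assumes "wf_form L \<phi>" "pars \<phi> \<subseteq> B"
    and \<sigma>: "\<And>v. v \<in> fv \<phi> \<Longrightarrow> (\<exists>i<n. \<sigma> v = Var i) \<or> (\<exists>b\<in>B. \<sigma> v = Par b)"
  shows "dset B n {a \<in> tuples C n. sat C (\<lambda>v. eval C (nenv a) (\<sigma> v)) \<phi>}"
proof -
  obtain g :: "'v \<Rightarrow> nat" where g: "inj_on g (avars \<phi>)" "g ` avars \<phi> \<subseteq> {n..}"
    using inj_on_into[OF finite_avars infinite_Ici] by metis
  let ?\<psi> = "subst g \<sigma> Par \<phi>"
  have disj: "tvars (\<sigma> v) \<inter> g ` avars \<phi> = {}" if "v \<in> fv \<phi>" for v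
    using \<sigma>[OF that] g(2) by force
  have "wf_form L ?\<psi>"
  proof (rule wf_subst)
    show "wf_trm L (\<sigma> v)" if "v \<in> fv \<phi>" for v using \<sigma>[OF that] by auto
  qed (use assms in auto)
  moreover have "pars ?\<psi> \<subseteq> B" using pars_subst[of g \<sigma> Par \<phi>] \<sigma> assms(2) by fastforce
  moreover have "fv ?\<psi> \<subseteq> {..<n}" using fv_subst[of g \<sigma> Par \<phi>] \<sigma> by fastforce
  moreover have "sat C (nenv a) ?\<psi> \<longleftrightarrow> sat C (\<lambda>v. eval C (nenv a) (\<sigma> v)) \<phi>" for a
    by (rule sat_subst[OF g(1)]) (use disj in auto)
  ultimately show ?thesis unfolding dset_def formulas_def
    by (intro exI[of _ ?\<psi>]) auto
qed

lemma dset_select: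
  assumes "dset B n D" "length js = n" "\<And>j. j \<in> set js \<Longrightarrow> j < m"
  shows "dset B m {a \<in> tuples C m. map ((!) a) js \<in> D}"
proof -
  obtain \<phi> :: "('f, 'r, nat, 'a) form" where
    \<phi>: "\<phi> \<in> formulas L B {..<n}" "D = {a \<in> tuples C n. sat C (nenv a) \<phi>}"
    using assms(1) unfolding dset_def by blast
  have "dset B m {a \<in> tuples C m. sat C (\<lambda>v. eval C (nenv a) (Var (js ! v))) \<phi>}"
    by (rule dset_formula) (use \<phi>(1) assms in \<open>auto simp: formulas_def\<close>)
  moreover have "sat C (\<lambda>v. eval C (nenv a) (Var (js ! v))) \<phi> \<longleftrightarrow> map ((!) a) js \<in> D"
    if a: "a \<in> tuples C m" for a
  proof -
    have "map ((!) a) js \<in> tuples C n" using a assms(2,3) unfolding tuples_def by fastforce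
    moreover have "sat C (\<lambda>v. eval C (nenv a) (Var (js ! v))) \<phi> \<longleftrightarrow> sat C (nenv (map ((!) a) js)) \<phi>"
    proof (rule sat_cong)
      fix v assume "v \<in> fv \<phi>"
      then have "v < n" using \<phi>(1) by (auto simp: formulas_def)
      then show "eval C (nenv a) (Var (js ! v)) = nenv (map ((!) a) js) v"
        using assms(2,3) a by (simp add: tuples_def)
    qed
    ultimately show ?thesis using \<phi>(2) by simp
  qed
  ultimately show ?thesis by (metis (mono_tags, lifting) Collect_cong)
qed

lemma dset_fix:
  assumes "dset B (n + k) S" "length b = k" "set b \<subseteq> B" "set b \<subseteq> univ C"
  shows "dset B n {a \<in> tuples C n. a @ b \<in> S}"
proof -
  obtain \<phi> :: "('f, 'r, nat, 'a) form" where
    \<phi>: "\<phi> \<in> formulas L B {..<n + k}" "S = {a \<in> tuples C (n + k). sat C (nenv a) \<phi>}"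
    using assms(1) unfolding dset_def by blast
  define \<sigma> :: "nat \<Rightarrow> ('f, nat, 'a) trm" where
    "\<sigma> = (\<lambda>v. if v < n then Var v else Par (b ! (v - n)))"
  have "dset B n {a \<in> tuples C n. sat C (\<lambda>v. eval C (nenv a) (\<sigma> v)) \<phi>}"
  proof (rule dset_formula)
    fix v assume "v \<in> fv \<phi>"
    then have "v < n + k" using \<phi>(1) by (auto simp: formulas_def)
    then have "\<not> v < n \<Longrightarrow> b ! (v - n) \<in> B" using assms(2,3)
      by (metis add_diff_inverse_nat nat_add_left_cancel_less nth_mem subsetD)
    then show "(\<exists>i<n. \<sigma> v = Var i) \<or> (\<exists>b\<in>B. \<sigma> v = Par b)" unfolding \<sigma>_def by auto
  qed (use \<phi>(1) in \<open>auto simp: formulas_def\<close>)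
  moreover have "sat C (\<lambda>v. eval C (nenv a) (\<sigma> v)) \<phi> \<longleftrightarrow> a @ b \<in> S" if a: "a \<in> tuples C n" for a
  proof -
    have "sat C (\<lambda>v. eval C (nenv a) (\<sigma> v)) \<phi> \<longleftrightarrow> sat C (nenv (a @ b)) \<phi>"
    proof (rule sat_cong)
      fix v assume "v \<in> fv \<phi>"
      then have "v < n + k" using \<phi>(1) by (auto simp: formulas_def)
      then show "eval C (nenv a) (\<sigma> v) = nenv (a @ b) v"
        using a assms(2) by (auto simp: \<sigma>_def nenv_def nth_append tuples_def)
    qed
    then show ?thesis using \<phi>(2) a assms unfolding tuples_def by auto
  qed
  ultimately show ?thesis by (metis (mono_tags, lifting) Collect_cong)
qed

lemma map_nth_block: "map ((!) (u @ v @ w)) [length u..<length u + length v] = v"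
  by (rule nth_equalityI) (simp_all add: nth_append)

lemma dset_fix_front:
  assumes "dset B (n + k) S" "a \<in> tuples C n" "set a \<subseteq> B"
  shows "dset B k {b \<in> tuples C k. a @ b \<in> S}"
proof -
  let ?js = "[k..<k + n] @ [0..<k]"
  let ?S = "{x \<in> tuples C (k + n). map ((!) x) ?js \<in> S}"
  have a: "length a = n" "set a \<subseteq> univ C" using assms(2) by (simp_all add: tuples_def)
  have "dset B (k + n) ?S" by (rule dset_select[OF assms(1)]) auto
  then have "dset B k {b \<in> tuples C k. b @ a \<in> ?S}" by (rule dset_fix[OF _ a(1) assms(3) a(2)])
  moreover have "b @ a \<in> ?S \<longleftrightarrow> a @ b \<in> S" if b: "b \<in> tuples C k" for b
  proof -
    have "length b = k" using b by (simp add: tuples_def)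
    then have "map ((!) (b @ a)) ?js = a @ b"
      using map_nth_block[of b a "[]"] map_nth_block[of "[]" b a] a(1) by simp
    moreover have "b @ a \<in> tuples C (k + n)" using a b by (auto simp: tuples_def)
    ultimately show ?thesis by simp
  qed
  ultimately show ?thesis by (metis (mono_tags, lifting) Collect_cong)
qed

text \<open>The parameters of the formula are listed as \<open>b\<close> and become the variables \<open>n, n + 1, \<dots>\<close>, while
  the other variables from \<open>n\<close> on are shifted out of the way.\<close>

lemma dset_parameters:
  assumes "dset B n S" "B \<subseteq> univ C"
  obtains b S0 where "set b \<subseteq> B" "dset {} (n + length b) S0" "S = {a \<in> tuples C n. a @ b \<in> S0}"
proof -
  obtain \<phi> :: "('f, 'r, nat, 'a) form" where
    \<phi>: "\<phi> \<in> formulas L B {..<n}" "S = {a \<in> tuples C n. sat C (nenv a) \<phi>}"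
    using assms(1) unfolding dset_def by blast
  obtain b where b: "set b = pars \<phi>" using finite_list[OF finite_pars] by metis
  have "\<forall>x \<in> pars \<phi>. \<exists>i. i < length b \<and> b ! i = x"
    by (simp flip: b in_set_conv_nth)
  from bchoice[OF this] obtain ix where
    ix: "\<And>x. x \<in> pars \<phi> \<Longrightarrow> ix x < length b \<and> b ! (ix x) = x"
    by blast
  let ?k = "length b"
  define g :: "nat \<Rightarrow> nat" where "g = (\<lambda>v. if v < n then v else v + ?k)"
  let ?\<sigma> = "\<lambda>v. Var (g v) :: ('f, nat, 'a) trm"
  let ?\<pi> = "\<lambda>x. Var (n + ix x) :: ('f, nat, 'a) trm"
  let ?\<psi> = "subst g ?\<sigma> ?\<pi> \<phi>"
  have g: "inj g" unfolding g_def inj_on_def by auto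
  have fv: "v < n" if "v \<in> fv \<phi>" for v using \<phi>(1) that by (auto simp: formulas_def)
  have "wf_form L ?\<psi>" by (rule wf_subst) (use \<phi> in \<open>auto simp: formulas_def\<close>)
  moreover have "pars ?\<psi> \<subseteq> {}" using pars_subst[of g ?\<sigma> ?\<pi> \<phi>] by auto
  moreover have "fv ?\<psi> \<subseteq> {..<n + ?k}"
    using fv_subst[of g ?\<sigma> ?\<pi> \<phi>] fv ix by (fastforce simp: g_def)
  ultimately have D: "dset {} (n + ?k) {a \<in> tuples C (n + ?k). sat C (nenv a) ?\<psi>}"
    unfolding dset_def formulas_def by blast
  have "sat C (nenv (a @ b)) ?\<psi> \<longleftrightarrow> sat C (nenv a) \<phi>" if a: "a \<in> tuples C n" for a
  proof -
    have "sat C (nenv (a @ b)) ?\<psi> \<longleftrightarrow> sat C (\<lambda>v. eval C (nenv (a @ b)) (?\<sigma> v)) \<phi>"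
    proof (rule sat_subst[of g UNIV])
      fix x assume "x \<in> pars \<phi>"
      then show "tvars (?\<pi> x) \<inter> range g = {} \<and> eval C (nenv (a @ b)) (?\<pi> x) = x"
        using ix[of x] a by (auto simp: g_def nenv_def nth_append tuples_def)
    qed (use g in auto)
    also have "\<dots> \<longleftrightarrow> sat C (nenv a) \<phi>"
    proof (rule sat_cong)
      fix v assume "v \<in> fv \<phi>"
      then show "eval C (nenv (a @ b)) (?\<sigma> v) = nenv a v"
        using fv[of v] a by (simp add: g_def nenv_def nth_append tuples_def)
    qed
    finally show ?thesis .
  qed
  moreover have "a @ b \<in> tuples C (n + ?k)" if "a \<in> tuples C n" for a
    using that b \<phi>(1) assms(2) by (auto simp: formulas_def tuples_def)
  ultimately have "S = {a \<in> tuples C n. a @ b \<in> {a \<in> tuples C (n + ?k). sat C (nenv a) ?\<psi>}}"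
    using \<phi>(2) by auto
  then show ?thesis using that[OF _ D] b \<phi>(1) by (auto simp: formulas_def)
qed

lemma dset_project1:
  assumes "dset B (Suc n) S"
  shows "dset B n {a \<in> tuples C n. \<exists>x. a @ [x] \<in> S}"
proof -
  obtain \<phi> :: "('f, 'r, nat, 'a) form" where
    \<phi>: "\<phi> \<in> formulas L B {..<Suc n}" "S = {a \<in> tuples C (Suc n). sat C (nenv a) \<phi>}"
    using assms(1) unfolding dset_def by blast
  have "sat C (nenv a) (Ex n \<phi>) \<longleftrightarrow> (\<exists>x. a @ [x] \<in> S)" if a: "a \<in> tuples C n" for a
  proof -
    have "sat C ((nenv a)(n := x)) \<phi> \<longleftrightarrow> sat C (nenv (a @ [x])) \<phi>" for x
    proof (rule sat_cong)
      fix v assume "v \<in> fv \<phi>"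
      then have "v < Suc n" using \<phi>(1) by (auto simp: formulas_def)
      then show "((nenv a)(n := x)) v = nenv (a @ [x]) v"
        using a by (auto simp: nenv_def nth_append tuples_def)
    qed
    then show ?thesis using a \<phi>(2) by (auto simp: tuples_def)
  qed
  moreover have "Ex n \<phi> \<in> formulas L B {..<n}" using \<phi>(1) by (auto simp: formulas_def less_Suc_eq)
  ultimately show ?thesis unfolding dset_def
    by (intro exI[of _ "Ex n \<phi>"] conjI) auto
qed

lemma dset_project:
  "dset B (n + k) S \<Longrightarrow> dset B n {a \<in> tuples C n. \<exists>b. length b = k \<and> a @ b \<in> S}"
proof (induction k arbitrary: S)
  case 0
  then have "{a \<in> tuples C n. \<exists>b. length b = 0 \<and> a @ b \<in> S} = S" using dset_subset by auto
  then show ?case using 0 by simp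
next
  case (Suc k)
  let ?S = "{a \<in> tuples C (n + k). \<exists>x. a @ [x] \<in> S}"
  have "dset B (n + k) ?S" using dset_project1[of B "n + k" S] Suc.prems by simp
  then have "dset B n {a \<in> tuples C n. \<exists>b. length b = k \<and> a @ b \<in> ?S}" by (rule Suc.IH)
  moreover have "(\<exists>b. length b = k \<and> a @ b \<in> ?S) \<longleftrightarrow> (\<exists>b. length b = Suc k \<and> a @ b \<in> S)" for a
  proof
    assume "\<exists>b. length b = Suc k \<and> a @ b \<in> S"
    then obtain b where b: "length b = Suc k" "a @ b \<in> S" by blast
    obtain b' x where b': "b = b' @ [x]" "length b' = k" using b(1) by (metis length_Suc_conv_rev)
    have "a @ b' \<in> tuples C (n + k)"
      using b b' subsetD[OF dset_subset[OF Suc.prems] b(2)] by (simp add: tuples_def)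
    then show "\<exists>b. length b = k \<and> a @ b \<in> ?S" using b b' by auto
  next
    assume "\<exists>b. length b = k \<and> a @ b \<in> ?S"
    then obtain b x where "length b = k" "a @ b @ [x] \<in> S" by auto
    then show "\<exists>b. length b = Suc k \<and> a @ b \<in> S" by (intro exI[of _ "b @ [x]"]) simp
  qed
  ultimately show ?case by simp
qed

lemma eval_Auts:
  assumes "g \<in> Auts A" "range e \<subseteq> univ C"
  shows "wf_trm L t \<Longrightarrow> tpars t = {} \<Longrightarrow> eval C (\<lambda>v. g (e v)) t = g (eval C e t) \<and> eval C e t \<in> univ C"
proof (induction t)
  case (Fn f ts)
  then have *: "eval C (\<lambda>v. g (e v)) t = g (eval C e t) \<and> eval C e t \<in> univ C" if "t \<in> set ts" for t
    using that by simp
  then have "map (eval C (\<lambda>v. g (e v))) ts = map g (map (eval C e) ts)" by simp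
  moreover have "map (eval C e) ts \<in> tuples C (length ts)" using * by (auto simp: tuples_def)
  ultimately show ?case using Fn.prems assms(1) structure_C
    unfolding automorphisms_def structure_of_def by (simp del: map_map)
qed (use assms in auto)

lemma sat_Auts:
  assumes "g \<in> Auts A"
  shows "e \<in> vals C \<Longrightarrow> wf_form L \<phi> \<Longrightarrow> pars \<phi> = {} \<Longrightarrow> sat C (\<lambda>v. g (e v)) \<phi> \<longleftrightarrow> sat C e \<phi>"
proof (induction \<phi> arbitrary: e)
  case (Eq s t)
  have e: "range e \<subseteq> univ C" using Eq by (simp add: vals_def)
  have inj: "inj_on g (univ C)" using assms unfolding automorphisms_def bij_betw_def by blast
  show ?case using eval_Auts[OF assms e, of s] eval_Auts[OF assms e, of t] Eq.prems inj
    by (auto dest: inj_onD)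
next
  case (Rel r ts)
  have e: "range e \<subseteq> univ C" using Rel by (simp add: vals_def)
  have *: "eval C (\<lambda>v. g (e v)) t = g (eval C e t) \<and> eval C e t \<in> univ C" if "t \<in> set ts" for t
    using eval_Auts[OF assms e, of t] Rel.prems that by simp
  then have "map (eval C (\<lambda>v. g (e v))) ts = map g (map (eval C e) ts)" by simp
  moreover have "map (eval C e) ts \<in> tuples C (length ts)" using * by (auto simp: tuples_def)
  ultimately show ?case using Rel.prems assms
    unfolding automorphisms_def by (simp del: map_map)
next
  case (Ex v \<phi>)
  have bij: "g ` univ C = univ C" using assms unfolding automorphisms_def bij_betw_def by blast
  have "sat C ((\<lambda>v. g (e v))(v := g x)) \<phi> \<longleftrightarrow> sat C (e(v := x)) \<phi>" if "x \<in> univ C" for x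
  proof -
    have "(\<lambda>v. g (e v))(v := g x) = (\<lambda>w. g ((e(v := x)) w))" by auto
    moreover have "e(v := x) \<in> vals C" using Ex.prems that by (auto simp: vals_def)
    ultimately show ?thesis using Ex.IH[of "e(v := x)"] Ex.prems by (simp del: fun_upd_apply)
  qed
  then have "(\<exists>x\<in>g ` univ C. sat C ((\<lambda>v. g (e v))(v := x)) \<phi>) \<longleftrightarrow> (\<exists>x\<in>univ C. sat C (e(v := x)) \<phi>)" by simp
  then show ?case using bij by simp
qed auto

lemma dset_Auts0:
  assumes "dset {} n S" "g \<in> Auts A" "a \<in> tuples C n"
  shows "map g a \<in> S \<longleftrightarrow> a \<in> S"
proof -
  obtain \<phi> :: "('f, 'r, nat, 'a) form" where
    \<phi>: "\<phi> \<in> formulas L {} {..<n}" "S = {a \<in> tuples C n. sat C (nenv a) \<phi>}"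
    using assms(1) unfolding dset_def by blast
  have "sat C (nenv (map g a)) \<phi> \<longleftrightarrow> sat C (\<lambda>v. g (nenv a v)) \<phi>"
    by (rule sat_cong) (use \<phi>(1) assms(3) in \<open>auto simp: nenv_def formulas_def tuples_def\<close>)
  also have "\<dots> \<longleftrightarrow> sat C (nenv a) \<phi>"
    using sat_Auts[OF assms(2) nenv_vals[OF assms(3)]] \<phi>(1) by (simp add: formulas_def)
  finally show ?thesis using \<phi>(2) assms Auts_tuples by auto
qed

lemma dset_orb:
  assumes "dset B n S" "B \<subseteq> univ C" "orb B a b" "a \<in> tuples C n"
  shows "b \<in> S \<longleftrightarrow> a \<in> S"
proof -
  obtain c S0 where c: "set c \<subseteq> B" "dset {} (n + length c) S0" "S = {a \<in> tuples C n. a @ c \<in> S0}"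
    using dset_parameters[OF assms(1,2)] by metis
  obtain g where g: "g \<in> Auts B" "b = map g a" using assms(3) unfolding orb_def by blast
  have "a @ c \<in> tuples C (n + length c)" using assms c by (auto simp: tuples_def)
  then have "map g (a @ c) \<in> S0 \<longleftrightarrow> a @ c \<in> S0" using dset_Auts0[OF c(2) g(1)] by blast
  moreover have "map g c = c" using Auts_map_fix[OF g(1) c(1)] .
  ultimately show ?thesis using c(3) g assms(4) Auts_tuples[OF g(1) assms(4)] by simp
qed

text \<open>Strong homogeneity speaks of elementary maps, that is of formulas without parameters whose
  variables may take the same value. Such a formula at values in \<open>B \<union> set a\<close> becomes a formula over
  \<open>B\<close> about the tuple \<open>a\<close> by substituting for each variable either the parameter or the first
  position of its value in \<open>a\<close>.\<close>

lemma homogeneity: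
  assumes B: "B \<subseteq> univ C" "|B| <o \<kappa>" and a: "a \<in> tuples C n" and b: "b \<in> tuples C n"
    and same: "\<And>D. dset B n D \<Longrightarrow> a \<in> D \<Longrightarrow> b \<in> D"
  shows "orb B a b"
proof -
  \<comment> \<open>Well-defined choice of a position, as \<open>a\<close> may repeat elements.\<close>
  define ix where "ix x = (LEAST i. i < n \<and> a ! i = x)" for x
  have ix: "ix x < n \<and> a ! ix x = x" if "x \<in> set a" for x
    using that a LeastI_ex[of "\<lambda>i. i < n \<and> a ! i = x"]
    unfolding ix_def tuples_def by (auto simp: in_set_conv_nth)
  define t :: "'a \<Rightarrow> ('f, nat, 'a) trm" where "t x = (if x \<in> B then Par x else Var (ix x))" for x
  define h where "h x = eval C (nenv b) (t x)" for x
  have same': "a \<in> D \<longleftrightarrow> b \<in> D" if "dset B n D" for D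
    using same[OF that] same[OF dset_Compl[OF that]] a b by blast
  have t_a: "eval C (nenv a) (t x) = x" if "x \<in> B \<union> set a" for x
    using ix[of x] that a unfolding t_def tuples_def by auto
  have eq: "sat C e \<phi> \<longleftrightarrow> sat C (h \<circ> e) \<phi>"
    if \<phi>: "\<phi> \<in> formulas L {} UNIV" and e: "e ` fv \<phi> \<subseteq> B \<union> set a"
    for \<phi> :: "('f, 'r, nat, 'a) form" and e
  proof -
    let ?D = "{a \<in> tuples C n. sat C (\<lambda>v. eval C (nenv a) (t (e v))) \<phi>}"
    have "dset B n ?D"
    proof (rule dset_formula)
      fix v assume "v \<in> fv \<phi>"
      then have "e v \<in> B \<union> set a" using e by blast
      then show "(\<exists>i<n. t (e v) = Var i) \<or> (\<exists>b\<in>B. t (e v) = Par b)"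
        using ix[of "e v"] unfolding t_def by auto
    qed (use \<phi> in \<open>auto simp: formulas_def\<close>)
    then have "a \<in> ?D \<longleftrightarrow> b \<in> ?D" by (rule same')
    moreover have "sat C (\<lambda>v. eval C (nenv a) (t (e v))) \<phi> \<longleftrightarrow> sat C e \<phi>"
      by (rule sat_cong) (use e t_a in blast)
    moreover have "(\<lambda>v. eval C (nenv b) (t (e v))) = h \<circ> e" by (auto simp: h_def)
    ultimately show ?thesis using a b by simp
  qed
  have "h ` (B \<union> set a) \<subseteq> univ C"
  proof
    fix y assume "y \<in> h ` (B \<union> set a)"
    then obtain x where "x \<in> B \<union> set a" "y = h x" by blast
    then show "y \<in> univ C" using ix[of x] B(1) b unfolding h_def t_def tuples_def by force
  qed
  then have "elementary_map L C (B \<union> set a) h" unfolding elementary_map_def using eq by blast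
  moreover have "|B \<union> set a| <o \<kappa>" using Un_less[OF B(2) finite_less] by simp
  moreover have "B \<union> set a \<subseteq> univ C" using B(1) a by (auto simp: tuples_def)
  ultimately obtain g where g: "g \<in> Auts {}" "\<And>x. x \<in> B \<union> set a \<Longrightarrow> g x = h x"
    using homogeneous_C unfolding strongly_homogeneous_def by metis
  have "g \<in> Auts B" using g unfolding automorphisms_def h_def t_def by auto
  moreover have "b = map g a"
  proof (rule nth_equalityI)
    show "length b = length (map g a)" using a b by (simp add: tuples_def)
    fix i assume "i < length b"
    then have i: "i < n" using b by (simp add: tuples_def)
    have len: "length a = n" "length b = n" using a b by (simp_all add: tuples_def)
    have "nth a i \<in> set a" using i len by simp
    let ?\<phi> = "Eq (Var 0) (Var 1) :: ('f, 'r, nat, 'a) form"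
    let ?\<sigma> = "\<lambda>v::nat. if v = 0 then t (a ! i) else Var i"
    let ?D = "{c \<in> tuples C n. sat C (\<lambda>v. eval C (nenv c) (?\<sigma> v)) ?\<phi>}"
    have "dset B n ?D"
      by (rule dset_formula) (use ix[OF \<open>a ! i \<in> set a\<close>] i in \<open>auto simp: t_def\<close>)
    then have "a \<in> ?D \<longleftrightarrow> b \<in> ?D" by (rule same')
    moreover have "a \<in> ?D" using a i len t_a[of "a ! i"] \<open>a ! i \<in> set a\<close> by simp
    ultimately have "h (a ! i) = b ! i" using i len by (simp add: h_def)
    then show "b ! i = map g a ! i" using g(2)[of "a ! i"] i len \<open>a ! i \<in> set a\<close> by simp
  qed
  ultimately show ?thesis unfolding orb_def by blast
qed

text \<open>A formula uses only finitely many parameters, so a type over \<open>B\<close> is determined by the types over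
  the empty set of the tuples extended by finite tuples of \<open>B\<close>.\<close>

lemma orb_finite_character:
  assumes B: "B \<subseteq> univ C" "|B| <o \<kappa>" and a: "a \<in> tuples C n" and b: "b \<in> tuples C n"
    and fin: "\<And>c. set c \<subseteq> B \<Longrightarrow> orb {} (a @ c) (b @ c)"
  shows "orb B a b"
proof (rule homogeneity[OF B a b])
  fix D assume D: "dset B n D" "a \<in> D"
  obtain c S0 where c: "set c \<subseteq> B" "dset {} (n + length c) S0" "D = {a \<in> tuples C n. a @ c \<in> S0}"
    using dset_parameters[OF D(1) B(1)] by metis
  have "a @ c \<in> tuples C (n + length c)" using a c B by (auto simp: tuples_def)
  then show "b \<in> D" using dset_orb[OF c(2) _ fin[OF c(1)]] c(3) D(2) b by simp
qed

end

section \<open>Compactness\<close>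

definition fip :: "'b set \<Rightarrow> 'b set set \<Rightarrow> bool" where
  "fip \<Omega> F \<longleftrightarrow> (\<forall>G. finite G \<and> G \<subseteq> F \<longrightarrow> (\<exists>x \<in> \<Omega>. \<forall>D \<in> G. x \<in> D))"

lemma fipD: "fip \<Omega> F \<Longrightarrow> finite G \<Longrightarrow> G \<subseteq> F \<Longrightarrow> \<exists>x \<in> \<Omega>. \<forall>D \<in> G. x \<in> D"
  unfolding fip_def by blast

lemma fip_imageI:
  assumes "\<And>K. finite K \<Longrightarrow> K \<subseteq> I \<Longrightarrow> \<exists>x \<in> \<Omega>. \<forall>i \<in> K. x \<in> D i"
  shows "fip \<Omega> (D ` I)"
  unfolding fip_def
proof (intro allI impI)
  fix G assume G: "finite G \<and> G \<subseteq> D ` I"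
  obtain K where "K \<subseteq> I" "finite K" "G = D ` K"
    using finite_subset_image[OF conjunct1[OF G] conjunct2[OF G]] by blast
  then show "\<exists>x \<in> \<Omega>. \<forall>D \<in> G. x \<in> D" using assms by simp
qed

text \<open>The ultrafilter lemma, with the finite intersection property relative to the points of \<open>\<Omega>\<close>;
  a family that is maximal with this property decides every set.\<close>

lemma fip_ultrafilter:
  assumes "fip \<Omega> F"
  obtains U where "F \<subseteq> U" "fip \<Omega> U" "\<And>S. S \<subseteq> \<Omega> \<Longrightarrow> S \<in> U \<or> \<Omega> - S \<in> U"
proof -
  let ?A = "{U. F \<subseteq> U \<and> fip \<Omega> U}"
  have "\<exists>M\<in>?A. \<forall>X\<in>?A. M \<subseteq> X \<longrightarrow> X = M"
  proof (rule subset_Zorn_nonempty)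
    show "?A \<noteq> {}" using assms by blast
    fix c assume c: "c \<noteq> {}" "subset.chain ?A c"
    have "fip \<Omega> (\<Union>c)" unfolding fip_def
    proof (intro allI impI)
      fix G assume G: "finite G \<and> G \<subseteq> \<Union>c"
      then obtain U where "U \<in> c" "G \<subseteq> U"
        using finite_subset_Union_chain[of G c ?A] c by blast
      then show "\<exists>x\<in>\<Omega>. \<forall>D\<in>G. x \<in> D" using G c(2) fipD[of \<Omega> U G] unfolding subset.chain_def by blast
    qed
    then show "\<Union>c \<in> ?A" using c unfolding subset.chain_def by blast
  qed
  then obtain U where U: "F \<subseteq> U" "fip \<Omega> U" and max: "\<And>X. fip \<Omega> X \<Longrightarrow> U \<subseteq> X \<Longrightarrow> X = U"
    by (smt (verit, best) mem_Collect_eq subset_trans)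
  have "S \<in> U \<or> \<Omega> - S \<in> U" if "S \<subseteq> \<Omega>" for S
  proof (rule ccontr)
    assume n: "\<not> (S \<in> U \<or> \<Omega> - S \<in> U)"
    have "\<exists>G. finite G \<and> G \<subseteq> insert D U \<and> \<not> (\<exists>x\<in>\<Omega>. \<forall>D\<in>G. x \<in> D)" if "D \<notin> U" for D
      using max[of "insert D U"] that unfolding fip_def by blast
    with n obtain G1 G2 where
      G1: "finite G1" "G1 \<subseteq> insert S U" "\<not> (\<exists>x\<in>\<Omega>. \<forall>D\<in>G1. x \<in> D)" and
      G2: "finite G2" "G2 \<subseteq> insert (\<Omega> - S) U" "\<not> (\<exists>x\<in>\<Omega>. \<forall>D\<in>G2. x \<in> D)"
      by meson
    obtain x where x: "x \<in> \<Omega>" "\<forall>D \<in> (G1 - {S}) \<union> (G2 - {\<Omega> - S}). x \<in> D"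
      using fipD[OF U(2), of "(G1 - {S}) \<union> (G2 - {\<Omega> - S})"] G1 G2 by blast
    show False
    proof (cases "x \<in> S")
      case True
      then show ?thesis using x G1(3) by blast
    next
      case False
      then show ?thesis using x G2(3) by blast
    qed
  qed
  then show ?thesis using that U by blast
qed

context monster_model
begin

lemma saturated_dsets1:
  assumes B: "B \<subseteq> univ C" "|B| <o \<kappa>" and D: "\<And>i. i \<in> I \<Longrightarrow> dset B 1 (D i)"
    and fin: "\<And>K. finite K \<Longrightarrow> K \<subseteq> I \<Longrightarrow> \<exists>x \<in> univ C. \<forall>i \<in> K. [x] \<in> D i"
  shows "\<exists>x \<in> univ C. \<forall>i \<in> I. [x] \<in> D i"
proof -
  have "\<forall>i \<in> I. \<exists>\<phi> :: ('f, 'r, nat, 'a) form. \<phi> \<in> formulas L B {..<1} \<and>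
    D i = {a \<in> tuples C 1. sat C (nenv a) \<phi>}"
    using D unfolding dset_def by blast
  from bchoice[OF this] obtain \<phi> :: "_ \<Rightarrow> ('f, 'r, nat, 'a) form" where
    \<phi>: "\<forall>i \<in> I. \<phi> i \<in> formulas L B {..<1} \<and> D i = {a \<in> tuples C 1. sat C (nenv a) (\<phi> i)}" ..
  have sat: "sat C e (\<phi> i) \<longleftrightarrow> [e 0] \<in> D i" if i: "i \<in> I" and e: "e \<in> vals C" for e i
  proof -
    have "sat C e (\<phi> i) \<longleftrightarrow> sat C (nenv [e 0]) (\<phi> i)"
      by (rule sat_cong) (use bspec[OF \<phi> i] in \<open>auto simp: formulas_def\<close>)
    moreover have "[e 0] \<in> tuples C 1" using e by (auto simp: vals_def tuples_def)
    ultimately show ?thesis using bspec[OF \<phi> i] by simp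
  qed
  have "consistent_in C (\<phi> ` I)" unfolding consistent_in_def
  proof (intro allI impI)
    fix G assume G: "finite G \<and> G \<subseteq> \<phi> ` I"
    obtain K where K: "K \<subseteq> I" "finite K" "G = \<phi> ` K"
      using finite_subset_image[OF conjunct1[OF G] conjunct2[OF G]] by blast
    obtain x where x: "x \<in> univ C" "\<forall>i \<in> K. [x] \<in> D i" using fin[OF K(2,1)] by blast
    have "(\<lambda>_. x) \<in> vals C" using x(1) by (auto simp: vals_def)
    then show "\<exists>e\<in>vals C. \<forall>\<psi>\<in>G. sat C e \<psi>" using sat x(2) K by (intro bexI[of _ "\<lambda>_. x"]) auto
  qed
  moreover have "\<phi> ` I \<subseteq> formulas L B {0}" using \<phi> by (auto simp: lessThan_Suc)
  ultimately have "\<exists>e \<in> vals C. \<forall>\<psi> \<in> \<phi> ` I. sat C e \<psi>"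
    using saturated_C B unfolding saturated_def by (metis (no_types))
  then obtain e where e: "e \<in> vals C" "\<forall>\<psi> \<in> \<phi> ` I. sat C e \<psi>" ..
  then have "\<forall>i \<in> I. [e 0] \<in> D i" using sat by simp
  moreover have "e 0 \<in> univ C" using e(1) by (auto simp: vals_def)
  ultimately show ?thesis by (rule bexI)
qed

text \<open>Saturation is given for one variable; here it is extended to fewer than \<open>\<kappa>\<close> variables of any
  kind. A partial assignment, a set \<open>G\<close> of pairs, is admissible if it is compatible with every finite
  part of \<open>\<Sigma>\<close>. Finite character and Zorn's lemma give a maximal one, and it is total: the conditions on a
  further value \<open>x\<close> of \<open>v\<close> are, for each finite part, definable over \<open>B\<close> and the values chosen so far.\<close>

lemma realize_partial_type:
  fixes \<Sigma> :: "('f, 'r, 'v, 'a) form set"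
  assumes B: "B \<subseteq> univ C" "|B| <o \<kappa>" and V: "|V| <o \<kappa>"
    and \<Sigma>: "\<Sigma> \<subseteq> formulas L B V" "consistent_in C \<Sigma>"
  shows "\<exists>e \<in> vals C. \<forall>\<sigma> \<in> \<Sigma>. sat C e \<sigma>"
proof -
  define solves where "solves G F e \<longleftrightarrow> e \<in> vals C \<and> (\<forall>v x. (v, x) \<in> G \<longrightarrow> e v = x) \<and> (\<forall>\<sigma> \<in> F. sat C e \<sigma>)"
    for G F and e :: "'v \<Rightarrow> 'a"
  define admissible where "admissible G \<longleftrightarrow> G \<subseteq> V \<times> univ C \<and> (\<forall>F. finite F \<and> F \<subseteq> \<Sigma> \<longrightarrow> (\<exists>e. solves G F e))" for G
  define f where "f G v = (SOME x. (v, x) \<in> G)" for G :: "('v \<times> 'a) set" and v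
  \<comment> \<open>Already the empty part of \<open>\<Sigma>\<close> makes an admissible set single-valued.\<close>
  have uniq: "x = y" if G: "admissible G" and vx: "(v, x) \<in> G" and vy: "(v, y) \<in> G" for G v x y
  proof -
    have "finite {} \<and> {} \<subseteq> \<Sigma>" by simp
    then obtain e where "solves G {} e" using G unfolding admissible_def by meson
    then have "e v = x" "e v = y" using vx vy unfolding solves_def by blast+
    then show ?thesis by (rule trans[OF sym])
  qed
  have f: "(v, f G v) \<in> G" if "v \<in> fst ` G" for v G
    using that someI_ex[of "\<lambda>x. (v, x) \<in> G"] unfolding f_def by force
  have "\<exists>M\<in>{G. admissible G}. \<forall>X\<in>{G. admissible G}. M \<subseteq> X \<longrightarrow> X = M"
  proof (rule subset_Zorn')
    fix c assume c: "subset.chain {G. admissible G} c"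
    show "\<Union>c \<in> {G. admissible G}"
    proof (cases "c = {}")
      case True
      then show ?thesis using \<Sigma>(2) unfolding consistent_in_def admissible_def solves_def by auto
    next
      case False
      have mem: "admissible G" if "G \<in> c" for G using c that unfolding subset.chain_def by blast
      have func: "x = y" if xy: "(v, x) \<in> \<Union>c" "(v, y) \<in> \<Union>c" for v x y
      proof -
        obtain G where "G \<in> c" "{(v, x), (v, y)} \<subseteq> G"
          using finite_subset_Union_chain[of "{(v, x), (v, y)}" c] c False xy by blast
        then show ?thesis using uniq[OF mem] by blast
      qed
      have "\<exists>e. solves (\<Union>c) F e" if F: "finite F" "F \<subseteq> \<Sigma>" for F
      proof -
        let ?P = "{z \<in> \<Union>c. fst z \<in> (\<Union>\<sigma>\<in>F. fv \<sigma>)}"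
        have "inj_on fst ?P"
        proof (rule inj_onI)
          fix z w assume zw: "z \<in> ?P" "w \<in> ?P" "fst z = fst w"
          have "(fst z, snd z) \<in> \<Union>c" using zw(1) by simp
          moreover have "(fst w, snd w) \<in> \<Union>c" using zw(2) by simp
          ultimately have "snd z = snd w" using func zw(3) by metis
          then show "z = w" using zw(3) by (rule prod_eqI[rotated])
        qed
        moreover have "finite (fst ` ?P)"
          by (rule finite_subset[of _ "\<Union>\<sigma>\<in>F. fv \<sigma>"]) (use F in auto)
        ultimately have "finite ?P" using finite_imageD by blast
        then obtain G where G: "G \<in> c" "?P \<subseteq> G"
          using finite_subset_Union_chain[of ?P c "{G. admissible G}"] c False by blast
        obtain e where e: "solves G F e" using mem[OF G(1)] F unfolding admissible_def by blast
        \<comment> \<open>Redefine \<open>e\<close> on the whole domain of the union; on the free variables of \<open>F\<close> nothing changes.\<close>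
        define e' where "e' v = (if v \<in> fst ` \<Union>c then f (\<Union>c) v else e v)" for v
        have "f (\<Union>c) v \<in> univ C" if "v \<in> fst ` \<Union>c" for v
          using f[OF that] mem unfolding admissible_def by blast
        then have "e' \<in> vals C" using e unfolding solves_def vals_def e'_def by auto
        moreover have "e' v = x" if "(v, x) \<in> \<Union>c" for v x
        proof -
          have v: "v \<in> fst ` \<Union>c" using that by force
          then show ?thesis using func[OF that f[OF v]] unfolding e'_def by simp
        qed
        moreover have "sat C e' \<sigma>" if "\<sigma> \<in> F" for \<sigma>
        proof -
          have "e' v = e v" if v: "v \<in> fv \<sigma>" for v
          proof (cases "v \<in> fst ` \<Union>c")
            case True
            have "(v, f (\<Union>c) v) \<in> ?P" using f[OF True] \<open>\<sigma> \<in> F\<close> v by simp blast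
            then have "(v, f (\<Union>c) v) \<in> G" using G(2) by blast
            then show ?thesis using e True unfolding solves_def e'_def by simp
          qed (simp add: e'_def)
          then have "sat C e' \<sigma> \<longleftrightarrow> sat C e \<sigma>" by (rule sat_cong)
          then show ?thesis using e that unfolding solves_def by blast
        qed
        ultimately show ?thesis unfolding solves_def by blast
      qed
      moreover have "\<Union>c \<subseteq> V \<times> univ C" using mem unfolding admissible_def by blast
      ultimately show ?thesis unfolding admissible_def by blast
    qed
  qed
  then obtain G where G: "admissible G" and max: "\<And>X. admissible X \<Longrightarrow> G \<subseteq> X \<Longrightarrow> X = G" by blast
  have GV: "G \<subseteq> V \<times> univ C" using G unfolding admissible_def by blast
  have "V \<subseteq> fst ` G"
  proof (rule ccontr)
    assume "\<not> V \<subseteq> fst ` G"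
    then obtain v where v: "v \<in> V" "v \<notin> fst ` G" by blast
    let ?B = "B \<union> snd ` G"
    have B1: "?B \<subseteq> univ C" using B GV by auto
    have "inj_on fst G"
    proof (rule inj_onI)
      fix z w assume zw: "z \<in> G" "w \<in> G" "fst z = fst w"
      have "(fst z, snd z) \<in> G" using zw(1) by simp
      moreover have "(fst w, snd w) \<in> G" using zw(2) by simp
      ultimately have "snd z = snd w" using uniq[OF G] zw(3) by metis
      then show "z = w" using zw(3) by (rule prod_eqI[rotated])
    qed
    then have "|G| \<le>o |V|" using GV card_of_ordLeq[of G V] by force
    then have "|G| <o \<kappa>" using V ordLeq_ordLess_trans by blast
    then have B2: "|?B| <o \<kappa>" using Un_less[OF B(2) image_less] by blast
    define D where "D F = {a \<in> tuples C 1. \<exists>e. solves G F e \<and> a = [e v]}" for F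
    have dD: "dset ?B 1 (D F)" if F: "finite F" "F \<subseteq> \<Sigma>" for F
    proof -
      let ?W = "(\<Union>\<sigma>\<in>F. fv \<sigma>) - fst ` G - {v}"
      have "finite ?W" using F(1) by simp
      from finite_list[OF this] obtain ws where ws: "set ws = ?W" ..
      have "\<forall>u \<in> ?W. \<exists>i. i < length ws \<and> ws ! i = u"
        by (simp flip: ws in_set_conv_nth)
      from bchoice[OF this] obtain ix where
        ix: "\<And>u. u \<in> ?W \<Longrightarrow> ix u < length ws \<and> ws ! (ix u) = u" by blast
      define \<tau> :: "'v \<Rightarrow> ('f, nat, 'a) trm" where
        "\<tau> u = (if u = v then Var 0 else if u \<in> fst ` G then Par (f G u) else Var (Suc (ix u)))" for u
      let ?S = "\<lambda>\<sigma>. {a \<in> tuples C (1 + length ws). sat C (\<lambda>u. eval C (nenv a) (\<tau> u)) \<sigma>}"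
      have "dset ?B (1 + length ws) (?S \<sigma>)" if "\<sigma> \<in> F" for \<sigma>
      proof (rule dset_formula)
        show "wf_form L \<sigma>" "pars \<sigma> \<subseteq> ?B" using that F(2) \<Sigma>(1) unfolding formulas_def by auto
        fix u assume "u \<in> fv \<sigma>"
        then consider "u = v" | "u \<noteq> v" "u \<in> fst ` G" | "u \<noteq> v" "u \<notin> fst ` G" "u \<in> ?W"
          using \<open>\<sigma> \<in> F\<close> by blast
        then show "(\<exists>i<1 + length ws. \<tau> u = Var i) \<or> (\<exists>b\<in>?B. \<tau> u = Par b)"
        proof cases
          case 2
          then have "f G u \<in> snd ` G" using f[of u G] by force
          then show ?thesis using 2 unfolding \<tau>_def by simp
        next
          case 3
          then show ?thesis using ix[of u] unfolding \<tau>_def by simp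
        qed (simp add: \<tau>_def)
      qed
      then have "dset ?B (1 + length ws) {a \<in> tuples C (1 + length ws). \<forall>D \<in> ?S ` F. a \<in> D}"
        using F(1) by (intro dset_INT) auto
      then have "dset ?B 1 {a \<in> tuples C 1. \<exists>b. length b = length ws \<and>
        a @ b \<in> {a \<in> tuples C (1 + length ws). \<forall>D \<in> ?S ` F. a \<in> D}}" (is "dset _ _ ?P")
        by (rule dset_project)
      moreover have "?P = D F"
      proof (intro set_eqI iffI)
        fix a assume a: "a \<in> ?P"
        then obtain b where b: "length b = length ws" "a @ b \<in> tuples C (1 + length ws)"
          "\<And>\<sigma>. \<sigma> \<in> F \<Longrightarrow> sat C (\<lambda>u. eval C (nenv (a @ b)) (\<tau> u)) \<sigma>" by auto
        let ?e = "\<lambda>u. eval C (nenv (a @ b)) (\<tau> u)"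
        have nv: "nenv (a @ b) \<in> vals C" using nenv_vals[OF b(2)] .
        have "f G u \<in> univ C" if "u \<in> fst ` G" for u using f[OF that] GV by blast
        then have "?e u \<in> univ C" for u using nv unfolding \<tau>_def vals_def by auto
        then have "?e \<in> vals C" by (auto simp: vals_def)
        moreover have "?e u = x" if ux: "(u, x) \<in> G" for u x
        proof -
          have u: "u \<in> fst ` G" using ux by force
          then have "u \<noteq> v" using v(2) by blast
          then show ?thesis using u uniq[OF G ux f[OF u]] unfolding \<tau>_def by simp
        qed
        moreover have "a = [?e v]" using a unfolding \<tau>_def tuples_def
          by (auto simp: length_Suc_conv nenv_def)
        ultimately show "a \<in> D F" using a b(3) unfolding D_def solves_def by auto
      next
        fix a assume "a \<in> D F"
        then obtain e where a: "a \<in> tuples C 1" "a = [e v]" and e: "solves G F e" unfolding D_def by auto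
        let ?b = "map e ws"
        have ab: "a @ ?b \<in> tuples C (1 + length ws)"
          using a e unfolding solves_def vals_def tuples_def by auto
        have "sat C (\<lambda>u. eval C (nenv (a @ ?b)) (\<tau> u)) \<sigma>" if "\<sigma> \<in> F" for \<sigma>
        proof -
          have "sat C (\<lambda>u. eval C (nenv (a @ ?b)) (\<tau> u)) \<sigma> \<longleftrightarrow> sat C e \<sigma>"
          proof (rule sat_cong)
            fix u assume "u \<in> fv \<sigma>"
            then consider "u = v" | "u \<noteq> v" "u \<in> fst ` G" | "u \<noteq> v" "u \<notin> fst ` G" "u \<in> ?W" using \<open>\<sigma> \<in> F\<close> by blast
            then show "eval C (nenv (a @ ?b)) (\<tau> u) = e u"
            proof cases
              case 1
              then show ?thesis using a unfolding \<tau>_def nenv_def by simp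
            next
              case 2
              then show ?thesis using f[of u G] e unfolding \<tau>_def solves_def by auto
            next
              case 3
              then show ?thesis using ix[of u] a unfolding \<tau>_def nenv_def by simp
            qed
          qed
          then show ?thesis using e that unfolding solves_def by blast
        qed
        then show "a \<in> ?P" using a(1) ab by (auto intro!: exI[of _ ?b])
      qed
      ultimately show ?thesis by simp
    qed
    have "\<exists>x \<in> univ C. \<forall>F \<in> {F. finite F \<and> F \<subseteq> \<Sigma>}. [x] \<in> D F"
    proof (rule saturated_dsets1[OF B1 B2])
      show "dset ?B 1 (D F)" if "F \<in> {F. finite F \<and> F \<subseteq> \<Sigma>}" for F using that dD by blast
      fix K assume K: "finite K" "K \<subseteq> {F. finite F \<and> F \<subseteq> \<Sigma>}"
      then have "finite (\<Union>K)" "\<Union>K \<subseteq> \<Sigma>" by auto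
      then obtain e where e: "solves G (\<Union>K) e" using G unfolding admissible_def by blast
      then have ev: "e v \<in> univ C" unfolding solves_def vals_def by auto
      have "[e v] \<in> D F" if "F \<in> K" for F
      proof -
        have "solves G F e" using e that unfolding solves_def by blast
        then show ?thesis using ev unfolding D_def tuples_def by auto
      qed
      then show "\<exists>x\<in>univ C. \<forall>F\<in>K. [x] \<in> D F" using ev by blast
    qed
    then obtain x where x: "x \<in> univ C" "\<forall>F \<in> {F. finite F \<and> F \<subseteq> \<Sigma>}. [x] \<in> D F" ..
    have xD: "[x] \<in> D F" if "finite F" "F \<subseteq> \<Sigma>" for F using x(2) that by simp
    have "admissible (insert (v, x) G)" unfolding admissible_def
    proof (intro conjI allI impI)
      show "insert (v, x) G \<subseteq> V \<times> univ C" using GV v(1) x(1) by blast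
      fix F assume "finite F \<and> F \<subseteq> \<Sigma>"
      then obtain e where "solves G F e" "x = e v" using xD unfolding D_def by auto
      then show "\<exists>e. solves (insert (v, x) G) F e" unfolding solves_def by auto
    qed
    then have "insert (v, x) G = G" using max by blast
    then show False using v(2) by force
  qed
  obtain u0 where u0: "u0 \<in> univ C" using univ_nonempty by blast
  define e where "e v = (if v \<in> fst ` G then f G v else u0)" for v
  have "f G v \<in> univ C" if "v \<in> fst ` G" for v using f[OF that] GV by blast
  then have "e \<in> vals C" unfolding vals_def e_def using u0 by auto
  moreover have "sat C e \<sigma>" if \<sigma>: "\<sigma> \<in> \<Sigma>" for \<sigma>
  proof -
    obtain e0 where e0: "solves G {\<sigma>} e0" using G \<sigma> unfolding admissible_def by blast
    have "sat C e \<sigma> \<longleftrightarrow> sat C e0 \<sigma>"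
    proof (rule sat_cong)
      fix v assume "v \<in> fv \<sigma>"
      then have v: "v \<in> fst ` G" using \<sigma> \<Sigma>(1) \<open>V \<subseteq> fst ` G\<close> unfolding formulas_def by blast
      then show "e v = e0 v" using e0 f[OF v] unfolding solves_def e_def by auto
    qed
    then show ?thesis using e0 unfolding solves_def by blast
  qed
  ultimately show ?thesis by blast
qed

lemma compactness:
  assumes B: "B \<subseteq> univ C" "|B| <o \<kappa>" and D: "\<And>i. i \<in> I \<Longrightarrow> dset B n (D i)"
    and fin: "\<And>K. finite K \<Longrightarrow> K \<subseteq> I \<Longrightarrow> \<exists>a \<in> tuples C n. \<forall>i \<in> K. a \<in> D i"
  shows "\<exists>a \<in> tuples C n. \<forall>i \<in> I. a \<in> D i"
proof -
  have "\<forall>i \<in> I. \<exists>\<phi> :: ('f, 'r, nat, 'a) form. \<phi> \<in> formulas L B {..<n} \<and>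
    D i = {a \<in> tuples C n. sat C (nenv a) \<phi>}"
    using D unfolding dset_def by blast
  from bchoice[OF this] obtain \<phi> :: "_ \<Rightarrow> ('f, 'r, nat, 'a) form" where
    \<phi>: "\<forall>i \<in> I. \<phi> i \<in> formulas L B {..<n} \<and> D i = {a \<in> tuples C n. sat C (nenv a) (\<phi> i)}" ..
  have "consistent_in C (\<phi> ` I)" unfolding consistent_in_def
  proof (intro allI impI)
    fix G assume G: "finite G \<and> G \<subseteq> \<phi> ` I"
    obtain K where K: "K \<subseteq> I" "finite K" "G = \<phi> ` K"
      using finite_subset_image[OF conjunct1[OF G] conjunct2[OF G]] by blast
    obtain a where a: "a \<in> tuples C n" "\<forall>i \<in> K. a \<in> D i" using fin[OF K(2,1)] by blast
    have "\<forall>\<psi>\<in>G. sat C (nenv a) \<psi>" using a(2) K \<phi> by auto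
    then show "\<exists>e\<in>vals C. \<forall>\<psi>\<in>G. sat C e \<psi>" using nenv_vals[OF a(1)] by (rule bexI)
  qed
  moreover have "|{..<n}| <o \<kappa>" by (rule finite_less) simp
  moreover have "\<phi> ` I \<subseteq> formulas L B {..<n}" using \<phi> by blast
  ultimately have "\<exists>e \<in> vals C. \<forall>\<psi> \<in> \<phi> ` I. sat C e \<psi>" by (intro realize_partial_type[OF B])
  then obtain e where e: "e \<in> vals C" "\<forall>\<psi> \<in> \<phi> ` I. sat C e \<psi>" ..
  let ?a = "map e [0..<n]"
  have a: "?a \<in> tuples C n" using e(1) by (auto simp: vals_def tuples_def)
  moreover have "?a \<in> D i" if i: "i \<in> I" for i
  proof -
    have "sat C (nenv ?a) (\<phi> i) \<longleftrightarrow> sat C e (\<phi> i)"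
      by (rule sat_cong) (use bspec[OF \<phi> i] in \<open>auto simp: formulas_def nenv_def\<close>)
    then show ?thesis using e(2) bspec[OF \<phi> i] a i by simp
  qed
  ultimately show ?thesis by blast
qed

end

section \<open>Lascar strong types\<close>

text \<open>The small model \<open>N\<close> provides the bound on the number of classes: an equivalence relation coarser than
  conjugacy over \<open>N\<close> has at most as many classes as there are types over \<open>N\<close>.\<close>

locale small_submodel = monster_model L C \<kappa>
  for L :: "('f, 'r) language" and C :: "('f, 'r, 'a) struct" and \<kappa> :: "'k rel" +
  fixes N A :: "'a set"
  assumes elementary_N: "elementary_sub L C N"
    and small_N: "small L C \<kappa> N"
    and A_subset_N: "A \<subseteq> N"
begin

lemma N_univ: "N \<subseteq> univ C"
  using small_imp_subset[OF small_N] .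

lemma N_less: "|N| <o \<kappa>"
  using small_imp_less[OF small_N] .

lemma A_univ: "A \<subseteq> univ C"
  using A_subset_N N_univ by blast

lemma A_less: "|A| <o \<kappa>"
  using subset_less[OF A_subset_N N_less] .

lemma N_Un_less: "finite B \<Longrightarrow> |N \<union> B| <o \<kappa>"
  using Un_less[OF N_less finite_less] .

lemma finite_UN_less: "finite I \<Longrightarrow> (\<And>i. i \<in> I \<Longrightarrow> |F i| <o \<kappa>) \<Longrightarrow> |\<Union>i\<in>I. F i| <o \<kappa>"
  by (induction I rule: finite_induct) (simp_all add: finite_less Un_less)

lemma Tarski_Vaught:
  fixes \<phi> :: "('f, 'r, nat, 'a) form"
  assumes "\<phi> \<in> formulas L {} UNIV" "range e \<subseteq> N" "sat C e (Ex v \<phi>)"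
  shows "\<exists>x \<in> N. sat C (e(v := x)) \<phi>"
proof -
  let ?N = "C\<lparr>univ := N\<rparr>"
  have el: "sat ?N e \<psi> \<longleftrightarrow> sat C e \<psi>"
    if "\<psi> \<in> formulas L {} UNIV" "range e \<subseteq> N" for \<psi> :: "('f, 'r, nat, 'a) form" and e
    using elementary_N that unfolding elementary_sub_def vals_def by simp
  have "Ex v \<phi> \<in> formulas L {} UNIV" using assms(1) by (simp add: formulas_def)
  then have "sat ?N e (Ex v \<phi>)" using el assms by blast
  then obtain x where x: "x \<in> N" "sat ?N (e(v := x)) \<phi>" by auto
  have "range (e(v := x)) \<subseteq> N" using assms(2) x(1) by auto
  then show ?thesis using x el[OF assms(1)] by blast
qed

lemma dset_meets_N1:
  assumes S: "dset N 1 S" and x: "[x] \<in> S"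
  shows "\<exists>y \<in> N. [y] \<in> S"
proof -
  obtain b S0 where b: "set b \<subseteq> N" "dset {} (1 + length b) S0" "S = {a \<in> tuples C 1. a @ b \<in> S0}"
    using dset_parameters[OF S N_univ] by blast
  obtain \<phi> :: "('f, 'r, nat, 'a) form" where
    \<phi>: "\<phi> \<in> formulas L {} {..<1 + length b}" "S0 = {a \<in> tuples C (1 + length b). sat C (nenv a) \<phi>}"
    using b(2) unfolding dset_def by blast
  obtain n0 where n0: "n0 \<in> N" using elementary_N unfolding elementary_sub_def structure_of_def by auto
  define e where "e i = (if i < Suc (length b) then (n0 # b) ! i else n0)" for i
  have "set (n0 # b) \<subseteq> N" using n0 b(1) by simp
  then have "(n0 # b) ! i \<in> N" if "i < Suc (length b)" for i using that
    by (metis length_Cons nth_mem subsetD)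
  then have e: "range e \<subseteq> N" using n0 unfolding e_def by auto
  have eq: "sat C (e(0 := y)) \<phi> \<longleftrightarrow> sat C (nenv ([y] @ b)) \<phi>" for y
  proof (rule sat_cong)
    fix v assume "v \<in> fv \<phi>"
    then have "v < 1 + length b" using \<phi>(1) unfolding formulas_def by blast
    then show "(e(0 := y)) v = nenv ([y] @ b) v"
      unfolding e_def nenv_def by (cases v) simp_all
  qed
  have xC: "x \<in> univ C" using x b(3) by (simp add: tuples_def)
  have "sat C (e(0 := x)) \<phi>" using x b(3) \<phi>(2) eq by simp
  then have "sat C e (Ex 0 \<phi>)" using xC by auto
  moreover have "\<phi> \<in> formulas L {} UNIV" using \<phi>(1) by (simp add: formulas_def)
  ultimately obtain y where y: "y \<in> N" "sat C (e(0 := y)) \<phi>" using Tarski_Vaught[OF _ e] by blast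
  have "[y] \<in> tuples C 1" "[y] @ b \<in> tuples C (1 + length b)"
    using y(1) N_univ b(1) by (auto simp: tuples_def)
  then have "[y] \<in> S" using y(2) eq b(3) \<phi>(2) by simp
  then show ?thesis using y(1) by blast
qed

lemma dset_meets_N:
  "dset N n S \<Longrightarrow> a \<in> S \<Longrightarrow> \<exists>m \<in> S. set m \<subseteq> N"
proof (induction n arbitrary: S a)
  case 0
  have "a = []" using subsetD[OF dset_subset[OF 0(1)] 0(2)] by (simp add: tuples_def)
  then show ?case using 0(2) by (intro bexI[of _ a]) simp_all
next
  case (Suc n)
  have a: "a \<in> tuples C (Suc n)" using Suc.prems dset_subset by blast
  then obtain b x where bx: "a = b @ [x]" "length b = n"
    by (auto simp: tuples_def length_Suc_conv_rev)
  let ?S = "{b \<in> tuples C n. \<exists>x. b @ [x] \<in> S}"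
  have "b \<in> ?S" using a bx Suc.prems(2) by (auto simp: tuples_def)
  then obtain m where m: "m \<in> ?S" "set m \<subseteq> N"
    using Suc.IH[OF dset_project1[OF Suc.prems(1)]] by blast
  then obtain y where y: "m @ [y] \<in> S" by blast
  have mC: "m \<in> tuples C n" using m(1) by blast
  have "dset N (n + 1) S" using Suc.prems(1) by simp
  then have D: "dset N 1 {c \<in> tuples C 1. m @ c \<in> S}" (is "dset N 1 ?T")
    by (rule dset_fix_front[OF _ mC m(2)])
  have "m @ [y] \<in> tuples C (Suc n)" using dset_subset[OF Suc.prems(1)] y by blast
  then have "[y] \<in> ?T" using y by (simp add: tuples_def)
  then obtain z where z: "z \<in> N" "[z] \<in> ?T" using dset_meets_N1[OF D] by blast
  then have "m @ [z] \<in> S" "set (m @ [z]) \<subseteq> N" using m(2) by auto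
  then show ?case by blast
qed

text \<open>The predicate \<open>q B c\<close> says that \<open>c\<close> realizes over \<open>B\<close> a global coheir of the type of \<open>a\<close> over \<open>N\<close>. The
  coheir consists of the definable sets whose trace on the tuples of \<open>N\<close> lies in an ultrafilter; the
  traces of the sets in the type of \<open>a\<close> have the finite intersection property by elementarity.
  Since automorphisms over \<open>N\<close> do not move traces, they preserve the coheir.\<close>

lemma coheir_exists:
  assumes a: "a \<in> tuples C n"
  obtains q where "\<And>B c. q B c \<Longrightarrow> c \<in> tuples C n" "\<And>B B' c. q B c \<Longrightarrow> B' \<subseteq> B \<Longrightarrow> q B' c"
    "\<And>B. B \<subseteq> univ C \<Longrightarrow> |B| <o \<kappa> \<Longrightarrow> \<exists>c. q B c"
    "\<And>B c c'. B \<subseteq> univ C \<Longrightarrow> |B| <o \<kappa> \<Longrightarrow> q B c \<Longrightarrow> q B c' \<Longrightarrow> orb B c c'"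
    "\<And>g B c. g \<in> Auts N \<Longrightarrow> B \<subseteq> univ C \<Longrightarrow> q B c \<Longrightarrow> q (g ` B) (map g c)"
    "q N a"
proof -
  let ?\<Omega> = "{m. length m = n \<and> set m \<subseteq> N}"
  have \<Omega>: "?\<Omega> \<subseteq> tuples C n" using N_univ by (auto simp: tuples_def)
  let ?F = "(\<inter>) ?\<Omega> ` {S. dset N n S \<and> a \<in> S}"
  have "fip ?\<Omega> ?F"
  proof (rule fip_imageI)
    fix K assume K: "finite K" "K \<subseteq> {S. dset N n S \<and> a \<in> S}"
    let ?I = "{x \<in> tuples C n. \<forall>D \<in> K. x \<in> D}"
    have "dset N n ?I" by (rule dset_INT) (use K in auto)
    moreover have "a \<in> ?I" using a K(2) by blast
    ultimately have "\<exists>m \<in> ?I. set m \<subseteq> N" by (rule dset_meets_N)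
    then obtain m where m: "m \<in> ?I" "set m \<subseteq> N" ..
    then show "\<exists>x\<in>?\<Omega>. \<forall>S\<in>K. x \<in> ?\<Omega> \<inter> S" by (intro bexI[of _ m]) (simp_all add: tuples_def)
  qed
  then obtain U where U: "?F \<subseteq> U" "fip ?\<Omega> U" and
    ult: "\<And>S. S \<subseteq> ?\<Omega> \<Longrightarrow> S \<in> U \<or> ?\<Omega> - S \<in> U"
    by (rule fip_ultrafilter) blast
  define q where "q B c \<longleftrightarrow> c \<in> tuples C n \<and> (\<forall>S. dset B n S \<longrightarrow> ?\<Omega> \<inter> S \<in> U \<longrightarrow> c \<in> S)" for B c
  have q_tuple: "c \<in> tuples C n" if "q B c" for B c using that unfolding q_def by blast
  have qD: "c \<in> S" if "q B c" "dset B n S" "?\<Omega> \<inter> S \<in> U" for B c S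
    using that unfolding q_def by blast
  have q_mono: "q B' c" if "q B c" "B' \<subseteq> B" for B B' c
    using that dset_mono unfolding q_def by blast
  have q_exists: "\<exists>c. q B c" if B: "B \<subseteq> univ C" "|B| <o \<kappa>" for B
  proof -
    let ?Q = "{S. dset B n S \<and> ?\<Omega> \<inter> S \<in> U}"
    have "\<exists>c \<in> tuples C n. \<forall>D \<in> ?Q. c \<in> D"
    proof (rule compactness[OF B])
      fix G assume G: "finite G" "G \<subseteq> ?Q"
      then have "finite ((\<inter>) ?\<Omega> ` G)" "(\<inter>) ?\<Omega> ` G \<subseteq> U" by auto
      then have "\<exists>m \<in> ?\<Omega>. \<forall>D \<in> (\<inter>) ?\<Omega> ` G. m \<in> D" by (rule fipD[OF U(2)])
      then obtain m where "m \<in> ?\<Omega>" "\<forall>D \<in> (\<inter>) ?\<Omega> ` G. m \<in> D" ..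
      then have "m \<in> tuples C n" "\<forall>D \<in> G. m \<in> D" using \<Omega> by auto
      then show "\<exists>x\<in>tuples C n. \<forall>D\<in>G. x \<in> D" by blast
    qed simp
    then show ?thesis unfolding q_def by blast
  qed
  have q_iff: "c \<in> S \<longleftrightarrow> ?\<Omega> \<inter> S \<in> U" if qc: "q B c" and S: "dset B n S" for B c S
  proof
    assume c: "c \<in> S"
    show "?\<Omega> \<inter> S \<in> U"
    proof (rule ccontr)
      assume "?\<Omega> \<inter> S \<notin> U"
      then have "?\<Omega> - (?\<Omega> \<inter> S) \<in> U" using ult[of "?\<Omega> \<inter> S"] by blast
      moreover have "?\<Omega> - (?\<Omega> \<inter> S) = ?\<Omega> \<inter> (tuples C n - S)" using \<Omega> by blast
      ultimately have "?\<Omega> \<inter> (tuples C n - S) \<in> U" by (rule subst[rotated])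
      then have "c \<in> tuples C n - S" by (rule qD[OF qc dset_Compl[OF S]])
      then show False using c by blast
    qed
  next
    assume "?\<Omega> \<inter> S \<in> U"
    then show "c \<in> S" by (rule qD[OF qc S])
  qed
  have q_unique: "orb B c c'" if B: "B \<subseteq> univ C" "|B| <o \<kappa>" and c: "q B c" "q B c'" for B c c'
  proof (rule homogeneity[OF B q_tuple[OF c(1)] q_tuple[OF c(2)]])
    show "c' \<in> D" if "dset B n D" "c \<in> D" for D using q_iff[OF c(1)] q_iff[OF c(2)] that by blast
  qed
  have q_Auts: "q (g ` B) (map g c)" if g: "g \<in> Auts N" and B: "B \<subseteq> univ C" and c: "q B c" for g B c
    unfolding q_def
  proof (intro conjI allI impI)
    have ct: "c \<in> tuples C n" using q_tuple[OF c] .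
    show gc: "map g c \<in> tuples C n" using Auts_tuples[OF g ct] .
    fix S assume S: "dset (g ` B) n S" "?\<Omega> \<inter> S \<in> U"
    have gB: "g ` B \<subseteq> univ C" using B Auts_univ[OF g] by blast
    obtain d S0 where d: "set d \<subseteq> g ` B" "dset {} (n + length d) S0" "S = {x \<in> tuples C n. x @ d \<in> S0}"
      using dset_parameters[OF S(1) gB] by blast
    have "d \<in> lists (g ` B)" using d(1) by (simp add: in_lists_conv_set subset_iff)
    then have "d \<in> map g ` lists B" by (simp add: lists_image)
    then obtain d' where d': "d = map g d'" "set d' \<subseteq> B" by (auto simp: in_lists_conv_set)
    have ld: "length d' = length d" using d'(1) by simp
    have d'C: "set d' \<subseteq> univ C" using d'(2) B by blast
    have trans: "map g x @ d \<in> S0 \<longleftrightarrow> x @ d' \<in> S0" if x: "x \<in> tuples C n" for x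
    proof -
      have "x @ d' \<in> tuples C (n + length d)" using x d'C ld by (auto simp: tuples_def)
      then have "map g (x @ d') \<in> S0 \<longleftrightarrow> x @ d' \<in> S0" using dset_Auts0[OF d(2) g] by blast
      then show ?thesis using d'(1) by simp
    qed
    let ?S' = "{x \<in> tuples C n. x @ d' \<in> S0}"
    have S': "dset B n ?S'" by (rule dset_fix[OF dset_mono[OF d(2) empty_subsetI] ld d'(2) d'C])
    have "?\<Omega> \<inter> S = ?\<Omega> \<inter> ?S'"
    proof (intro set_eqI)
      fix m
      show "m \<in> ?\<Omega> \<inter> S \<longleftrightarrow> m \<in> ?\<Omega> \<inter> ?S'"
      proof (cases "m \<in> ?\<Omega>")
        case True
        then have "m \<in> tuples C n" "map g m = m" using \<Omega> Auts_map_fix[OF g] by auto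
        then show ?thesis using trans[of m] True d(3) by simp
      next
        case False
        then show ?thesis by blast
      qed
    qed
    then have "?\<Omega> \<inter> ?S' \<in> U" using S(2) by simp
    then have "c \<in> ?S'" by (rule qD[OF c S'])
    then show "map g c \<in> S" using trans[OF ct] gc d(3) by simp
  qed
  have q_a: "q N a" unfolding q_def
  proof (intro conjI allI impI a)
    fix S assume S: "dset N n S" "?\<Omega> \<inter> S \<in> U"
    show "a \<in> S"
    proof (rule ccontr)
      assume "a \<notin> S"
      then have "?\<Omega> \<inter> (tuples C n - S) \<in> ?F" using a dset_Compl[OF S(1)] by blast
      then have "{?\<Omega> \<inter> (tuples C n - S), ?\<Omega> \<inter> S} \<subseteq> U" using U(1) S(2) by blast
      then have "\<exists>m \<in> ?\<Omega>. \<forall>D \<in> {?\<Omega> \<inter> (tuples C n - S), ?\<Omega> \<inter> S}. m \<in> D"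
        by (rule fipD[OF U(2), rotated]) simp
      then obtain m where "\<forall>D \<in> {?\<Omega> \<inter> (tuples C n - S), ?\<Omega> \<inter> S}. m \<in> D" ..
      then have "m \<in> ?\<Omega> \<inter> (tuples C n - S)" "m \<in> ?\<Omega> \<inter> S" by (simp_all only: ball_simps insert_iff)
      then show False by blast
    qed
  qed
  show ?thesis by (rule that[OF q_tuple q_mono q_exists q_unique q_Auts q_a])
qed

text \<open>Let \<open>q\<close> be a coheir of the type of \<open>a\<close> over \<open>N\<close>, and call \<open>(c0, c)\<close> a Morley pair if \<open>c0\<close> realizes \<open>q\<close>
  over \<open>N\<close> and \<open>c\<close> realizes it over \<open>N\<close> and \<open>c0\<close>. All Morley pairs are conjugate over \<open>N\<close>, so if one of them
  lies in \<open>E\<close>, all do, and then \<open>a\<close> and \<open>b\<close> are both equivalent to a realization of \<open>q\<close> over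
  \<open>N\<close>, \<open>a\<close> and \<open>b\<close>. Boundedness gives one Morley pair in \<open>E\<close>: choose representatives of all classes, and
  let \<open>c\<close> realize \<open>q\<close> over \<open>N\<close> and all representatives; then \<open>c\<close> is equivalent to one of them.\<close>

lemma bounded_invariant_contains_orb_N:
  assumes bd: "bounded_equiv C \<kappa> n E" and inv: "invariant_rel L C A E"
    and a: "a \<in> tuples C n" and ab: "orb N a b"
  shows "(a, b) \<in> E"
proof (rule coheir_exists[OF a])
  fix q
  assume q_tuple: "\<And>B c. q B c \<Longrightarrow> c \<in> tuples C n"
    and q_mono: "\<And>B B' c. q B c \<Longrightarrow> B' \<subseteq> B \<Longrightarrow> q B' c"
    and q_exists: "\<And>B. B \<subseteq> univ C \<Longrightarrow> |B| <o \<kappa> \<Longrightarrow> \<exists>c. q B c"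
    and q_unique: "\<And>B c c'. B \<subseteq> univ C \<Longrightarrow> |B| <o \<kappa> \<Longrightarrow> q B c \<Longrightarrow> q B c' \<Longrightarrow> orb B c c'"
    and q_Auts: "\<And>g B c. g \<in> Auts N \<Longrightarrow> B \<subseteq> univ C \<Longrightarrow> q B c \<Longrightarrow> q (g ` B) (map g c)"
    and q_a: "q N a"
  have eq: "equiv (tuples C n) E" and Qk: "|tuples C n // E| <o \<kappa>"
    using bd unfolding bounded_equiv_def by auto
  let ?Q = "tuples C n // E"
  \<comment> \<open>Representatives that realize \<open>q\<close> over \<open>N\<close> are preferred, so that \<open>c0\<close> below does.\<close>
  define rep where "rep K = (if \<exists>c \<in> K. q N c then SOME c. c \<in> K \<and> q N c else SOME c. c \<in> K)" for K
  have rep: "rep K \<in> K" if "K \<in> ?Q" for K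
  proof (cases "\<exists>c \<in> K. q N c")
    case True
    then show ?thesis unfolding rep_def using someI_ex[of "\<lambda>c. c \<in> K \<and> q N c"] by auto
  next
    case False
    have "K \<noteq> {}" using that eq by (metis in_quotient_imp_non_empty)
    then show ?thesis unfolding rep_def using False someI_ex[of "\<lambda>c. c \<in> K"] by auto
  qed
  have rep_q: "q N (rep K)" if "c \<in> K" "q N c" for c K
  proof -
    have "\<exists>c. c \<in> K \<and> q N c" using that by blast
    from someI_ex[OF this] show ?thesis unfolding rep_def using that by auto
  qed
  let ?R = "\<Union>K \<in> ?Q. set (rep K)"
  have rep_tuple: "rep K \<in> tuples C n" if "K \<in> ?Q" for K
    using rep[OF that] in_quotient_imp_subset[OF eq that] by blast
  have "?R \<subseteq> (\<Union>i\<in>{..<n}. (\<lambda>K. rep K ! i) ` ?Q)"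
  proof
    fix x assume "x \<in> ?R"
    then obtain K where K: "K \<in> ?Q" "x \<in> set (rep K)" by blast
    then obtain i where "i < n" "x = rep K ! i"
      using rep_tuple[OF K(1)] by (auto simp: in_set_conv_nth tuples_def)
    then show "x \<in> (\<Union>i\<in>{..<n}. (\<lambda>K. rep K ! i) ` ?Q)" using K(1) by blast
  qed
  moreover have "|\<Union>i\<in>{..<n}. (\<lambda>K. rep K ! i) ` ?Q| <o \<kappa>"
    by (rule finite_UN_less) (use image_less[OF Qk] in auto)
  ultimately have R_less: "|?R| <o \<kappa>" by (rule subset_less)
  have R_univ: "?R \<subseteq> univ C" using rep_tuple by (auto simp: tuples_def)
  let ?B = "N \<union> ?R"
  have B: "?B \<subseteq> univ C" "|?B| <o \<kappa>" using N_univ R_univ Un_less[OF N_less R_less] by auto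
  obtain c where c: "q ?B c" using q_exists[OF B] by blast
  have ct: "c \<in> tuples C n" using q_tuple[OF c] .
  define c0 where "c0 = rep (E `` {c})"
  have KQ: "E `` {c} \<in> ?Q" using ct by (rule quotientI)
  have cK: "c \<in> E `` {c}" using equiv_class_self[OF eq ct] .
  have c0: "q N c0" unfolding c0_def by (rule rep_q[OF cK q_mono[OF c]]) simp
  have "c0 \<in> E `` {c}" unfolding c0_def by (rule rep[OF KQ])
  then have "(c, c0) \<in> E" by simp
  then have c0c: "(c0, c) \<in> E" using eq by (metis equivE symD)
  have "set c0 \<subseteq> ?R" unfolding c0_def using KQ by blast
  then have "N \<union> set c0 \<subseteq> ?B" by (rule Un_mono[OF subset_refl])
  then have qc: "q (N \<union> set c0) c" by (rule q_mono[OF c])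
  have E_pair: "(a', c') \<in> E" if a': "q N a'" and c': "q (N \<union> set a') c'" for a' c'
  proof -
    obtain g where g: "g \<in> Auts N" "a' = map g c0"
      using q_unique[OF N_univ N_less c0 a'] unfolding orb_def by blast
    have "N \<union> set c0 \<subseteq> univ C" using N_univ q_tuple[OF c0] by (auto simp: tuples_def)
    then have "q (g ` (N \<union> set c0)) (map g c)" by (rule q_Auts[OF g(1) _ qc])
    moreover have "g ` (N \<union> set c0) = N \<union> set a'"
      using g Auts_fix[OF g(1)] by (auto simp: image_Un)
    ultimately have gc: "q (N \<union> set a') (map g c)" by simp
    have a'C: "N \<union> set a' \<subseteq> univ C" using N_univ q_tuple[OF a'] by (auto simp: tuples_def)
    obtain h where h: "h \<in> Auts (N \<union> set a')" "c' = map h (map g c)"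
      using q_unique[OF a'C N_Un_less gc c'] unfolding orb_def by auto
    have gA: "g \<in> Auts A" using g(1) Auts_mono[OF A_subset_N] by blast
    have "A \<subseteq> N \<union> set a'" using A_subset_N by blast
    then have hA: "h \<in> Auts A" using h(1) Auts_mono by blast
    have "(a', map g c) \<in> E" using inv gA c0c unfolding invariant_rel_def g(2) by blast
    then have "(map h a', c') \<in> E" using inv hA unfolding invariant_rel_def h(2) by blast
    moreover have "map h a' = a'" by (rule Auts_map_fix[OF h(1)]) simp
    ultimately show ?thesis by simp
  qed
  obtain g where g: "g \<in> Auts N" "b = map g a" using ab unfolding orb_def by blast
  have "g ` N = N" using Auts_fix[OF g(1)] by auto
  then have q_b: "q N b" using q_Auts[OF g(1) N_univ q_a] g(2) by simp
  let ?B' = "N \<union> (set a \<union> set b)"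
  have "?B' \<subseteq> univ C" using N_univ q_tuple[OF q_a] q_tuple[OF q_b] by (auto simp: tuples_def)
  moreover have "|?B'| <o \<kappa>" by (rule N_Un_less) simp
  ultimately obtain c' where c': "q ?B' c'" using q_exists by blast
  have "(a, c') \<in> E" by (rule E_pair[OF q_a q_mono[OF c']]) blast
  moreover have "(b, c') \<in> E" by (rule E_pair[OF q_b q_mono[OF c']]) blast
  ultimately show ?thesis using eq by (metis equivE symD transD)
qed

lemma bounded_equivI:
  assumes eq: "equiv (tuples C n) E" and orb: "\<And>a b. a \<in> tuples C n \<Longrightarrow> orb N a b \<Longrightarrow> (a, b) \<in> E"
  shows "bounded_equiv C \<kappa> n E"
proof -
  let ?F = "formulas L N UNIV :: ('f, 'r, nat, 'a) form set"
  define tp :: "'a list \<Rightarrow> ('f, 'r, nat, 'a) form set" where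
    "tp a = {\<phi> \<in> formulas L N {..<n}. sat C (nenv a) \<phi>}" for a
  define rep where "rep K = (SOME a. a \<in> K)" for K :: "'a list set"
  have rep: "rep K \<in> K" if "K \<in> tuples C n // E" for K
  proof -
    have "K \<noteq> {}" using that eq by (metis in_quotient_imp_non_empty)
    then show ?thesis unfolding rep_def using someI_ex[of "\<lambda>c. c \<in> K"] by blast
  qed
  have rep_tuple: "rep K \<in> tuples C n" if "K \<in> tuples C n // E" for K
    using rep[OF that] in_quotient_imp_subset[OF eq that] by blast
  have "inj_on (tp \<circ> rep) (tuples C n // E)"
  proof (rule inj_onI)
    fix K K' assume K: "K \<in> tuples C n // E" "K' \<in> tuples C n // E" "(tp \<circ> rep) K = (tp \<circ> rep) K'"
    have "orb N (rep K) (rep K')"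
    proof (rule homogeneity[OF N_univ N_less rep_tuple[OF K(1)] rep_tuple[OF K(2)]])
      fix D assume D: "dset N n D" "rep K \<in> D"
      obtain \<phi> :: "('f, 'r, nat, 'a) form" where
        \<phi>: "\<phi> \<in> formulas L N {..<n}" "D = {a \<in> tuples C n. sat C (nenv a) \<phi>}"
        using D(1) unfolding dset_def by blast
      have "\<phi> \<in> tp (rep K)" using \<phi> D(2) unfolding tp_def by simp
      then have "\<phi> \<in> tp (rep K')" using K(3) by simp
      then show "rep K' \<in> D" using \<phi>(2) rep_tuple[OF K(2)] unfolding tp_def by simp
    qed
    then have "(rep K, rep K') \<in> E" using orb rep_tuple[OF K(1)] by blast
    then show "K = K'" using quotient_eqI[OF eq K(1,2) rep[OF K(1)] rep[OF K(2)]] by blast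
  qed
  moreover have "(tp \<circ> rep) ` (tuples C n // E) \<subseteq> Pow ?F" unfolding tp_def formulas_def by auto
  ultimately have "|tuples C n // E| \<le>o |Pow ?F|" using card_of_ordLeq[of _ "Pow ?F"] by blast
  moreover have "|Pow ?F| <o \<kappa>" using small_N unfolding small_def by blast
  ultimately show ?thesis using eq ordLeq_ordLess_trans unfolding bounded_equiv_def by blast
qed

text \<open>Lascar's description of his strong types: chains of tuples in which neighbours have the same type
  over a small model. Conjugates of \<open>N\<close> over \<open>A\<close> suffice as the models.\<close>

definition Lascar_step :: "nat \<Rightarrow> 'a list rel" where
  "Lascar_step n = {(a, b). a \<in> tuples C n \<and> (\<exists>g \<in> Auts A. orb (g ` N) a b)}"

definition Ls :: "nat \<Rightarrow> 'a list rel" where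
  "Ls n = (Lascar_step n)\<^sup>+"

lemma image_N_univ: "g \<in> Auts A \<Longrightarrow> g ` N \<subseteq> univ C"
  using N_univ Auts_univ by blast

lemma A_subset_image_N: "g \<in> Auts A \<Longrightarrow> A \<subseteq> g ` N"
  using A_subset_N Auts_fix by force

lemma Lascar_step_tuples: "Lascar_step n \<subseteq> tuples C n \<times> tuples C n"
  using orb_tuples unfolding Lascar_step_def by blast

lemma orb_Auts:
  assumes g: "g \<in> Auts A" and M: "M \<subseteq> univ C" and a: "set a \<subseteq> univ C" and ab: "orb M a b"
  shows "orb (g ` M) (map g a) (map g b)"
proof -
  obtain h where h: "h \<in> Auts M" "b = map h a" using ab unfolding orb_def by blast
  obtain g' where g': "g' \<in> Auts A" "\<And>x. x \<in> univ C \<Longrightarrow> g' (g x) = x"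
    using Auts_inverse[OF g A_univ] by blast
  have e: "g \<in> Auts {}" "g' \<in> Auts {}" "h \<in> Auts {}" using g g'(1) h(1) Auts_mono[OF empty_subsetI] by blast+
  have "g \<circ> (h \<circ> g') \<in> Auts {}" using e Auts_comp by blast
  moreover have "(g \<circ> (h \<circ> g')) y = y" if "y \<in> g ` M" for y
    using that g'(2) M Auts_fix[OF h(1)] by auto
  ultimately have "g \<circ> (h \<circ> g') \<in> Auts (g ` M)" unfolding automorphisms_def by blast
  moreover have "map g b = map (g \<circ> (h \<circ> g')) (map g a)" using h(2) g'(2) a by auto
  ultimately show ?thesis unfolding orb_def by blast
qed

lemma Lascar_step_Auts:
  assumes "(a, b) \<in> Lascar_step n" "g \<in> Auts A" shows "(map g a, map g b) \<in> Lascar_step n"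
proof -
  obtain h where h: "a \<in> tuples C n" "h \<in> Auts A" "orb (h ` N) a b"
    using assms(1) unfolding Lascar_step_def by blast
  have "set a \<subseteq> univ C" using h(1) by (simp add: tuples_def)
  then have "orb (g ` h ` N) (map g a) (map g b)"
    using orb_Auts[OF assms(2) image_N_univ[OF h(2)] _ h(3)] by blast
  then have "orb ((g \<circ> h) ` N) (map g a) (map g b)" by (simp add: image_comp)
  then show ?thesis using Auts_comp[OF assms(2) h(2)] Auts_tuples[OF assms(2) h(1)]
    unfolding Lascar_step_def by blast
qed

lemma Ls_Auts:
  assumes "(a, b) \<in> Ls n" "g \<in> Auts A" shows "(map g a, map g b) \<in> Ls n"
  using assms(1) unfolding Ls_def
proof (induction rule: trancl_induct)
  case (base b)
  then show ?case using Lascar_step_Auts[OF _ assms(2)] by blast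
next
  case (step b c)
  then show ?case using Lascar_step_Auts[OF step(2) assms(2)] by (rule_tac trancl_into_trancl)
qed

lemma orb_N_Ls: "a \<in> tuples C n \<Longrightarrow> orb N a b \<Longrightarrow> (a, b) \<in> Ls n"
proof -
  assume "a \<in> tuples C n" "orb N a b"
  moreover have "orb (id ` N) a b \<longleftrightarrow> orb N a b" by simp
  ultimately have "(a, b) \<in> Lascar_step n" unfolding Lascar_step_def using Auts_id by blast
  then show ?thesis unfolding Ls_def by (rule r_into_trancl)
qed

lemma Ls_tuples: "(a, b) \<in> Ls n \<Longrightarrow> a \<in> tuples C n \<and> b \<in> tuples C n"
  unfolding Ls_def using trancl_subset_Sigma[OF Lascar_step_tuples] by blast

lemma equiv_Ls: "equiv (tuples C n) (Ls n)"
proof (rule equivI)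
  show "Ls n \<subseteq> tuples C n \<times> tuples C n" using Ls_tuples by auto
  show "refl_on (tuples C n) (Ls n)" using orb_N_Ls orb_refl by (auto intro: refl_onI)
  have "(b, a) \<in> Lascar_step n" if ab: "(a, b) \<in> Lascar_step n" for a b
  proof -
    obtain g where g: "a \<in> tuples C n" "g \<in> Auts A" "orb (g ` N) a b"
      using ab unfolding Lascar_step_def by blast
    have "set a \<subseteq> univ C" using g(1) by (simp add: tuples_def)
    then have "orb (g ` N) b a" using orb_sym[OF g(3) image_N_univ[OF g(2)]] by blast
    then show ?thesis using g orb_tuples unfolding Lascar_step_def by blast
  qed
  then show "sym (Ls n)" unfolding Ls_def by (intro sym_trancl symI)
  show "trans (Ls n)" unfolding Ls_def by (rule trans_trancl)
qed

lemma Ls_refl: "a \<in> tuples C n \<Longrightarrow> (a, a) \<in> Ls n"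
  using orb_N_Ls orb_refl by blast

lemma Ls_sym: "(a, b) \<in> Ls n \<Longrightarrow> (b, a) \<in> Ls n"
  using equiv_Ls by (metis equivE symD)

lemma Ls_trans: "(a, b) \<in> Ls n \<Longrightarrow> (b, c) \<in> Ls n \<Longrightarrow> (a, c) \<in> Ls n"
  using equiv_Ls by (metis equivE transD)

lemma Ls_orb_A: "(a, b) \<in> Ls n \<Longrightarrow> orb A a b"
  unfolding Ls_def
proof (induction rule: trancl_induct)
  case (base b)
  then show ?case unfolding Lascar_step_def using orb_mono[OF A_subset_image_N] by blast
next
  case (step b c)
  then have "orb A b c" unfolding Lascar_step_def using orb_mono[OF A_subset_image_N] by blast
  then show ?case using step orb_trans by blast
qed

text \<open>The inverse of \<open>g\<close> moves conjugacy over \<open>g ` N\<close> to conjugacy over \<open>N\<close>, and \<open>E\<close> is invariant.\<close>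

lemma Ls_subset:
  assumes bd: "bounded_equiv C \<kappa> n E" and inv: "invariant_rel L C A E"
  shows "Ls n \<subseteq> E"
proof -
  have eq: "equiv (tuples C n) E" using bd unfolding bounded_equiv_def by blast
  have "Lascar_step n \<subseteq> E"
  proof (clarify)
    fix a b assume "(a, b) \<in> Lascar_step n"
    then obtain g where g: "a \<in> tuples C n" "g \<in> Auts A" "orb (g ` N) a b"
      unfolding Lascar_step_def by blast
    obtain g' where g': "g' \<in> Auts A" "\<And>x. x \<in> univ C \<Longrightarrow> g' (g x) = x" "\<And>x. x \<in> univ C \<Longrightarrow> g (g' x) = x"
      using Auts_inverse[OF g(2) A_univ] by blast
    have aC: "set a \<subseteq> univ C" and bC: "set b \<subseteq> univ C"
      using g(1) orb_tuples[OF g(3) g(1)] by (simp_all add: tuples_def)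
    have "g' ` g ` N = N" using g'(2) N_univ by force
    then have "orb N (map g' a) (map g' b)"
      using orb_Auts[OF g'(1) image_N_univ[OF g(2)] aC g(3)] by simp
    then have "(map g' a, map g' b) \<in> E"
      using bounded_invariant_contains_orb_N[OF bd inv Auts_tuples[OF g'(1) g(1)]] by blast
    then have "(map g (map g' a), map g (map g' b)) \<in> E" using inv g(2) unfolding invariant_rel_def by blast
    moreover have "map g (map g' a) = a" "map g (map g' b) = b"
      using g'(3) aC bC by (auto intro!: map_idI)
    ultimately show "(a, b) \<in> E" by simp
  qed
  then have "(Lascar_step n)\<^sup>+ \<subseteq> E\<^sup>+" by (auto intro: trancl_mono)
  moreover have "E\<^sup>+ = E" using eq by (metis equivE trancl_id)
  ultimately show ?thesis unfolding Ls_def by simp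
qed

lemma Lascar_equiv_eq_Ls: "Lascar_equiv L C \<kappa> A n = Ls n"
  unfolding Lascar_equiv_def
proof (rule Least_equality)
  have "bounded_equiv C \<kappa> n (Ls n)" by (rule bounded_equivI[OF equiv_Ls orb_N_Ls])
  moreover have "invariant_rel L C A (Ls n)" unfolding invariant_rel_def using Ls_Auts by blast
  ultimately show "bounded_equiv C \<kappa> n (Ls n) \<and> invariant_rel L C A (Ls n)" ..
  show "Ls n \<subseteq> E" if "bounded_equiv C \<kappa> n E \<and> invariant_rel L C A E" for E
    using Ls_subset that by blast
qed

end

section \<open>Type-definable sets and Kim--Pillay strong types\<close>

context monster_model
begin

definition tdef :: "'a set \<Rightarrow> nat \<Rightarrow> 'a list set \<Rightarrow> bool" where
  "tdef B n S \<longleftrightarrow> (\<exists>F. (\<forall>D \<in> F. dset B n D) \<and> S = {a \<in> tuples C n. \<forall>D \<in> F. a \<in> D})"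

lemma tdefI: "(\<And>D. D \<in> F \<Longrightarrow> dset B n D) \<Longrightarrow> tdef B n {a \<in> tuples C n. \<forall>D \<in> F. a \<in> D}"
  unfolding tdef_def by (rule exI[of _ F]) blast

lemma tdefE:
  assumes "tdef B n S"
  obtains F where "\<And>D. D \<in> F \<Longrightarrow> dset B n D" "S = {a \<in> tuples C n. \<forall>D \<in> F. a \<in> D}"
  using assms unfolding tdef_def by blast

lemma tdef_subset: "tdef B n S \<Longrightarrow> S \<subseteq> tuples C n"
  unfolding tdef_def by blast

lemma tdef_mono: "tdef A n S \<Longrightarrow> A \<subseteq> B \<Longrightarrow> tdef B n S"
  unfolding tdef_def by (blast intro: dset_mono)

text \<open>A type-definable set is the intersection of all definable sets that contain it, a form that needs no
  choice of a defining family.\<close>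

lemma tdef_iff_hull:
  "tdef B n S \<longleftrightarrow> S = {a \<in> tuples C n. \<forall>D. dset B n D \<longrightarrow> S \<subseteq> D \<longrightarrow> a \<in> D}"
proof
  assume S: "tdef B n S"
  obtain F where F: "\<And>D. D \<in> F \<Longrightarrow> dset B n D" "S = {a \<in> tuples C n. \<forall>D \<in> F. a \<in> D}"
    using tdefE[OF S] by blast
  show "S = {a \<in> tuples C n. \<forall>D. dset B n D \<longrightarrow> S \<subseteq> D \<longrightarrow> a \<in> D}"
  proof
    show "S \<subseteq> {a \<in> tuples C n. \<forall>D. dset B n D \<longrightarrow> S \<subseteq> D \<longrightarrow> a \<in> D}" using F(2) by blast
    show "{a \<in> tuples C n. \<forall>D. dset B n D \<longrightarrow> S \<subseteq> D \<longrightarrow> a \<in> D} \<subseteq> S"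
    proof
      fix a assume a: "a \<in> {a \<in> tuples C n. \<forall>D. dset B n D \<longrightarrow> S \<subseteq> D \<longrightarrow> a \<in> D}"
      have "a \<in> D" if D: "D \<in> F" for D
      proof -
        have "S \<subseteq> D" unfolding F(2) using D by blast
        then show ?thesis using a F(1)[OF D] by simp
      qed
      then have "a \<in> {a \<in> tuples C n. \<forall>D \<in> F. a \<in> D}" using a by simp
      then show "a \<in> S" unfolding F(2) .
    qed
  qed
next
  assume S: "S = {a \<in> tuples C n. \<forall>D. dset B n D \<longrightarrow> S \<subseteq> D \<longrightarrow> a \<in> D}"
  have "tdef B n {a \<in> tuples C n. \<forall>D \<in> {D. dset B n D \<and> S \<subseteq> D}. a \<in> D}" by (rule tdefI) simp
  also have "{a \<in> tuples C n. \<forall>D \<in> {D. dset B n D \<and> S \<subseteq> D}. a \<in> D} = S"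
    by (rule trans[OF _ S[symmetric]]) (rule Collect_cong, blast)
  finally show "tdef B n S" .
qed

lemma tdef_INT:
  assumes "\<And>i. i \<in> I \<Longrightarrow> tdef B n (S i)"
  shows "tdef B n {a \<in> tuples C n. \<forall>i \<in> I. a \<in> S i}"
proof -
  have "\<forall>i \<in> I. \<exists>F. (\<forall>D \<in> F. dset B n D) \<and> S i = {a \<in> tuples C n. \<forall>D \<in> F. a \<in> D}"
    using assms unfolding tdef_def by blast
  from bchoice[OF this] obtain F where
    F: "\<forall>i \<in> I. (\<forall>D \<in> F i. dset B n D) \<and> S i = {a \<in> tuples C n. \<forall>D \<in> F i. a \<in> D}" ..
  have "tdef B n {a \<in> tuples C n. \<forall>D \<in> (\<Union>i\<in>I. F i). a \<in> D}" by (rule tdefI) (use F in blast)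
  also have "{a \<in> tuples C n. \<forall>D \<in> (\<Union>i\<in>I. F i). a \<in> D} = {a \<in> tuples C n. \<forall>i \<in> I. a \<in> S i}"
  proof (rule Collect_cong)
    fix a
    have "(\<forall>D \<in> F i. a \<in> D) \<longleftrightarrow> a \<in> S i" if "a \<in> tuples C n" "i \<in> I" for i
      using bspec[OF F that(2)] that(1) by simp
    then show "a \<in> tuples C n \<and> (\<forall>D \<in> (\<Union>i\<in>I. F i). a \<in> D) \<longleftrightarrow> a \<in> tuples C n \<and> (\<forall>i \<in> I. a \<in> S i)"
      by auto
  qed
  finally show ?thesis .
qed

lemma tdef_Int:
  assumes "tdef B n S" "tdef B n S'" shows "tdef B n (S \<inter> S')"
proof -
  have "tdef B n {a \<in> tuples C n. \<forall>X \<in> {S, S'}. a \<in> X}" by (rule tdef_INT) (use assms in auto)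
  moreover have "{a \<in> tuples C n. \<forall>X \<in> {S, S'}. a \<in> X} = S \<inter> S'"
    using tdef_subset[OF assms(1)] by auto
  ultimately show ?thesis by simp
qed

lemma tdef_select:
  assumes "tdef B n S" "length js = n" "\<And>j. j \<in> set js \<Longrightarrow> j < m"
  shows "tdef B m {a \<in> tuples C m. map ((!) a) js \<in> S}"
proof -
  obtain F where F: "\<And>D. D \<in> F \<Longrightarrow> dset B n D" "S = {a \<in> tuples C n. \<forall>D \<in> F. a \<in> D}"
    using tdefE[OF assms(1)] by blast
  have "tdef B m {a \<in> tuples C m. \<forall>E \<in> (\<lambda>D. {a \<in> tuples C m. map ((!) a) js \<in> D}) ` F. a \<in> E}"
    by (rule tdefI, erule imageE) (simp only: dset_select[OF F(1) assms(2,3)])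
  moreover have "map ((!) a) js \<in> tuples C n" if "a \<in> tuples C m" for a
    using that assms(2,3) by (fastforce simp: tuples_def)
  ultimately show ?thesis unfolding F(2) by (simp cong: conj_cong)
qed

lemma tdef_fix:
  assumes "tdef B (n + k) S" "length b = k" "set b \<subseteq> B" "set b \<subseteq> univ C"
  shows "tdef B n {a \<in> tuples C n. a @ b \<in> S}"
proof -
  obtain F where F: "\<And>D. D \<in> F \<Longrightarrow> dset B (n + k) D" "S = {a \<in> tuples C (n + k). \<forall>D \<in> F. a \<in> D}"
    using tdefE[OF assms(1)] by blast
  have "tdef B n {a \<in> tuples C n. \<forall>E \<in> (\<lambda>D. {a \<in> tuples C n. a @ b \<in> D}) ` F. a \<in> E}"
    by (rule tdefI, erule imageE) (simp only: dset_fix[OF F(1) assms(2-4)])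
  moreover have "a @ b \<in> tuples C (n + k)" if "a \<in> tuples C n" for a
    using that assms by (auto simp: tuples_def)
  ultimately show ?thesis unfolding F(2) by (simp cong: conj_cong)
qed

text \<open>If every finite part of the definition has a witness \<open>b\<close> for \<open>a\<close>, then by compactness
  over \<open>B\<close> and \<open>a\<close> a single \<open>b\<close> satisfies the whole.\<close>

lemma tdef_project:
  assumes S: "tdef B (n + k) S" and B: "B \<subseteq> univ C" "|B| <o \<kappa>"
  shows "tdef B n {a \<in> tuples C n. \<exists>b. length b = k \<and> a @ b \<in> S}"
proof -
  obtain F where F: "\<And>D. D \<in> F \<Longrightarrow> dset B (n + k) D" "S = {a \<in> tuples C (n + k). \<forall>D \<in> F. a \<in> D}"
    using tdefE[OF S] by blast
  let ?I = "\<lambda>G. {a \<in> tuples C (n + k). \<forall>D \<in> G. a \<in> D}"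
  let ?P = "\<lambda>G. {a \<in> tuples C n. \<exists>b. length b = k \<and> a @ b \<in> ?I G}"
  let ?\<G> = "{G. finite G \<and> G \<subseteq> F}"
  have "tdef B n {a \<in> tuples C n. \<forall>E \<in> ?P ` ?\<G>. a \<in> E}"
  proof (rule tdefI)
    fix E assume "E \<in> ?P ` ?\<G>"
    then obtain G where G: "finite G" "G \<subseteq> F" "E = ?P G" by blast
    have "dset B (n + k) (?I G)" by (rule dset_INT[OF G(1)]) (use G(2) F(1) in blast)
    then show "dset B n E" unfolding G(3) by (rule dset_project)
  qed
  moreover have "{a \<in> tuples C n. \<forall>E \<in> ?P ` ?\<G>. a \<in> E} = {a \<in> tuples C n. \<exists>b. length b = k \<and> a @ b \<in> S}"
  proof (rule Collect_cong, rule conj_cong[OF refl])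
    fix a assume a: "a \<in> tuples C n"
    show "(\<forall>E \<in> ?P ` ?\<G>. a \<in> E) \<longleftrightarrow> (\<exists>b. length b = k \<and> a @ b \<in> S)"
    proof
      assume all: "\<forall>E \<in> ?P ` ?\<G>. a \<in> E"
      let ?B = "B \<union> set a"
      let ?fib = "\<lambda>D. {b \<in> tuples C k. a @ b \<in> D}"
      have "\<exists>b \<in> tuples C k. \<forall>D \<in> F. b \<in> ?fib D"
      proof (rule compactness)
        show "?B \<subseteq> univ C" using a B(1) by (auto simp: tuples_def)
        show "|?B| <o \<kappa>" by (rule Un_less[OF B(2) finite_less]) simp
        fix D assume "D \<in> F"
        then have "dset ?B (n + k) D" by (rule dset_mono[OF F(1)]) blast
        then show "dset ?B k (?fib D)" by (rule dset_fix_front[OF _ a]) blast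
      next
        fix G assume "finite G" "G \<subseteq> F"
        then have "a \<in> ?P G" using all by simp
        then obtain b where b: "length b = k" "a @ b \<in> ?I G" by blast
        then have "b \<in> tuples C k" by (auto simp: tuples_def)
        then show "\<exists>b\<in>tuples C k. \<forall>D\<in>G. b \<in> ?fib D" using b by (intro bexI[of _ b]) simp_all
      qed
      then obtain b where b: "b \<in> tuples C k" "\<forall>D \<in> F. b \<in> ?fib D" ..
      have "a @ b \<in> tuples C (n + k)" using a b(1) by (auto simp: tuples_def)
      then have "a @ b \<in> S" unfolding F(2) using b(2) by simp
      then show "\<exists>b. length b = k \<and> a @ b \<in> S" using b(1) by (auto simp: tuples_def)
    next
      assume "\<exists>b. length b = k \<and> a @ b \<in> S"
      then obtain b where "length b = k" "a @ b \<in> S" by blast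
      then show "\<forall>E \<in> ?P ` ?\<G>. a \<in> E" unfolding F(2) using a by auto
    qed
  qed
  ultimately show ?thesis by simp
qed

lemma tdef_orbit:
  assumes A: "A \<subseteq> univ C" "|A| <o \<kappa>" and a: "a \<in> tuples C n"
  shows "tdef A n {b. orb A a b}"
proof -
  have "tdef A n {b \<in> tuples C n. \<forall>D \<in> {D. dset A n D \<and> a \<in> D}. b \<in> D}" by (rule tdefI) simp
  also have "{b \<in> tuples C n. \<forall>D \<in> {D. dset A n D \<and> a \<in> D}. b \<in> D} = {b. orb A a b}"
  proof (intro set_eqI iffI)
    fix b assume b: "b \<in> {b \<in> tuples C n. \<forall>D \<in> {D. dset A n D \<and> a \<in> D}. b \<in> D}"
    have "orb A a b" by (rule homogeneity[OF A a]) (use b in auto)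
    then show "b \<in> {b. orb A a b}" by simp
  next
    fix b assume "b \<in> {b. orb A a b}"
    then have "orb A a b" by simp
    then show "b \<in> {b \<in> tuples C n. \<forall>D \<in> {D. dset A n D \<and> a \<in> D}. b \<in> D}"
      using dset_orb[OF _ A(1) _ a] orb_tuples[OF _ a] by simp
  qed
  finally show ?thesis .
qed

lemma tdef_conjugate_pairs:
  assumes A: "A \<subseteq> univ C" "|A| <o \<kappa>"
  shows "tdef A (n + n) {x \<in> tuples C (n + n). orb A (take n x) (drop n x)}"
proof -
  define X where "X D = {x \<in> tuples C (n + n). take n x \<in> D}" for D
  define Y where "Y D = {x \<in> tuples C (n + n). drop n x \<in> D}" for D
  have sel: "map ((!) x) [0..<n] = take n x" "map ((!) x) [n..<n + n] = drop n x"
    if "x \<in> tuples C (n + n)" for x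
  proof -
    have len: "length x = n + n" using that by (simp add: tuples_def)
    show "map ((!) x) [0..<n] = take n x" by (rule nth_equalityI) (use len in auto)
    show "map ((!) x) [n..<n + n] = drop n x" by (rule nth_equalityI) (use len in auto)
  qed
  have dX: "dset A (n + n) (X D)" if "dset A n D" for D
  proof -
    have "dset A (n + n) {x \<in> tuples C (n + n). map ((!) x) [0..<n] \<in> D}"
      by (rule dset_select[OF that]) auto
    then show ?thesis unfolding X_def using sel(1) by (simp cong: conj_cong)
  qed
  have dY: "dset A (n + n) (Y D)" if "dset A n D" for D
  proof -
    have "dset A (n + n) {x \<in> tuples C (n + n). map ((!) x) [n..<n + n] \<in> D}"
      by (rule dset_select[OF that]) auto
    then show ?thesis unfolding Y_def using sel(2) by (simp cong: conj_cong)
  qed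
  define Z where "Z D = (tuples C (n + n) - X D) \<union> Y D" for D
  have "tdef A (n + n) {x \<in> tuples C (n + n). \<forall>E \<in> Z ` {D. dset A n D}. x \<in> E}"
  proof (rule tdefI)
    fix E assume "E \<in> Z ` {D. dset A n D}"
    then obtain D where D: "dset A n D" "E = Z D" by blast
    show "dset A (n + n) E" unfolding D(2) Z_def by (rule dset_Un[OF dset_Compl[OF dX[OF D(1)]] dY[OF D(1)]])
  qed
  also have "{x \<in> tuples C (n + n). \<forall>E \<in> Z ` {D. dset A n D}. x \<in> E} =
    {x \<in> tuples C (n + n). orb A (take n x) (drop n x)}"
  proof (rule Collect_cong, rule conj_cong[OF refl])
    fix x assume x: "x \<in> tuples C (n + n)"
    have t: "take n x \<in> tuples C n" "drop n x \<in> tuples C n" using x take_drop_tuples by blast+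
    show "(\<forall>E \<in> Z ` {D. dset A n D}. x \<in> E) \<longleftrightarrow> orb A (take n x) (drop n x)"
    proof
      assume all: "\<forall>E \<in> Z ` {D. dset A n D}. x \<in> E"
      show "orb A (take n x) (drop n x)"
      proof (rule homogeneity[OF A t])
        fix D assume D: "dset A n D" "take n x \<in> D"
        have "x \<in> Z D" using all D(1) by blast
        then show "drop n x \<in> D" using D(2) x unfolding Z_def X_def Y_def by simp
      qed
    next
      assume "orb A (take n x) (drop n x)"
      then have "drop n x \<in> D \<longleftrightarrow> take n x \<in> D" if "dset A n D" for D
        using dset_orb[OF that A(1) _ t(1)] by blast
      then show "\<forall>E \<in> Z ` {D. dset A n D}. x \<in> E" using x unfolding Z_def X_def Y_def by simp
    qed
  qed
  finally show ?thesis .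
qed

text \<open>A set type-definable over \<open>B\<close> and invariant over the smaller set \<open>A\<close> is type-definable over \<open>A\<close>. If \<open>a\<close> lies
  in every \<open>A\<close>-definable set containing \<open>S\<close>, then the definition of \<open>S\<close> is consistent with the type of \<open>a\<close>
  over \<open>A\<close>; a common realization is conjugate to \<open>a\<close> and lies in \<open>S\<close>.\<close>

lemma tdef_invariant:
  assumes B: "B \<subseteq> univ C" "|B| <o \<kappa>" and AB: "A \<subseteq> B" and S: "tdef B n S"
    and inv: "\<And>a b. a \<in> S \<Longrightarrow> orb A a b \<Longrightarrow> b \<in> S"
  shows "tdef A n S"
  unfolding tdef_iff_hull
proof (intro set_eqI iffI)
  fix a assume "a \<in> S"
  then show "a \<in> {a \<in> tuples C n. \<forall>D. dset A n D \<longrightarrow> S \<subseteq> D \<longrightarrow> a \<in> D}"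
    using tdef_subset[OF S] by blast
next
  fix a assume a: "a \<in> {a \<in> tuples C n. \<forall>D. dset A n D \<longrightarrow> S \<subseteq> D \<longrightarrow> a \<in> D}"
  have A: "A \<subseteq> univ C" "|A| <o \<kappa>" using AB B subset_less by auto
  obtain F where F: "\<And>D. D \<in> F \<Longrightarrow> dset B n D" "S = {a \<in> tuples C n. \<forall>D \<in> F. a \<in> D}"
    using tdefE[OF S] by blast
  let ?H = "{D. dset A n D \<and> a \<in> D}"
  have "\<exists>b \<in> tuples C n. \<forall>D \<in> F \<union> ?H. b \<in> D"
  proof (rule compactness[OF B])
    show "dset B n D" if "D \<in> F \<union> ?H" for D using that F(1) dset_mono[OF _ AB] by blast
    fix G assume G: "finite G" "G \<subseteq> F \<union> ?H"
    let ?I = "{x \<in> tuples C n. \<forall>D \<in> G \<inter> ?H. x \<in> D}"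
    have I: "dset A n ?I" by (rule dset_INT) (use G in auto)
    have "a \<in> ?I" using a by simp
    then have "\<not> S \<subseteq> tuples C n - ?I" using a dset_Compl[OF I] by blast
    then obtain b where b: "b \<in> S" "b \<in> ?I" using tdef_subset[OF S] by blast
    have bS: "b \<in> {a \<in> tuples C n. \<forall>D \<in> F. a \<in> D}" using b(1) unfolding F(2) .
    have "\<forall>D \<in> G. b \<in> D"
    proof
      fix D assume D: "D \<in> G"
      then have "D \<in> F \<or> D \<in> ?H" using G by blast
      then show "b \<in> D" using b(2) bS D by blast
    qed
    moreover have "b \<in> tuples C n" using b(2) by simp
    ultimately show "\<exists>x\<in>tuples C n. \<forall>D\<in>G. x \<in> D" by (rule bexI)
  qed
  then obtain b where b: "b \<in> tuples C n" "\<forall>D \<in> F \<union> ?H. b \<in> D" ..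
  have "b \<in> {a \<in> tuples C n. \<forall>D \<in> F. a \<in> D}" using b by simp
  then have bS: "b \<in> S" unfolding F(2) .
  have at: "a \<in> tuples C n" using a by simp
  have "orb A a b" by (rule homogeneity[OF A at b(1)]) (use b(2) in simp)
  moreover have "set a \<subseteq> univ C" using at by (simp add: tuples_def)
  ultimately have "orb A b a" by (rule orb_sym[OF _ A(1)])
  then show "a \<in> S" by (rule inv[OF bS])
qed

lemma upds_nth:
  "distinct xs \<Longrightarrow> length ys = length xs \<Longrightarrow> i < length xs \<Longrightarrow> (f(xs [\<mapsto>] ys)) (xs ! i) = Some (ys ! i)"
proof (induction xs arbitrary: f ys i)
  case (Cons x xs)
  obtain y ys' where ys: "ys = y # ys'" using Cons.prems(2) by (cases ys) auto
  show ?case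
  proof (cases i)
    case 0
    then show ?thesis using Cons.prems ys by (simp add: map_upds_apply_nontin)
  next
    case (Suc j)
    then show ?thesis using Cons.prems ys Cons.IH[of ys' j "f(x \<mapsto> y)"]
      by (simp del: map_upds_twist fun_upd_apply)
  qed
qed simp

lemma holds_inst_iff:
  fixes \<sigma> :: "('f, 'r, nat, 'a) form"
  assumes "fv \<sigma> \<subseteq> {..<2 * n}" "a \<in> tuples C n" "b \<in> tuples C n"
  shows "holds C (inst [[0..<2 * n] [\<mapsto>] a @ b] \<sigma>) \<longleftrightarrow> sat C (nenv (a @ b)) \<sigma>"
proof -
  have ab: "a @ b \<in> tuples C (2 * n)" using assms by (auto simp: tuples_def)
  have "sat C e (inst [[0..<2 * n] [\<mapsto>] a @ b] \<sigma>) \<longleftrightarrow> sat C (nenv (a @ b)) \<sigma>" for e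
    unfolding sat_inst
  proof (rule sat_cong)
    fix v assume "v \<in> fv \<sigma>"
    then have v: "v < 2 * n" using assms(1) by auto
    have "[[0..<2 * n] [\<mapsto>] a @ b] ([0..<2 * n] ! v) = Some ((a @ b) ! v)"
      by (rule upds_nth) (use ab v in \<open>simp_all add: tuples_def\<close>)
    then show "(case [[0..<2 * n] [\<mapsto>] a @ b] v of None \<Rightarrow> e v | Some a \<Rightarrow> a) = nenv (a @ b) v"
      using v ab by (simp add: tuples_def nenv_def)
  qed
  then show ?thesis using nenv_vals[OF ab] unfolding holds_def by blast
qed

definition pairs :: "'a list rel \<Rightarrow> 'a list set" where
  "pairs E = (\<lambda>(a, b). a @ b) ` E"

lemma append_in_pairs:
  assumes "E \<subseteq> tuples C n \<times> tuples C n" "length a = n" "length b = n"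
  shows "a @ b \<in> pairs E \<longleftrightarrow> (a, b) \<in> E"
proof
  assume "a @ b \<in> pairs E"
  then obtain c d where cd: "(c, d) \<in> E" "a @ b = c @ d" unfolding pairs_def by auto
  then have "length c = n" using assms(1) by (auto simp: tuples_def)
  then show "(a, b) \<in> E" using cd assms(2) by simp
qed (force simp: pairs_def)

lemma tdef_iff_formulas:
  "tdef B n S \<longleftrightarrow> (\<exists>\<Sigma> :: ('f, 'r, nat, 'a) form set. \<Sigma> \<subseteq> formulas L B {..<n} \<and>
    S = {a \<in> tuples C n. \<forall>\<sigma> \<in> \<Sigma>. sat C (nenv a) \<sigma>})"
proof
  let ?D = "\<lambda>\<sigma> :: ('f, 'r, nat, 'a) form. {a \<in> tuples C n. sat C (nenv a) \<sigma>}"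
  assume S: "tdef B n S"
  obtain F where F: "\<And>D. D \<in> F \<Longrightarrow> dset B n D" "S = {a \<in> tuples C n. \<forall>D \<in> F. a \<in> D}"
    using tdefE[OF S] by blast
  have "\<forall>D \<in> F. \<exists>\<sigma> :: ('f, 'r, nat, 'a) form. \<sigma> \<in> formulas L B {..<n} \<and> D = ?D \<sigma>"
    using F(1) unfolding dset_def by blast
  from bchoice[OF this] obtain \<sigma> :: "_ \<Rightarrow> ('f, 'r, nat, 'a) form" where
    \<sigma>: "\<forall>D \<in> F. \<sigma> D \<in> formulas L B {..<n} \<and> D = ?D (\<sigma> D)" ..
  have "a \<in> D \<longleftrightarrow> sat C (nenv a) (\<sigma> D)" if "D \<in> F" "a \<in> tuples C n" for a D
  proof -
    have "D = ?D (\<sigma> D)" using bspec[OF \<sigma> that(1)] by blast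
    then have "a \<in> D \<longleftrightarrow> a \<in> ?D (\<sigma> D)" by (rule arg_cong)
    then show ?thesis using that(2) by simp
  qed
  then have "S = {a \<in> tuples C n. \<forall>\<psi> \<in> \<sigma> ` F. sat C (nenv a) \<psi>}" unfolding F(2) by auto
  moreover have "\<sigma> ` F \<subseteq> formulas L B {..<n}" using \<sigma> by blast
  ultimately show "\<exists>\<Sigma> :: ('f, 'r, nat, 'a) form set. \<Sigma> \<subseteq> formulas L B {..<n} \<and>
    S = {a \<in> tuples C n. \<forall>\<sigma> \<in> \<Sigma>. sat C (nenv a) \<sigma>}" by blast
next
  assume "\<exists>\<Sigma> :: ('f, 'r, nat, 'a) form set. \<Sigma> \<subseteq> formulas L B {..<n} \<and>
    S = {a \<in> tuples C n. \<forall>\<sigma> \<in> \<Sigma>. sat C (nenv a) \<sigma>}"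
  then obtain \<Sigma> :: "('f, 'r, nat, 'a) form set" where \<Sigma>: "\<Sigma> \<subseteq> formulas L B {..<n}"
    "S = {a \<in> tuples C n. \<forall>\<sigma> \<in> \<Sigma>. sat C (nenv a) \<sigma>}" by blast
  let ?F = "(\<lambda>\<sigma>. {a \<in> tuples C n. sat C (nenv a) \<sigma>}) ` \<Sigma>"
  have "tdef B n {a \<in> tuples C n. \<forall>D \<in> ?F. a \<in> D}"
    by (rule tdefI) (use \<Sigma>(1) in \<open>auto simp: dset_def\<close>)
  moreover have "{a \<in> tuples C n. \<forall>D \<in> ?F. a \<in> D} = S" unfolding \<Sigma>(2) by auto
  ultimately show "tdef B n S" by simp
qed

lemma pairs_eq_iff:
  assumes "S \<subseteq> tuples C (n + n)"
  shows "E = {(a, b). a \<in> tuples C n \<and> b \<in> tuples C n \<and> a @ b \<in> S} \<longleftrightarrow>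
    E \<subseteq> tuples C n \<times> tuples C n \<and> pairs E = S"
proof
  assume E: "E = {(a, b). a \<in> tuples C n \<and> b \<in> tuples C n \<and> a @ b \<in> S}"
  have "x \<in> pairs E" if x: "x \<in> S" for x
  proof -
    have "(take n x, drop n x) \<in> E" unfolding E using x take_drop_tuples[OF subsetD[OF assms x]] by simp
    then have "take n x @ drop n x \<in> pairs E" unfolding pairs_def by blast
    then show ?thesis by simp
  qed
  moreover have "pairs E \<subseteq> S" unfolding E pairs_def by auto
  ultimately show "E \<subseteq> tuples C n \<times> tuples C n \<and> pairs E = S" using E by blast
next
  assume E: "E \<subseteq> tuples C n \<times> tuples C n \<and> pairs E = S"
  have "(a, b) \<in> E \<longleftrightarrow> a @ b \<in> S" if "a \<in> tuples C n" "b \<in> tuples C n" for a b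
    using append_in_pairs[of E n a b] E that by (simp add: tuples_def)
  then show "E = {(a, b). a \<in> tuples C n \<and> b \<in> tuples C n \<and> a @ b \<in> S}" using E by auto
qed

lemma type_definable_rel_iff:
  "type_definable_rel L C A n E \<longleftrightarrow> E \<subseteq> tuples C n \<times> tuples C n \<and> tdef A (n + n) (pairs E)"
proof -
  let ?S = "\<lambda>\<Sigma> :: ('f, 'r, nat, 'a) form set. {x \<in> tuples C (n + n). \<forall>\<sigma> \<in> \<Sigma>. sat C (nenv x) \<sigma>}"
  have "E = {(a, b). a \<in> tuples C n \<and> b \<in> tuples C n \<and>
      (\<forall>\<sigma> \<in> \<Sigma>. holds C (inst [[0..<2 * n] [\<mapsto>] a @ b] \<sigma>))} \<longleftrightarrow>
    E \<subseteq> tuples C n \<times> tuples C n \<and> pairs E = ?S \<Sigma>"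
    if \<Sigma>: "\<Sigma> \<subseteq> formulas L A {..<2 * n}" for \<Sigma> :: "('f, 'r, nat, 'a) form set"
  proof -
    have "(\<forall>\<sigma> \<in> \<Sigma>. holds C (inst [[0..<2 * n] [\<mapsto>] a @ b] \<sigma>)) \<longleftrightarrow> a @ b \<in> ?S \<Sigma>"
      if t: "a \<in> tuples C n" "b \<in> tuples C n" for a b
    proof -
      have "holds C (inst [[0..<2 * n] [\<mapsto>] a @ b] \<sigma>) \<longleftrightarrow> sat C (nenv (a @ b)) \<sigma>" if "\<sigma> \<in> \<Sigma>" for \<sigma>
        by (rule holds_inst_iff[OF _ t]) (use \<Sigma> that in \<open>auto simp: formulas_def\<close>)
      moreover have "a @ b \<in> tuples C (n + n)" using t by (auto simp: tuples_def)
      ultimately show ?thesis by simp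
    qed
    then have "{(a, b). a \<in> tuples C n \<and> b \<in> tuples C n \<and>
        (\<forall>\<sigma> \<in> \<Sigma>. holds C (inst [[0..<2 * n] [\<mapsto>] a @ b] \<sigma>))} =
      {(a, b). a \<in> tuples C n \<and> b \<in> tuples C n \<and> a @ b \<in> ?S \<Sigma>}" by auto
    moreover have "?S \<Sigma> \<subseteq> tuples C (n + n)" by blast
    ultimately show ?thesis using pairs_eq_iff[of "?S \<Sigma>" n E] by simp
  qed
  then show ?thesis unfolding type_definable_rel_def tdef_iff_formulas mult_2 by blast
qed

end

context small_submodel
begin

lemma type_definable_imp_invariant:
  assumes "type_definable_rel L C A n E" shows "invariant_rel L C A E"
  unfolding invariant_rel_def
proof (intro ballI, clarify)
  fix g a b assume g: "g \<in> Auts A" and ab: "(a, b) \<in> E"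
  have E: "E \<subseteq> tuples C n \<times> tuples C n" "tdef A (n + n) (pairs E)"
    using assms type_definable_rel_iff by blast+
  have t: "a \<in> tuples C n" "b \<in> tuples C n" using ab E(1) by auto
  then have len: "length a = n" "length b = n" and t2: "a @ b \<in> tuples C (n + n)"
    by (auto simp: tuples_def)
  obtain F where F: "\<And>D. D \<in> F \<Longrightarrow> dset A (n + n) D"
    "pairs E = {a \<in> tuples C (n + n). \<forall>D \<in> F. a \<in> D}"
    using tdefE[OF E(2)] by blast
  have o: "orb A (a @ b) (map g (a @ b))" unfolding orb_def using g by blast
  have "a @ b \<in> pairs E" using append_in_pairs[OF E(1)] len ab by simp
  then have "\<forall>D \<in> F. a @ b \<in> D" unfolding F(2) by simp
  then have "\<forall>D \<in> F. map g (a @ b) \<in> D" using dset_orb[OF F(1) A_univ o t2] by simp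
  then have "map g (a @ b) \<in> pairs E" unfolding F(2) using Auts_tuples[OF g t2] by simp
  then show "(map g a, map g b) \<in> E" using append_in_pairs[OF E(1), of "map g a" "map g b"] len by simp
qed

text \<open>The intersection of all bounded relations type-definable over \<open>A\<close> is type-definable, and it is
  bounded since each of them contains conjugacy over \<open>N\<close>.\<close>

lemma KP_exists:
  "bounded_equiv C \<kappa> n (KP_equiv L C \<kappa> A n)"
  "type_definable_rel L C A n (KP_equiv L C \<kappa> A n)"
  "bounded_equiv C \<kappa> n E \<Longrightarrow> type_definable_rel L C A n E \<Longrightarrow> KP_equiv L C \<kappa> A n \<subseteq> E"
proof -
  let ?T = "tuples C n \<times> tuples C n"
  define \<E> where "\<E> = {E. bounded_equiv C \<kappa> n E \<and> type_definable_rel L C A n E}"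
  define K where "K = {x \<in> ?T. \<forall>E \<in> \<E>. x \<in> E}"
  have eqE: "equiv (tuples C n) E" if "E \<in> \<E>" for E
    using that unfolding \<E>_def bounded_equiv_def by blast
  have eqK: "equiv (tuples C n) K"
  proof (rule equivI)
    show "K \<subseteq> ?T" unfolding K_def by blast
    show "refl_on (tuples C n) K"
    proof (rule refl_onI)
      fix a assume a: "a \<in> tuples C n"
      have "(a, a) \<in> E" if "E \<in> \<E>" for E using eqE[OF that] a by (metis equivE refl_onD)
      then show "(a, a) \<in> K" unfolding K_def using a by simp
    qed
    show "sym K"
    proof (rule symI)
      fix a b assume ab: "(a, b) \<in> K"
      have "(b, a) \<in> E" if "E \<in> \<E>" for E
      proof -
        have "(a, b) \<in> E" using ab that unfolding K_def by blast
        then show ?thesis using eqE[OF that] by (metis equivE symD)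
      qed
      then show "(b, a) \<in> K" using ab unfolding K_def by simp
    qed
    show "trans K"
    proof (rule transI)
      fix a b c assume abc: "(a, b) \<in> K" "(b, c) \<in> K"
      have "(a, c) \<in> E" if "E \<in> \<E>" for E
      proof -
        have "(a, b) \<in> E" "(b, c) \<in> E" using abc that unfolding K_def by blast+
        then show ?thesis using eqE[OF that] by (metis equivE transD)
      qed
      then show "(a, c) \<in> K" using abc unfolding K_def by simp
    qed
  qed
  have bdK: "bounded_equiv C \<kappa> n K"
  proof (rule bounded_equivI[OF eqK])
    fix a b assume a: "a \<in> tuples C n" "orb N a b"
    have "(a, b) \<in> E" if "E \<in> \<E>" for E
      using bounded_invariant_contains_orb_N[OF _ type_definable_imp_invariant a] that
      unfolding \<E>_def by blast
    then show "(a, b) \<in> K" unfolding K_def using a orb_tuples[OF a(2,1)] by simp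
  qed
  have "tdef A (n + n) {x \<in> tuples C (n + n). \<forall>E \<in> \<E>. x \<in> pairs E}"
    by (rule tdef_INT) (use type_definable_rel_iff in \<open>auto simp: \<E>_def\<close>)
  also have "{x \<in> tuples C (n + n). \<forall>E \<in> \<E>. x \<in> pairs E} = pairs K"
  proof (intro set_eqI iffI)
    fix x assume x: "x \<in> {x \<in> tuples C (n + n). \<forall>E \<in> \<E>. x \<in> pairs E}"
    have t: "take n x \<in> tuples C n" "drop n x \<in> tuples C n" using x take_drop_tuples by blast+
    have "(take n x, drop n x) \<in> E" if E: "E \<in> \<E>" for E
    proof -
      have "E \<subseteq> ?T" using E type_definable_rel_iff unfolding \<E>_def by blast
      then show ?thesis using append_in_pairs[of E n "take n x" "drop n x"] t x E
        by (simp add: tuples_def)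
    qed
    then have "(take n x, drop n x) \<in> K" unfolding K_def using t by simp
    then have "take n x @ drop n x \<in> pairs K" unfolding pairs_def by blast
    then show "x \<in> pairs K" by simp
  next
    fix x assume "x \<in> pairs K"
    then obtain a b where ab: "x = a @ b" "(a, b) \<in> K" unfolding pairs_def by auto
    then have "x \<in> pairs E" if "E \<in> \<E>" for E using that unfolding K_def pairs_def by blast
    moreover have "x \<in> tuples C (n + n)" using ab unfolding K_def by (auto simp: tuples_def)
    ultimately show "x \<in> {x \<in> tuples C (n + n). \<forall>E \<in> \<E>. x \<in> pairs E}" by simp
  qed
  finally have "tdef A (n + n) (pairs K)" .
  then have tdK: "type_definable_rel L C A n K" unfolding type_definable_rel_iff K_def by simp
  have KP: "KP_equiv L C \<kappa> A n = K" unfolding KP_equiv_def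
    by (rule Least_equality) (use bdK tdK in \<open>auto simp: K_def \<E>_def\<close>)
  show "bounded_equiv C \<kappa> n (KP_equiv L C \<kappa> A n)" "type_definable_rel L C A n (KP_equiv L C \<kappa> A n)"
    unfolding KP using bdK tdK by auto
  show "KP_equiv L C \<kappa> A n \<subseteq> E" if "bounded_equiv C \<kappa> n E" "type_definable_rel L C A n E"
    unfolding KP K_def \<E>_def using that by blast
qed

lemma Ls_subset_KP: "Ls n \<subseteq> KP_equiv L C \<kappa> A n"
  by (rule Ls_subset[OF KP_exists(1) type_definable_imp_invariant[OF KP_exists(2)]])

end

section \<open>Lascar-invariant types and their Morley sequences\<close>

text \<open>Only the values \<open>d\<close> of finitely many variables of a realization of \<open>p\<close> matter, since the formula at stake
  has finitely many variables. The assumption \<open>nonsplitting\<close> says that the type of \<open>d\<close> over \<open>N\<close> does not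
  Lascar-split over \<open>A\<close>.\<close>

locale Lascar_invariant_type = small_submodel L C \<kappa> N A
  for L :: "('f, 'r) language" and C :: "('f, 'r, 'a) struct" and \<kappa> :: "'k rel" and N A +
  fixes d :: "'a list" and m :: nat
  assumes d_tuple: "d \<in> tuples C m"
    and complete: "\<And>a n. a \<in> tuples C n \<Longrightarrow> \<exists>a'. set a' \<subseteq> N \<and> (a, a') \<in> Ls n"
    and nonsplitting: "\<And>a b. set a \<subseteq> N \<Longrightarrow> set b \<subseteq> N \<Longrightarrow> (a, b) \<in> Ls (length a) \<Longrightarrow>
      orb {} (d @ a) (d @ b)"
begin

text \<open>The type of \<open>d\<close> over \<open>N\<close> has a unique Lascar-invariant global extension: a formula with parameters \<open>c\<close>
  is decided as it is for \<open>d\<close> at parameters \<open>c'\<close> in \<open>N\<close> of the same Lascar strong type, which exist by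
  completeness. The tuple \<open>e\<close> realizes this extension over \<open>B\<close>.\<close>

definition realizes :: "'a set \<Rightarrow> 'a list \<Rightarrow> bool" where
  "realizes B e \<longleftrightarrow> e \<in> tuples C m \<and>
    (\<forall>c c'. set c \<subseteq> B \<longrightarrow> set c' \<subseteq> N \<longrightarrow> (c, c') \<in> Ls (length c) \<longrightarrow> orb {} (e @ c) (d @ c'))"

lemma realizes_tuple: "realizes B e \<Longrightarrow> e \<in> tuples C m"
  unfolding realizes_def by blast

lemma realizesD:
  "realizes B e \<Longrightarrow> set c \<subseteq> B \<Longrightarrow> set c' \<subseteq> N \<Longrightarrow> (c, c') \<in> Ls (length c) \<Longrightarrow> orb {} (e @ c) (d @ c')"
  unfolding realizes_def by blast

lemma realizes_mono: "realizes B' e \<Longrightarrow> B \<subseteq> B' \<Longrightarrow> realizes B e"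
  unfolding realizes_def by blast

lemma tuples_iff: "a \<in> tuples C n \<longleftrightarrow> length a = n \<and> set a \<subseteq> univ C"
  by (simp add: tuples_def)

lemma map_inverse: "(\<And>x. x \<in> univ C \<Longrightarrow> f (g x) = x) \<Longrightarrow> set a \<subseteq> univ C \<Longrightarrow> map f (map g a) = a"
  by (simp add: map_idI subset_iff)

lemma Ls_select:
  assumes "(a, b) \<in> Ls n" "\<And>j. j \<in> set js \<Longrightarrow> j < n"
  shows "(map ((!) a) js, map ((!) b) js) \<in> Ls (length js)"
proof -
  have one: "(map ((!) a) js, map ((!) b) js) \<in> Ls (length js)" if ab: "(a, b) \<in> Lascar_step n" for a b
  proof -
    obtain g h where a: "a \<in> tuples C n" and g: "g \<in> Auts A" and h: "h \<in> Auts (g ` N)" "b = map h a"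
      using ab unfolding Lascar_step_def orb_def by blast
    have "map ((!) b) js = map h (map ((!) a) js)" using h(2) a assms(2) by (simp add: tuples_iff)
    then have "orb (g ` N) (map ((!) a) js) (map ((!) b) js)" using h(1) unfolding orb_def by blast
    moreover have "map ((!) a) js \<in> tuples C (length js)"
      using a assms(2) by (auto simp: tuples_iff subset_iff)
    ultimately have "(map ((!) a) js, map ((!) b) js) \<in> Lascar_step (length js)"
      using g unfolding Lascar_step_def by blast
    then show ?thesis unfolding Ls_def by (rule r_into_trancl)
  qed
  show ?thesis using assms(1)[unfolded Ls_def]
  proof (induction rule: trancl_induct)
    case (base b)
    then show ?case by (rule one)
  next
    case (step b c)
    show ?case by (rule Ls_trans[OF step(3) one[OF step(2)]])
  qed
qed

text \<open>For finitely many conditions, put all their parameters into one tuple \<open>c\<close>, move it into \<open>N\<close> by an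
  automorphism that preserves its Lascar strong type, and move \<open>d\<close> back.\<close>

lemma realizes_exists:
  assumes B: "B \<subseteq> univ C" "|B| <o \<kappa>"
  shows "\<exists>e. realizes B e"
proof -
  let ?I = "{(c, c', S). set c \<subseteq> B \<and> set c' \<subseteq> N \<and> (c, c') \<in> Ls (length c) \<and>
    dset {} (m + length c) S \<and> d @ c' \<in> S}"
  let ?D = "\<lambda>(c, c', S). {e \<in> tuples C m. e @ c \<in> S}"
  have "\<exists>e \<in> tuples C m. \<forall>i \<in> ?I. e \<in> ?D i"
  proof (rule compactness[OF B])
    fix i assume "i \<in> ?I"
    then obtain c c' S where i: "i = (c, c', S)" "set c \<subseteq> B" "dset {} (m + length c) S" by blast
    have "set c \<subseteq> univ C" using i(2) B(1) by blast
    then have "dset B m {e \<in> tuples C m. e @ c \<in> S}"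
      by (rule dset_fix[OF dset_mono[OF i(3) empty_subsetI] refl i(2)])
    then show "dset B m (?D i)" unfolding i(1) by simp
  next
    fix K assume K: "finite K" "K \<subseteq> ?I"
    have "finite (\<Union>(c, c', S)\<in>K. set c)" using K(1) by (auto simp: case_prod_beta)
    from finite_list[OF this] obtain c where c: "set c = (\<Union>(c, c', S)\<in>K. set c)" ..
    have "set c \<subseteq> B" unfolding c using K(2) by auto
    then have ct: "set c \<subseteq> univ C" "c \<in> tuples C (length c)" using B(1) by (auto simp: tuples_iff)
    from complete[OF ct(2)] obtain c' where c': "set c' \<subseteq> N" "(c, c') \<in> Ls (length c)" by blast
    obtain g where g: "g \<in> Auts A" "c' = map g c" using Ls_orb_A[OF c'(2)] unfolding orb_def by blast
    obtain h where h: "h \<in> Auts A" "\<And>x. x \<in> univ C \<Longrightarrow> h (g x) = x"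
      using Auts_inverse[OF g(1) A_univ] by blast
    have "map h d \<in> ?D i" if i: "i \<in> K" for i
    proof -
      obtain b b' S where b: "i = (b, b', S)" by (cases i) auto
      have S: "dset {} (m + length b) S" "set b' \<subseteq> N" "(b, b') \<in> Ls (length b)" "d @ b' \<in> S"
        using K(2) i unfolding b by auto
      have sub: "set b \<subseteq> set c" unfolding c using i unfolding b by force
      define ix where "ix x = (SOME i. i < length c \<and> c ! i = x)" for x
      have ix: "ix x < length c \<and> c ! ix x = x" if "x \<in> set b" for x
      proof -
        have "\<exists>i. i < length c \<and> c ! i = x" using subsetD[OF sub that] in_set_conv_nth[of x c] by blast
        then show ?thesis unfolding ix_def by (rule someI_ex)
      qed
      have "(map ((!) c) (map ix b), map ((!) c') (map ix b)) \<in> Ls (length (map ix b))"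
        by (rule Ls_select[OF c'(2)]) (use ix in auto)
      moreover have "map ((!) c) (map ix b) = b" using ix by (auto intro: map_idI)
      moreover have "map ((!) c') (map ix b) = map g b" using ix g(2) by auto
      ultimately have "(b, map g b) \<in> Ls (length b)" by (simp only: length_map)
      then have 1: "(b', map g b) \<in> Ls (length b')"
        using Ls_trans[OF Ls_sym[OF S(3)]] Ls_tuples[OF S(3)] by (simp add: tuples_iff)
      have gN: "set (map g b) \<subseteq> N" using sub c'(1) g(2) by auto
      note o = nonsplitting[OF S(2) gN 1]
      have t: "d @ b' \<in> tuples C (m + length b)" using dset_subset[OF S(1)] S(4) by blast
      have "d @ map g b \<in> S" using dset_orb[OF S(1) empty_subsetI o t] S(4) by blast
      moreover have "d @ map g b \<in> tuples C (m + length b)" using orb_tuples[OF o t] .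
      ultimately have "map h (d @ map g b) \<in> S" using dset_Auts0[OF S(1) h(1)] by blast
      moreover have "map h (map g b) = b" by (rule map_inverse[of h g, OF h(2)]) (use sub ct in blast)+
      ultimately show ?thesis unfolding b using Auts_tuples[OF h(1) d_tuple] by (simp del: map_map)
    qed
    then show "\<exists>x\<in>tuples C m. \<forall>i\<in>K. x \<in> ?D i" using Auts_tuples[OF h(1) d_tuple] by blast
  qed
  then obtain e where e: "e \<in> tuples C m" "\<forall>i \<in> ?I. e \<in> ?D i" ..
  have "orb {} (e @ c) (d @ c')" if c: "set c \<subseteq> B" and c': "set c' \<subseteq> N" "(c, c') \<in> Ls (length c)" for c c'
  proof -
    have t: "d @ c' \<in> tuples C (m + length c)" "e @ c \<in> tuples C (m + length c)"
      using Ls_tuples[OF c'(2)] d_tuple e(1) by (auto simp: tuples_iff)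
    have "orb {} (d @ c') (e @ c)"
    proof (rule homogeneity[OF empty_subsetI finite_less t])
      fix D assume D: "dset {} (m + length c) D" "d @ c' \<in> D"
      then have "(c, c', D) \<in> ?I" using c c' by simp
      from bspec[OF e(2) this] show "e @ c \<in> D" by simp
    qed simp
    then show ?thesis by (rule orb_sym) (use t in \<open>simp_all add: tuples_iff\<close>)
  qed
  then show ?thesis unfolding realizes_def using e(1) by blast
qed

lemma realizes_unique:
  assumes B: "B \<subseteq> univ C" "|B| <o \<kappa>" and e: "realizes B e" "realizes B e'"
  shows "orb B e e'"
proof (rule orb_finite_character[OF B realizes_tuple[OF e(1)] realizes_tuple[OF e(2)]])
  fix c assume c: "set c \<subseteq> B"
  then have ct: "c \<in> tuples C (length c)" using B(1) by (simp add: tuples_iff)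
  from complete[OF this] obtain c' where c': "set c' \<subseteq> N" "(c, c') \<in> Ls (length c)" by blast
  have "set (e' @ c) \<subseteq> univ C" using realizes_tuple[OF e(2)] ct by (simp add: tuples_iff)
  then have "orb {} (d @ c') (e' @ c)" by (rule orb_sym[OF realizesD[OF e(2) c c'] empty_subsetI])
  then show "orb {} (e @ c) (e' @ c)" by (rule orb_trans[OF realizesD[OF e(1) c c']])
qed

lemma realizes_N: assumes e: "realizes N e" shows "orb N d e"
proof (rule orb_finite_character[OF N_univ N_less d_tuple realizes_tuple[OF e]])
  fix c assume c: "set c \<subseteq> N"
  have ct: "c \<in> tuples C (length c)" using c N_univ by (auto simp: tuples_iff)
  have "set (e @ c) \<subseteq> univ C" using realizes_tuple[OF e] ct by (simp add: tuples_iff)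
  then show "orb {} (d @ c) (e @ c)" by (rule orb_sym[OF realizesD[OF e c c Ls_refl[OF ct]] empty_subsetI])
qed

lemma realizes_Auts:
  assumes g: "g \<in> Auts N" and B: "B \<subseteq> univ C" and e: "realizes B e"
  shows "realizes (g ` B) (map g e)"
  unfolding realizes_def
proof (intro conjI allI impI)
  show "map g e \<in> tuples C m" by (rule Auts_tuples[OF g realizes_tuple[OF e]])
  fix c c' assume c: "set c \<subseteq> g ` B" and c': "set c' \<subseteq> N" "(c, c') \<in> Ls (length c)"
  have "c \<in> lists (g ` B)" using c by (simp add: in_lists_conv_set subset_iff)
  then have "c \<in> map g ` lists B" by (simp add: lists_image)
  then obtain c0 where c0: "c = map g c0" "set c0 \<subseteq> B" by (auto simp: in_lists_conv_set)
  have t: "c0 \<in> tuples C (length c)" using c0 B by (auto simp: tuples_iff)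
  have "orb N c0 c" unfolding orb_def using g c0(1) by blast
  then have "(c0, c') \<in> Ls (length c)" by (rule Ls_trans[OF orb_N_Ls[OF t] c'(2)])
  then have 1: "orb {} (e @ c0) (d @ c')" using realizesD[OF e c0(2) c'(1)] c0(1) by simp
  have "g \<in> Auts {}" using g Auts_mono[OF empty_subsetI] by blast
  then have "orb {} (e @ c0) (map g e @ c)" unfolding orb_def c0(1) by force
  moreover have "set (e @ c0) \<subseteq> univ C" using realizes_tuple[OF e] t by (simp add: tuples_iff)
  ultimately have "orb {} (map g e @ c) (e @ c0)" by (rule orb_sym[OF _ empty_subsetI])
  then show "orb {} (map g e @ c) (d @ c')" by (rule orb_trans[OF _ 1])
qed

text \<open>Two realizations over \<open>N\<close>, \<open>u\<close> and \<open>u'\<close> are conjugate over these, so it is enough to compare \<open>u\<close> and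
  \<open>u'\<close> next to a realization over a larger set.\<close>

lemma move_realization:
  assumes B: "B \<subseteq> univ C" "|B| <o \<kappa>" "N \<union> set u \<union> set u' \<subseteq> B"
    and e: "realizes B e" and c: "realizes (N \<union> set u \<union> set u') c"
    and E: "(u @ e, u' @ e) \<in> Ls n"
  shows "(u @ c, u' @ c) \<in> Ls n"
proof -
  let ?B = "N \<union> set u \<union> set u'"
  have "orb ?B e c"
    by (rule realizes_unique[OF order_trans[OF B(3,1)] subset_less[OF B(3,2)] realizes_mono[OF e B(3)] c])
  then obtain h where h: "h \<in> Auts ?B" "c = map h e" unfolding orb_def by blast
  have hA: "h \<in> Auts A" using h(1) Auts_mono[of A ?B] A_subset_N by blast
  have "map h u = u" "map h u' = u'" by (rule Auts_map_fix[OF h(1)], blast)+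
  then show ?thesis using Ls_Auts[OF E hA] h(2) by simp
qed

text \<open>Take \<open>e\<close> realizing the type also over the model \<open>g ` N\<close>, over which \<open>u\<close> and \<open>u'\<close> are conjugate. For \<open>w\<close> in
  that model, \<open>u @ w\<close> and \<open>u' @ w\<close> have the same Lascar strong type over \<open>A\<close>, hence look alike to \<open>e\<close>.\<close>

lemma Lascar_step_realizes:
  assumes uu': "(u, u') \<in> Lascar_step n" and c: "realizes (N \<union> set u \<union> set u') c"
  shows "(u @ c, u' @ c) \<in> Ls (n + m)"
proof -
  obtain g where u: "u \<in> tuples C n" and g: "g \<in> Auts A" and o: "orb (g ` N) u u'"
    using uu' unfolding Lascar_step_def by blast
  have u': "u' \<in> tuples C n" using orb_tuples[OF o u] .
  let ?B = "N \<union> set u \<union> set u' \<union> g ` N"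
  have B: "?B \<subseteq> univ C" using N_univ image_N_univ[OF g] u u' by (simp add: tuples_iff)
  have gN_less: "|g ` N| <o \<kappa>" by (rule image_less[OF N_less])
  have B_less: "|?B| <o \<kappa>" using Un_less[OF N_Un_less gN_less, of "set u \<union> set u'"] by (simp add: Un_assoc)
  obtain e where e: "realizes ?B e" using realizes_exists[OF B B_less] by blast
  have et: "e \<in> tuples C m" using realizes_tuple[OF e] .
  have t: "u @ e \<in> tuples C (n + m)" "u' @ e \<in> tuples C (n + m)" using u u' et by (auto simp: tuples_iff)
  have "orb (g ` N) (u @ e) (u' @ e)"
  proof (rule orb_finite_character[OF image_N_univ[OF g] gN_less t])
    fix w assume w: "set w \<subseteq> g ` N"
    have wC: "set w \<subseteq> univ C" using w image_N_univ[OF g] by blast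
    have uw: "u @ w \<in> tuples C (n + length w)" using u wC by (simp add: tuples_iff)
    from complete[OF this] obtain z where z: "set z \<subseteq> N" "(u @ w, z) \<in> Ls (n + length w)" by blast
    have "(u @ w, u' @ w) \<in> Lascar_step (n + length w)"
      unfolding Lascar_step_def using uw g orb_fix[OF o w] by blast
    then have "(u @ w, u' @ w) \<in> Ls (n + length w)" unfolding Ls_def by (rule r_into_trancl)
    then have z': "(u' @ w, z) \<in> Ls (n + length w)" by (rule Ls_trans[OF Ls_sym z(2)])
    have len: "length u = n" "length u' = n" "length e = m" using u u' et by (simp_all add: tuples_iff)
    have 1: "orb {} (e @ u @ w) (d @ z)"
      by (rule realizesD[OF e _ z(1)]) (use w z(2) len in auto)
    have 2: "orb {} (e @ u' @ w) (d @ z)"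
      by (rule realizesD[OF e _ z(1)]) (use w z' len in auto)
    have "set (e @ u' @ w) \<subseteq> univ C" using u' et wC by (simp add: tuples_iff)
    then have "orb {} (d @ z) (e @ u' @ w)" by (rule orb_sym[OF 2 empty_subsetI])
    then have "orb {} (e @ u @ w) (e @ u' @ w)" by (rule orb_trans[OF 1])
    then obtain h where h: "h \<in> Auts {}" "e @ u' @ w = map h (e @ u @ w)" unfolding orb_def by blast
    then have "map h e = e" "map h u = u'" "map h w = w" using len by (simp_all add: append_eq_append_conv)
    then have "(u' @ e) @ w = map h ((u @ e) @ w)" by simp
    then show "orb {} ((u @ e) @ w) ((u' @ e) @ w)" unfolding orb_def using h(1) by blast
  qed
  then have "(u @ e, u' @ e) \<in> Lascar_step (n + m)" unfolding Lascar_step_def using g t by blast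
  then have "(u @ e, u' @ e) \<in> Ls (n + m)" unfolding Ls_def by (rule r_into_trancl)
  then show ?thesis by (rule move_realization[OF B B_less _ e c, rotated]) blast
qed

lemma Ls_realizes:
  assumes "(u, u') \<in> Ls n" "realizes (N \<union> set u \<union> set u') c"
  shows "(u @ c, u' @ c) \<in> Ls (n + m)"
  using assms(1)[unfolded Ls_def] assms(2)
proof (induction arbitrary: c rule: trancl_induct)
  case (base u')
  then show ?case by (rule Lascar_step_realizes)
next
  case (step u' u'')
  have "(u, u') \<in> Ls n" using step(1) unfolding Ls_def .
  then have t: "u \<in> tuples C n" "u' \<in> tuples C n" "u'' \<in> tuples C n"
    using Ls_tuples Lascar_step_tuples step(2) by blast+
  let ?B = "N \<union> (set u \<union> set u' \<union> set u'')"
  have B: "?B \<subseteq> univ C" using N_univ t by (simp add: tuples_iff)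
  have B_less: "|?B| <o \<kappa>" by (rule N_Un_less) simp
  obtain e where e: "realizes ?B e" using realizes_exists[OF B B_less] by blast
  have "(u @ e, u' @ e) \<in> Ls (n + m)" by (rule step.IH[OF realizes_mono[OF e]]) blast
  moreover have "(u' @ e, u'' @ e) \<in> Ls (n + m)"
    by (rule Lascar_step_realizes[OF step(2) realizes_mono[OF e]]) blast
  ultimately have "(u @ e, u'' @ e) \<in> Ls (n + m)" by (rule Ls_trans)
  then show ?case by (rule move_realization[OF B B_less _ e step.prems, rotated]) blast
qed

definition Morley :: "'a set \<Rightarrow> 'a list list \<Rightarrow> bool" where
  "Morley B cs \<longleftrightarrow> (\<forall>i < length cs. realizes (B \<union> set (concat (take i cs))) (cs ! i))"

lemma Morley_Nil [simp]: "Morley B []"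
  by (simp add: Morley_def)

lemma Morley_snoc: "Morley B (cs @ [c]) \<longleftrightarrow> Morley B cs \<and> realizes (B \<union> set (concat cs)) c"
  unfolding Morley_def by (auto simp: less_Suc_eq nth_append)

lemma Morley_mono: "Morley B' cs \<Longrightarrow> B \<subseteq> B' \<Longrightarrow> Morley B cs"
  unfolding Morley_def using realizes_mono by (metis Un_mono order_refl)

lemma Morley_append: "Morley B (cs @ ds) \<longleftrightarrow> Morley B cs \<and> Morley (B \<union> set (concat cs)) ds"
proof (induction ds rule: rev_induct)
  case (snoc x ds)
  have "Morley B (cs @ ds @ [x]) \<longleftrightarrow> Morley B (cs @ ds) \<and> realizes (B \<union> set (concat (cs @ ds))) x"
    using Morley_snoc[of B "cs @ ds" x] by simp
  then show ?case using snoc by (simp add: Morley_snoc Un_assoc)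
qed simp

lemma Morley_tuple: "Morley B cs \<Longrightarrow> i < length cs \<Longrightarrow> cs ! i \<in> tuples C m"
  unfolding Morley_def using realizes_tuple by blast

lemma Morley_length: "Morley B cs \<Longrightarrow> c \<in> set cs \<Longrightarrow> length c = m"
  using Morley_tuple by (auto simp: in_set_conv_nth tuples_iff)

lemma Morley_concat: "Morley B cs \<Longrightarrow> concat cs \<in> tuples C (length cs * m)"
proof (induction cs rule: rev_induct)
  case (snoc c cs)
  have "Morley B cs" "c \<in> tuples C m" using snoc.prems realizes_tuple by (auto simp: Morley_snoc)
  then have "concat cs @ c \<in> tuples C (length cs * m + m)" using snoc.IH by (simp add: tuples_iff)
  then show ?case by (simp add: add.commute)
qed (simp add: tuples_iff)

lemma Morley_exists:
  assumes "B \<subseteq> univ C" "|B| <o \<kappa>"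
  shows "\<exists>cs. length cs = k \<and> Morley B cs"
proof (induction k)
  case (Suc k)
  then obtain cs where cs: "length cs = k" "Morley B cs" by blast
  have "B \<union> set (concat cs) \<subseteq> univ C" using assms(1) Morley_concat[OF cs(2)] by (simp add: tuples_iff)
  moreover have "|B \<union> set (concat cs)| <o \<kappa>" by (rule Un_less[OF assms(2) finite_less]) simp
  ultimately have "\<exists>c. realizes (B \<union> set (concat cs)) c" by (rule realizes_exists)
  then obtain c where "realizes (B \<union> set (concat cs)) c" ..
  then have "Morley B (cs @ [c])" using cs(2) Morley_snoc by blast
  then show ?case using cs(1) by (intro exI[of _ "cs @ [c]"]) simp
qed simp

lemma Morley_subsequence:
  assumes cs: "Morley B cs" and js: "sorted_wrt (<) js" "\<And>j. j \<in> set js \<Longrightarrow> j < length cs"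
  shows "Morley B (map ((!) cs) js)"
  unfolding Morley_def
proof (intro allI impI)
  fix i assume i: "i < length (map ((!) cs) js)"
  then have j: "js ! i < length cs" using js(2) by simp
  have "set (concat (take i (map ((!) cs) js))) \<subseteq> set (concat (take (js ! i) cs))"
  proof
    fix x assume "x \<in> set (concat (take i (map ((!) cs) js)))"
    then obtain l where l: "l \<in> set (take i js)" "x \<in> set (cs ! l)" by (auto simp: take_map)
    then obtain i' where i': "i' < i" "l = js ! i'" using i by (auto simp: in_set_conv_nth)
    then have "l < js ! i" using js(1) i by (simp add: sorted_wrt_iff_nth_less)
    then have "cs ! l \<in> set (take (js ! i) cs)" using j by (force simp: in_set_conv_nth)
    then show "x \<in> set (concat (take (js ! i) cs))" using l(2) by auto
  qed
  then have "B \<union> set (concat (take i (map ((!) cs) js))) \<subseteq> B \<union> set (concat (take (js ! i) cs))" by blast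
  moreover have "realizes (B \<union> set (concat (take (js ! i) cs))) (cs ! (js ! i))"
    using cs j unfolding Morley_def by blast
  ultimately show "realizes (B \<union> set (concat (take i (map ((!) cs) js)))) (map ((!) cs) js ! i)"
    using realizes_mono i by simp
qed

text \<open>By induction on the length, with invariance and uniqueness of realizations. Together with
  closure under subsequences this is the indiscernibility of Morley sequences over \<open>N\<close>.\<close>

lemma Morley_unique:
  "Morley N cs \<Longrightarrow> Morley N ds \<Longrightarrow> length cs = length ds \<Longrightarrow> orb N (concat cs) (concat ds)"
proof (induction cs arbitrary: ds rule: rev_induct)
  case Nil
  then show ?case by (simp add: orb_refl)
next
  case (snoc c cs)
  obtain ds' e where ds: "ds = ds' @ [e]" "length ds' = length cs"
    using snoc.prems(3) by (cases ds rule: rev_cases) auto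
  have M: "Morley N cs" "realizes (N \<union> set (concat cs)) c" "Morley N ds'" "realizes (N \<union> set (concat ds')) e"
    using snoc.prems(1,2) ds(1) by (simp_all add: Morley_snoc)
  obtain g where g: "g \<in> Auts N" "concat ds' = map g (concat cs)"
    using snoc.IH[OF M(1,3)] ds(2) unfolding orb_def by auto
  have c1: "N \<union> set (concat cs) \<subseteq> univ C" "N \<union> set (concat ds') \<subseteq> univ C"
    using N_univ Morley_concat[OF M(1)] Morley_concat[OF M(3)] by (simp_all add: tuples_iff)
  have "realizes (g ` (N \<union> set (concat cs))) (map g c)" by (rule realizes_Auts[OF g(1) c1(1) M(2)])
  moreover have "g ` (N \<union> set (concat cs)) = N \<union> set (concat ds')"
    using Auts_fix[OF g(1)] unfolding g(2) by (simp add: image_Un)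
  ultimately have "realizes (N \<union> set (concat ds')) (map g c)" by simp
  from realizes_unique[OF c1(2) N_Un_less[OF finite_set] this M(4)]
  have "orb (N \<union> set (concat ds')) (map g c) e" .
  then obtain h where h: "h \<in> Auts (N \<union> set (concat ds'))" "e = map h (map g c)" unfolding orb_def by blast
  have "h \<in> Auts N" using h(1) Auts_mono[of N "N \<union> set (concat ds')"] by blast
  then have "h \<circ> g \<in> Auts N" using g(1) by (rule Auts_comp)
  moreover have "map h (concat ds') = concat ds'" by (rule Auts_map_fix[OF h(1)]) blast
  then have "concat ds = map (h \<circ> g) (concat (cs @ [c]))" using h(2) g(2) ds(1) by simp
  ultimately show ?case unfolding orb_def by blast
qed

lemma Ls_Morley:
  assumes "(u, u') \<in> Ls n" "Morley (N \<union> set u \<union> set u') ks"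
  shows "(u @ concat ks, u' @ concat ks) \<in> Ls (n + length ks * m)"
  using assms(2)
proof (induction ks rule: rev_induct)
  case Nil
  then show ?case using assms(1) by simp
next
  case (snoc k ks)
  have M: "Morley (N \<union> set u \<union> set u') ks" "realizes (N \<union> set u \<union> set u' \<union> set (concat ks)) k"
    using snoc.prems by (simp_all add: Morley_snoc)
  have "realizes (N \<union> set (u @ concat ks) \<union> set (u' @ concat ks)) k"
    by (rule realizes_mono[OF M(2)]) auto
  from Ls_realizes[OF snoc.IH[OF M(1)] this] show ?case by (simp add: algebra_simps)
qed

text \<open>The realizations of the type over \<open>A\<close> of a Morley sequence of length \<open>k\<close>, flattened to \<open>k * m\<close>-tuples.
  The invariant type itself need not be invariant under automorphisms over \<open>A\<close>, but this set is.\<close>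

definition conj_Morley :: "nat \<Rightarrow> 'a list set" where
  "conj_Morley k = {x. \<exists>cs. Morley N cs \<and> length cs = k \<and> orb A (concat cs) x}"

lemma conj_Morley_tuples: "x \<in> conj_Morley k \<Longrightarrow> x \<in> tuples C (k * m)"
  unfolding conj_Morley_def using Morley_concat orb_tuples by blast

lemma conj_Morley_orb: "x \<in> conj_Morley k \<Longrightarrow> orb A x y \<Longrightarrow> y \<in> conj_Morley k"
  unfolding conj_Morley_def using orb_trans by blast

lemma tdef_conj_Morley: "tdef A (k * m) (conj_Morley k)"
proof -
  obtain cs where cs: "length cs = k" "Morley N cs" using Morley_exists[OF N_univ N_less] by blast
  have "conj_Morley k = {x. orb A (concat cs) x}"
  proof (intro set_eqI iffI)
    fix x assume "x \<in> conj_Morley k"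
    then obtain ds where ds: "Morley N ds" "length ds = k" "orb A (concat ds) x"
      unfolding conj_Morley_def by blast
    have "orb N (concat cs) (concat ds)" by (rule Morley_unique[OF cs(2) ds(1)]) (simp add: cs(1) ds(2))
    then have "orb A (concat cs) (concat ds)" by (rule orb_mono[OF A_subset_N])
    then show "x \<in> {x. orb A (concat cs) x}" using orb_trans ds(3) by blast
  next
    fix x assume "x \<in> {x. orb A (concat cs) x}"
    then show "x \<in> conj_Morley k" unfolding conj_Morley_def using cs by blast
  qed
  moreover have "tdef A (k * m) {x. orb A (concat cs) x}"
    using tdef_orbit[OF A_univ A_less Morley_concat[OF cs(2)]] cs(1) by simp
  ultimately show ?thesis by simp
qed

lemma conj_Morley_halves:
  assumes IK: "I @ K \<in> conj_Morley (2 * k)" and len: "length I = k * m"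
  shows "I \<in> conj_Morley k \<and> (I, K) \<in> Ls (k * m)"
proof -
  obtain cs where cs: "Morley N cs" "length cs = 2 * k" "orb A (concat cs) (I @ K)"
    using IK unfolding conj_Morley_def by blast
  define c1 c2 where "c1 = take k cs" and "c2 = drop k cs"
  have c12: "cs = c1 @ c2" "length c1 = k" "length c2 = k" unfolding c1_def c2_def using cs(2) by auto
  have M: "Morley N c1" "Morley (N \<union> set (concat c1)) c2" using cs(1) c12(1) Morley_append by auto
  have M2: "Morley N c2" by (rule Morley_mono[OF M(2)]) blast
  have t: "concat c1 \<in> tuples C (k * m)" "concat c2 \<in> tuples C (k * m)"
    using Morley_concat[OF M(1)] Morley_concat[OF M2] c12 by auto
  obtain g where g: "g \<in> Auts A" "I @ K = map g (concat cs)" using cs(3) unfolding orb_def by blast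
  have "I @ K = map g (concat c1) @ map g (concat c2)" using g(2) c12(1) by simp
  then have IK2: "I = map g (concat c1)" "K = map g (concat c2)"
    using len t(1) by (simp_all add: append_eq_append_conv tuples_iff)
  have "orb N (concat c1) (concat c2)" by (rule Morley_unique[OF M(1) M2]) (simp add: c12)
  then have "(concat c1, concat c2) \<in> Ls (k * m)" by (rule orb_N_Ls[OF t(1)])
  then have "(I, K) \<in> Ls (k * m)" unfolding IK2 by (rule Ls_Auts[OF _ g(1)])
  moreover have "I \<in> conj_Morley k" unfolding conj_Morley_def orb_def using M(1) c12(2) g(1) IK2(1) by blast
  ultimately show ?thesis by blast
qed

text \<open>This is why Lascar equivalence is type-definable on these tuples. If \<open>I\<close> is a Morley sequence
  over \<open>N\<close> and \<open>J\<close> has the same Lascar strong type, any Morley sequence over \<open>N\<close>, \<open>I\<close> and \<open>J\<close> continues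
  both of them alike. Conversely the two halves of a Morley sequence over \<open>N\<close> are
  conjugate over \<open>N\<close>, so both \<open>I\<close> and \<open>J\<close> are Lascar equivalent to a common continuation.\<close>

lemma Ls_iff_common_continuation:
  assumes I: "I \<in> conj_Morley k" and J: "length J = k * m"
  shows "(I, J) \<in> Ls (k * m) \<longleftrightarrow>
    (\<exists>K. length K = k * m \<and> I @ K \<in> conj_Morley (2 * k) \<and> J @ K \<in> conj_Morley (2 * k))"
proof
  assume IJ: "(I, J) \<in> Ls (k * m)"
  obtain cs where cs: "Morley N cs" "length cs = k" "orb A (concat cs) I"
    using I unfolding conj_Morley_def by blast
  obtain g where g: "g \<in> Auts A" "I = map g (concat cs)" using cs(3) unfolding orb_def by blast
  obtain h where h: "h \<in> Auts A" "\<And>x. x \<in> univ C \<Longrightarrow> h (g x) = x" "\<And>x. x \<in> univ C \<Longrightarrow> g (h x) = x"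
    using Auts_inverse[OF g(1) A_univ] by blast
  have t: "I \<in> tuples C (k * m)" "J \<in> tuples C (k * m)" "concat cs \<in> tuples C (k * m)"
    using Ls_tuples[OF IJ] Morley_concat[OF cs(1)] cs(2) by auto
  have hI: "map h I = concat cs" unfolding g(2) by (rule map_inverse[of h g, OF h(2)]) (use t(3) in \<open>simp_all only: tuples_iff\<close>)
  have gJ: "map g (map h J) = J" by (rule map_inverse[of g h, OF h(3)]) (use t(2) in \<open>simp_all only: tuples_iff\<close>)
  have hJ: "(concat cs, map h J) \<in> Ls (k * m)" using Ls_Auts[OF IJ h(1)] hI by simp
  let ?B = "N \<union> set (concat cs) \<union> set (map h J)"
  have "?B \<subseteq> univ C" using N_univ t(3) Ls_tuples[OF hJ] by (simp add: tuples_iff)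
  moreover have "|?B| <o \<kappa>" using N_Un_less[of "set (concat cs) \<union> set (map h J)"] by (simp add: Un_assoc)
  ultimately obtain ks where ks: "length ks = k" "Morley ?B ks" using Morley_exists by blast
  let ?K = "map g (concat ks)"
  have "Morley (N \<union> set (concat cs)) ks" by (rule Morley_mono[OF ks(2)]) blast
  then have "Morley N (cs @ ks)" using cs(1) Morley_append by blast
  then have 1: "concat cs @ concat ks \<in> conj_Morley (2 * k)"
    unfolding conj_Morley_def using cs(2) ks(1) orb_refl by (force intro!: exI[of _ "cs @ ks"])
  have "(concat cs @ concat ks, map h J @ concat ks) \<in> Ls (k * m + length ks * m)"
    by (rule Ls_Morley[OF hJ ks(2)])
  then have 2: "map h J @ concat ks \<in> conj_Morley (2 * k)" by (rule conj_Morley_orb[OF 1 Ls_orb_A])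
  have orbg: "orb A x (map g x)" for x unfolding orb_def using g(1) by blast
  have "I @ ?K \<in> conj_Morley (2 * k)" using conj_Morley_orb[OF 1 orbg] g(2) by simp
  moreover have "J @ ?K \<in> conj_Morley (2 * k)" using conj_Morley_orb[OF 2 orbg] gJ by (simp del: map_map)
  moreover have "length ?K = k * m" using Morley_concat[OF ks(2)] ks(1) by (simp add: tuples_iff)
  ultimately show "\<exists>K. length K = k * m \<and> I @ K \<in> conj_Morley (2 * k) \<and> J @ K \<in> conj_Morley (2 * k)" by blast
next
  assume "\<exists>K. length K = k * m \<and> I @ K \<in> conj_Morley (2 * k) \<and> J @ K \<in> conj_Morley (2 * k)"
  then obtain K where K: "I @ K \<in> conj_Morley (2 * k)" "J @ K \<in> conj_Morley (2 * k)" by blast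
  have "length I = k * m" using conj_Morley_tuples[OF I] by (simp add: tuples_iff)
  then have "(I, K) \<in> Ls (k * m)" "(J, K) \<in> Ls (k * m)" using conj_Morley_halves K J by blast+
  then show "(I, J) \<in> Ls (k * m)" using Ls_trans Ls_sym by blast
qed

section \<open>Kim--Pillay equivalent tuples see the same Morley sequences\<close>

text \<open>Some member of the Lascar class of \<open>I\<close> is to \<open>y'\<close> what \<open>I\<close> is to \<open>y\<close>.\<close>

definition simulates :: "nat \<Rightarrow> 'a list \<Rightarrow> 'a list \<Rightarrow> 'a list \<Rightarrow> bool" where
  "simulates k I y y' \<longleftrightarrow> (\<exists>I'. (I, I') \<in> Ls (k * m) \<and> orb A (I @ y) (I' @ y'))"

text \<open>Quantifying over all conjugates of Morley sequences, and not only over one Lascar class, makes the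
  relation invariant over \<open>A\<close>; symmetry is built in.\<close>

definition Morley_rel :: "nat \<Rightarrow> nat \<Rightarrow> 'a list rel" where
  "Morley_rel k n = {(y, y'). y \<in> tuples C n \<and> y' \<in> tuples C n \<and>
    (\<forall>I \<in> conj_Morley k. simulates k I y y' \<and> simulates k I y' y)}"

lemma conj_Morley_Ls: "I \<in> conj_Morley k \<Longrightarrow> (I, J) \<in> Ls (k * m) \<Longrightarrow> J \<in> conj_Morley k"
  using conj_Morley_orb Ls_orb_A by blast

lemma simulates_Ls:
  assumes IJ: "(I, J) \<in> Ls (k * m)" and J: "simulates k J y y'"
  shows "simulates k I y y'"
proof -
  obtain J' g where g: "(J, J') \<in> Ls (k * m)" "g \<in> Auts A" "J' @ y' = map g (J @ y)"
    using J unfolding simulates_def orb_def by blast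
  have "length J' = length J" using Ls_tuples[OF g(1)] by (simp add: tuples_iff)
  then have gJ: "J' = map g J" "y' = map g y" using g(3) by simp_all
  have "(map g I, J') \<in> Ls (k * m)" using Ls_Auts[OF IJ g(2)] gJ(1) by simp
  then have "(I, map g I) \<in> Ls (k * m)" using Ls_trans[OF Ls_trans[OF IJ g(1)] Ls_sym] by blast
  moreover have "orb A (I @ y) (map g I @ y')" unfolding orb_def using g(2) gJ(2) by force
  ultimately show ?thesis unfolding simulates_def by blast
qed

lemma simulates_refl: "I \<in> conj_Morley k \<Longrightarrow> simulates k I y y"
  unfolding simulates_def using Ls_refl[OF conj_Morley_tuples] orb_refl by blast

lemma simulates_trans:
  assumes I: "I \<in> conj_Morley k" and 1: "simulates k I y y'"
    and 2: "\<And>I'. I' \<in> conj_Morley k \<Longrightarrow> simulates k I' y' y''"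
  shows "simulates k I y y''"
proof -
  obtain I' where I': "(I, I') \<in> Ls (k * m)" "orb A (I @ y) (I' @ y')" using 1 unfolding simulates_def by blast
  obtain I'' where I'': "(I', I'') \<in> Ls (k * m)" "orb A (I' @ y') (I'' @ y'')"
    using 2[OF conj_Morley_Ls[OF I I'(1)]] unfolding simulates_def by blast
  show ?thesis unfolding simulates_def
    using Ls_trans[OF I'(1) I''(1)] orb_trans[OF I'(2) I''(2)] by blast
qed

lemma equiv_Morley_rel: "equiv (tuples C n) (Morley_rel k n)"
proof (rule equivI)
  show "Morley_rel k n \<subseteq> tuples C n \<times> tuples C n" unfolding Morley_rel_def by blast
  show "refl_on (tuples C n) (Morley_rel k n)"
    by (rule refl_onI) (simp add: Morley_rel_def simulates_refl)
  show "sym (Morley_rel k n)" by (rule symI) (simp add: Morley_rel_def)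
  show "trans (Morley_rel k n)"
  proof (rule transI)
    fix x y z assume xy: "(x, y) \<in> Morley_rel k n" and yz: "(y, z) \<in> Morley_rel k n"
    have "simulates k I x z \<and> simulates k I z x" if I: "I \<in> conj_Morley k" for I
    proof
      show "simulates k I x z"
        by (rule simulates_trans[OF I, of x y]) (use xy yz I in \<open>simp_all add: Morley_rel_def\<close>)
      show "simulates k I z x"
        by (rule simulates_trans[OF I, of z y]) (use xy yz I in \<open>simp_all add: Morley_rel_def\<close>)
    qed
    then show "(x, z) \<in> Morley_rel k n" using xy yz unfolding Morley_rel_def by simp
  qed
qed

text \<open>An automorphism over \<open>N\<close> preserves the Lascar strong type of \<open>I\<close>, because \<open>N\<close> contains a
  tuple of that strong type.\<close>

lemma orb_N_simulates:
  assumes I: "I \<in> conj_Morley k" and y: "orb N y y'"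
  shows "simulates k I y y'"
proof -
  obtain g where g: "g \<in> Auts N" "y' = map g y" using y unfolding orb_def by blast
  have gA: "g \<in> Auts A" using g(1) Auts_mono[OF A_subset_N] by blast
  obtain J where J: "set J \<subseteq> N" "(I, J) \<in> Ls (k * m)" using complete[OF conj_Morley_tuples[OF I]] by blast
  have "(map g I, J) \<in> Ls (k * m)" using Ls_Auts[OF J(2) gA] Auts_map_fix[OF g(1) J(1)] by simp
  then have "(I, map g I) \<in> Ls (k * m)" using Ls_trans[OF J(2) Ls_sym] by blast
  moreover have "orb A (I @ y) (map g I @ y')" unfolding orb_def using gA g(2) by force
  ultimately show ?thesis unfolding simulates_def by blast
qed

lemma bounded_Morley_rel: "bounded_equiv C \<kappa> n (Morley_rel k n)"
proof (rule bounded_equivI[OF equiv_Morley_rel])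
  fix a b assume a: "a \<in> tuples C n" and ab: "orb N a b"
  have "set a \<subseteq> univ C" using a by (simp add: tuples_iff)
  then have ba: "orb N b a" by (rule orb_sym[OF ab N_univ])
  show "(a, b) \<in> Morley_rel k n" unfolding Morley_rel_def
    using a orb_tuples[OF ab a] orb_N_simulates[OF _ ab] orb_N_simulates[OF _ ba] by simp
qed

lemma simulates_Auts:
  assumes h: "h \<in> Auts A" and I: "I \<in> conj_Morley k" and y: "y \<in> tuples C n"
    and sim: "\<And>J. J \<in> conj_Morley k \<Longrightarrow> simulates k J y y'"
  shows "simulates k I (map h y) (map h y')"
proof -
  obtain g where g: "g \<in> Auts A" "\<And>x. x \<in> univ C \<Longrightarrow> g (h x) = x" "\<And>x. x \<in> univ C \<Longrightarrow> h (g x) = x"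
    using Auts_inverse[OF h A_univ] by blast
  have orb_h: "orb A x (map h x)" and orb_g: "orb A x (map g x)" for x
    unfolding orb_def using h g(1) by blast+
  have IC: "set I \<subseteq> univ C" using conj_Morley_tuples[OF I] by (simp add: tuples_iff)
  have hgI: "map h (map g I) = I" by (rule map_inverse[of h g, OF g(3) IC])
  have gI: "map g I \<in> conj_Morley k" by (rule conj_Morley_orb[OF I orb_g])
  obtain J where J: "(map g I, J) \<in> Ls (k * m)" "orb A (map g I @ y) (J @ y')"
    using sim[OF gI] unfolding simulates_def by blast
  have "set (map g I @ y) \<subseteq> univ C"
    using conj_Morley_tuples[OF gI] y by (simp only: tuples_iff set_append) blast
  then have "orb A (map h (map g I @ y)) (map g I @ y)" by (rule orb_sym[OF orb_h A_univ])
  then have "orb A (map h (map g I @ y)) (map h (J @ y'))" by (rule orb_trans[OF orb_trans[OF _ J(2)] orb_h])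
  then have "orb A (I @ map h y) (map h J @ map h y')" using hgI by (simp del: map_map)
  moreover have "(I, map h J) \<in> Ls (k * m)" using Ls_Auts[OF J(1) h] hgI by (simp del: map_map)
  ultimately show ?thesis unfolding simulates_def by blast
qed

lemma Morley_rel_Auts:
  assumes "h \<in> Auts A" "(y, y') \<in> Morley_rel k n"
  shows "(map h y, map h y') \<in> Morley_rel k n"
proof -
  have t: "y \<in> tuples C n" "y' \<in> tuples C n"
    and s: "\<And>I. I \<in> conj_Morley k \<Longrightarrow> simulates k I y y'" "\<And>I. I \<in> conj_Morley k \<Longrightarrow> simulates k I y' y"
    using assms(2) unfolding Morley_rel_def by auto
  show ?thesis unfolding Morley_rel_def
    using Auts_tuples[OF assms(1)] t simulates_Auts[OF assms(1) _ t(1) s(1)]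
      simulates_Auts[OF assms(1) _ t(2) s(2)] by simp
qed

lemma map_nth_blockI:
  "z = u @ v @ w \<Longrightarrow> i = length u \<Longrightarrow> j = length u + length v \<Longrightarrow> map ((!) z) [i..<j] = v"
  using map_nth_block by simp

text \<open>Spelled out, the condition on \<open>(y, y')\<close> is that there are \<open>I'\<close> and a common continuation \<open>K\<close> of \<open>I\<close> and
  \<open>I'\<close> with \<open>I @ y\<close> conjugate to \<open>I' @ y'\<close>. It is a projection of a set that is type-definable over \<open>A\<close> in the
  variables \<open>y, y', I', K, I\<close>, with \<open>I\<close> then fixed as a parameter.\<close>

lemma tdef_simulates:
  assumes I: "I \<in> conj_Morley k" "set I \<subseteq> N"
  shows "tdef N (n + n) {x \<in> tuples C (n + n). simulates k I (take n x) (drop n x)}"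
proof -
  define l where "l = k * m"
  let ?q = "(n + n) + (l + l)"
  \<comment> \<open>The positions of \<open>I' @ K\<close>, of \<open>I @ K\<close> and of \<open>I @ y @ I' @ y'\<close> in the list \<open>y @ y' @ I' @ K @ I\<close>.\<close>
  let ?j1 = "[n + n..<?q]"
  let ?j2 = "[?q..<?q + l] @ [n + n + l..<?q]"
  let ?j3 = "[?q..<?q + l] @ [0..<n] @ [n + n..<n + n + l] @ [n..<n + n]"
  let ?P = "{x \<in> tuples C ((l + n) + (l + n)). orb A (take (l + n) x) (drop (l + n) x)}"
  let ?T1 = "{z \<in> tuples C (?q + l). map ((!) z) ?j1 \<in> conj_Morley (2 * k)}"
  let ?T2 = "{z \<in> tuples C (?q + l). map ((!) z) ?j2 \<in> conj_Morley (2 * k)}"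
  let ?T3 = "{z \<in> tuples C (?q + l). map ((!) z) ?j3 \<in> ?P}"
  let ?T = "?T1 \<inter> (?T2 \<inter> ?T3)"
  have M2: "tdef A (l + l) (conj_Morley (2 * k))"
  proof -
    have "2 * k * m = l + l" unfolding l_def mult_2 by (rule add_mult_distrib)
    then show ?thesis using tdef_conj_Morley[of "2 * k"] by simp
  qed
  have "tdef A (?q + l) ?T1" by (rule tdef_select[OF M2]) auto
  moreover have "tdef A (?q + l) ?T2" by (rule tdef_select[OF M2]) auto
  moreover have "tdef A (?q + l) ?T3"
    by (rule tdef_select[OF tdef_conjugate_pairs[OF A_univ A_less]]) auto
  ultimately have "tdef A (?q + l) ?T" by (intro tdef_Int)
  then have TN: "tdef N (?q + l) ?T" by (rule tdef_mono[OF _ A_subset_N])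
  have It: "length I = l" "set I \<subseteq> univ C"
    using conj_Morley_tuples[OF I(1)] by (simp_all add: tuples_iff l_def)
  have fin: "tdef N (n + n) {x \<in> tuples C (n + n). \<exists>b. length b = l + l \<and> x @ b \<in>
      {w \<in> tuples C ?q. w @ I \<in> ?T}}"
    by (rule tdef_project[OF tdef_fix[OF TN It(1) I(2) It(2)] N_univ N_less])
  have T_iff: "((y @ y') @ (I' @ K)) @ I \<in> ?T \<longleftrightarrow>
      I' @ K \<in> conj_Morley (2 * k) \<and> I @ K \<in> conj_Morley (2 * k) \<and> orb A (I @ y) (I' @ y')"
    if t: "y \<in> tuples C n" "y' \<in> tuples C n" "I' \<in> tuples C l" "K \<in> tuples C l" for y y' I' K
  proof -
    let ?z = "((y @ y') @ (I' @ K)) @ I"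
    have len: "length y = n" "length y' = n" "length I' = l" "length K = l" "length I = l"
      using t It by (simp_all add: tuples_iff)
    have z: "?z \<in> tuples C (?q + l)" using t It by (simp add: tuples_iff)
    have bI: "map ((!) ?z) [?q..<?q + l] = I"
      by (rule map_nth_blockI[where u = "y @ y' @ I' @ K" and w = "[]"]) (simp_all add: len)
    have b_y: "map ((!) ?z) [0..<n] = y"
      by (rule map_nth_blockI[where u = "[]" and w = "y' @ I' @ K @ I"]) (simp_all add: len)
    have b_y': "map ((!) ?z) [n..<n + n] = y'"
      by (rule map_nth_blockI[where u = "y" and w = "I' @ K @ I"]) (simp_all add: len)
    have bI': "map ((!) ?z) [n + n..<n + n + l] = I'"
      by (rule map_nth_blockI[where u = "y @ y'" and w = "K @ I"]) (simp_all add: len)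
    have bK: "map ((!) ?z) [n + n + l..<?q] = K"
      by (rule map_nth_blockI[where u = "y @ y' @ I'" and w = "I"]) (simp_all add: len)
    have bIK: "map ((!) ?z) ?j1 = I' @ K"
      by (rule map_nth_blockI[where u = "y @ y'" and w = "I"]) (simp_all add: len)
    have b3: "map ((!) ?z) ?j3 = I @ y @ I' @ y'" by (simp only: map_append bI b_y bI' b_y')
    have b2: "map ((!) ?z) ?j2 = I @ K" by (simp only: map_append bI bK)
    have P: "I @ y @ I' @ y' \<in> ?P \<longleftrightarrow> orb A (I @ y) (I' @ y')"
      using t It len by (simp add: tuples_iff)
    have "?z \<in> ?T1 \<longleftrightarrow> I' @ K \<in> conj_Morley (2 * k)" using z bIK by (simp only: mem_Collect_eq simp_thms)
    moreover have "?z \<in> ?T2 \<longleftrightarrow> I @ K \<in> conj_Morley (2 * k)" using z b2 by (simp only: mem_Collect_eq simp_thms)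
    moreover have "?z \<in> ?T3 \<longleftrightarrow> I @ y @ I' @ y' \<in> ?P" using z b3 by (simp only: mem_Collect_eq simp_thms)
    ultimately show ?thesis using P by (simp only: Int_iff)
  qed
  have "{x \<in> tuples C (n + n). \<exists>b. length b = l + l \<and> x @ b \<in> {w \<in> tuples C ?q. w @ I \<in> ?T}} =
    {x \<in> tuples C (n + n). simulates k I (take n x) (drop n x)}"
  proof (rule Collect_cong, rule conj_cong[OF refl])
    fix x assume x: "x \<in> tuples C (n + n)"
    let ?y = "take n x" and ?y' = "drop n x"
    have t: "?y \<in> tuples C n" "?y' \<in> tuples C n" using x take_drop_tuples by blast+
    have x_eq: "?y @ ?y' = x" by simp
    show "(\<exists>b. length b = l + l \<and> x @ b \<in> {w \<in> tuples C ?q. w @ I \<in> ?T}) \<longleftrightarrow> simulates k I ?y ?y'"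
    proof
      assume "\<exists>b. length b = l + l \<and> x @ b \<in> {w \<in> tuples C ?q. w @ I \<in> ?T}"
      then obtain b where "length b = l + l \<and> x @ b \<in> {w \<in> tuples C ?q. w @ I \<in> ?T}" ..
      then have b: "length b = l + l" "x @ b \<in> tuples C ?q" "(x @ b) @ I \<in> ?T" by blast+
      let ?I' = "take l b" and ?K = "drop l b"
      have b_eq: "?I' @ ?K = b" by simp
      have t': "?I' \<in> tuples C l" "?K \<in> tuples C l"
        using b(1,2) take_drop_tuples[of b l l] by (simp_all add: tuples_iff)
      have "((?y @ ?y') @ (?I' @ ?K)) @ I \<in> ?T" unfolding x_eq b_eq by (rule b(3))
      then have c: "?I' @ ?K \<in> conj_Morley (2 * k)" "I @ ?K \<in> conj_Morley (2 * k)" "orb A (I @ ?y) (?I' @ ?y')"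
        using T_iff[OF t t'] by blast+
      have len: "length ?I' = k * m" "length ?K = k * m" using t' by (simp_all only: tuples_iff l_def)
      have "(I, ?I') \<in> Ls (k * m)"
        by (rule iffD2[OF Ls_iff_common_continuation[OF I(1) len(1)]]) (use len(2) c in blast)
      then show "simulates k I ?y ?y'" unfolding simulates_def using c(3) by blast
    next
      assume "simulates k I ?y ?y'"
      then obtain I' where I': "(I, I') \<in> Ls (k * m)" "orb A (I @ ?y) (I' @ ?y')" unfolding simulates_def by blast
      have t': "I' \<in> tuples C l" using Ls_tuples[OF I'(1)] by (simp add: l_def)
      then have "length I' = k * m" by (simp add: tuples_iff l_def)
      from iffD1[OF Ls_iff_common_continuation[OF I(1) this] I'(1)]
      obtain K where K: "length K = k * m" "I @ K \<in> conj_Morley (2 * k)" "I' @ K \<in> conj_Morley (2 * k)" by blast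
      have Kt: "K \<in> tuples C l" using conj_Morley_tuples[OF K(3)] K(1) by (simp add: tuples_iff l_def)
      have T: "((?y @ ?y') @ (I' @ K)) @ I \<in> ?T" using T_iff[OF t t' Kt] K(2,3) I'(2) by blast
      have "x @ (I' @ K) \<in> tuples C ?q" using x t' Kt by (simp add: tuples_iff)
      moreover have "(x @ (I' @ K)) @ I \<in> ?T" using T unfolding x_eq .
      moreover have "length (I' @ K) = l + l" using t' Kt by (simp add: tuples_iff)
      ultimately show "\<exists>b. length b = l + l \<and> x @ b \<in> {w \<in> tuples C ?q. w @ I \<in> ?T}" by blast
    qed
  qed
  then show ?thesis using fin by (rule subst)
qed

text \<open>It is enough to test sequences \<open>I\<close> inside \<open>N\<close>, because every sequence is Lascar equivalent to one in \<open>N\<close>.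
  So the relation is type-definable over \<open>N\<close>, and by invariance over \<open>A\<close>.\<close>

lemma KP_subset_Morley_rel: "KP_equiv L C \<kappa> A n \<subseteq> Morley_rel k n"
proof (rule KP_exists(3)[OF bounded_Morley_rel])
  let ?R = "Morley_rel k n"
  have RT: "?R \<subseteq> tuples C n \<times> tuples C n" unfolding Morley_rel_def by blast
  define S where "S I = {x \<in> tuples C (n + n). simulates k I (take n x) (drop n x)}" for I
  let ?js = "[n..<n + n] @ [0..<n]"
  define S' where "S' I = {x \<in> tuples C (n + n). map ((!) x) ?js \<in> S I}" for I
  let ?I = "{I \<in> conj_Morley k. set I \<subseteq> N}"
  have "tdef N (n + n) (S I \<inter> S' I)" if I: "I \<in> ?I" for I
  proof (rule tdef_Int)
    show S: "tdef N (n + n) (S I)" unfolding S_def by (rule tdef_simulates) (use I in auto)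
    show "tdef N (n + n) (S' I)" unfolding S'_def by (rule tdef_select[OF S]) auto
  qed
  then have "tdef N (n + n) {x \<in> tuples C (n + n). \<forall>I \<in> ?I. x \<in> S I \<inter> S' I}" by (rule tdef_INT)
  also have "{x \<in> tuples C (n + n). \<forall>I \<in> ?I. x \<in> S I \<inter> S' I} = pairs ?R"
  proof (intro set_eqI)
    fix x
    show "x \<in> {x \<in> tuples C (n + n). \<forall>I \<in> ?I. x \<in> S I \<inter> S' I} \<longleftrightarrow> x \<in> pairs ?R"
    proof (cases "x \<in> tuples C (n + n)")
      case True
      let ?y = "take n x" and ?y' = "drop n x"
      have t: "?y \<in> tuples C n" "?y' \<in> tuples C n" using True take_drop_tuples by blast+
      then have len: "length ?y = n" "length ?y' = n" by (simp_all add: tuples_iff)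
      have "map ((!) (?y @ ?y')) [n..<n + n] = ?y'"
        by (rule map_nth_blockI[where u = ?y and w = "[]"]) (simp_all only: len append_Nil2)
      moreover have "map ((!) (?y @ ?y')) [0..<n] = ?y"
        by (rule map_nth_blockI[where u = "[]" and w = ?y']) (simp_all only: len append_Nil list.size add_0)
      ultimately have sel: "map ((!) x) ?js = ?y' @ ?y" by simp
      have "?y' @ ?y \<in> tuples C (n + n)" using t by (simp add: tuples_iff)
      then have "x \<in> S I \<inter> S' I \<longleftrightarrow> simulates k I ?y ?y' \<and> simulates k I ?y' ?y" for I
        unfolding S_def S'_def using True sel len by simp
      then have "x \<in> {x \<in> tuples C (n + n). \<forall>I \<in> ?I. x \<in> S I \<inter> S' I} \<longleftrightarrow>
          (\<forall>I \<in> ?I. simulates k I ?y ?y' \<and> simulates k I ?y' ?y)" using True by blast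
      also have "\<dots> \<longleftrightarrow> (\<forall>I \<in> conj_Morley k. simulates k I ?y ?y' \<and> simulates k I ?y' ?y)"
      proof
        assume all: "\<forall>I \<in> ?I. simulates k I ?y ?y' \<and> simulates k I ?y' ?y"
        show "\<forall>I \<in> conj_Morley k. simulates k I ?y ?y' \<and> simulates k I ?y' ?y"
        proof
          fix I assume I: "I \<in> conj_Morley k"
          obtain J where J: "set J \<subseteq> N" "(I, J) \<in> Ls (k * m)"
            using complete[OF conj_Morley_tuples[OF I]] by blast
          have "J \<in> ?I" using conj_Morley_Ls[OF I J(2)] J(1) by simp
          then have "simulates k J ?y ?y' \<and> simulates k J ?y' ?y" by (rule bspec[OF all])
          then show "simulates k I ?y ?y' \<and> simulates k I ?y' ?y" using simulates_Ls[OF J(2)] by simp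
        qed
      qed simp
      also have "\<dots> \<longleftrightarrow> (?y, ?y') \<in> ?R" unfolding Morley_rel_def using t by simp
      also have "\<dots> \<longleftrightarrow> x \<in> pairs ?R" using append_in_pairs[OF RT len] by simp
      finally show ?thesis .
    next
      case False
      have "x \<notin> pairs ?R"
      proof
        assume "x \<in> pairs ?R"
        then obtain a b where ab: "x = a @ b" "(a, b) \<in> ?R" unfolding pairs_def by auto
        then have "a \<in> tuples C n" "b \<in> tuples C n" using RT by blast+
        then show False using False ab(1) by (simp add: tuples_iff)
      qed
      then show ?thesis using False by simp
    qed
  qed
  finally have "tdef N (n + n) (pairs ?R)" .
  then have "tdef A (n + n) (pairs ?R)"
  proof (rule tdef_invariant[OF N_univ N_less A_subset_N])
    fix a b assume a: "a \<in> pairs ?R" and ab: "orb A a b"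
    obtain y y' where y: "a = y @ y'" "(y, y') \<in> ?R" using a unfolding pairs_def by auto
    obtain h where h: "h \<in> Auts A" "b = map h a" using ab unfolding orb_def by blast
    have "(map h y, map h y') \<in> ?R" by (rule Morley_rel_Auts[OF h(1) y(2)])
    then show "b \<in> pairs ?R" unfolding pairs_def h(2) y(1) by (auto intro: rev_image_eqI)
  qed
  then show "type_definable_rel L C A n ?R" unfolding type_definable_rel_iff using RT by blast
qed

section \<open>Alternation along Morley sequences\<close>

text \<open>The list is a sequence in reverse order, so that lengthening the sequence adds a head; \<open>t\<close> is the truth value of \<open>\<Phi>\<close> at the last term.\<close>

fun alt :: "'a list set \<Rightarrow> bool \<Rightarrow> 'a list \<Rightarrow> 'a list list \<Rightarrow> bool" where
  "alt \<Phi> t y [] \<longleftrightarrow> True"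
| "alt \<Phi> t y (c # cs) \<longleftrightarrow> (c @ y \<in> \<Phi> \<longleftrightarrow> t) \<and> alt \<Phi> (\<not> t) y cs"

lemma alt_Auts:
  assumes "dset {} (m + n) \<Phi>" "g \<in> Auts B" "y \<in> tuples C n"
  shows "(\<And>c. c \<in> set cs \<Longrightarrow> c \<in> tuples C m) \<Longrightarrow> alt \<Phi> t (map g y) (map (map g) cs) \<longleftrightarrow> alt \<Phi> t y cs"
proof (induction cs arbitrary: t)
  case (Cons c cs)
  have "c @ y \<in> tuples C (m + n)" using Cons.prems[of c] assms(3) by (simp add: tuples_iff)
  then have "map g (c @ y) \<in> \<Phi> \<longleftrightarrow> c @ y \<in> \<Phi>" by (rule dset_Auts0[OF assms(1,2)])
  then show ?case using Cons by simp
qed simp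

lemma alt_rev_nth:
  "alt \<Phi> t y (rev cs) \<Longrightarrow> Suc i < length cs \<Longrightarrow> (cs ! i @ y \<in> \<Phi>) \<noteq> (cs ! Suc i @ y \<in> \<Phi>)"
proof (induction cs arbitrary: t rule: rev_induct)
  case (snoc c cs)
  show ?case
  proof (cases "Suc i < length cs")
    case True
    then show ?thesis using snoc by (auto simp: nth_append)
  next
    case False
    then have i: "Suc i = length cs" using snoc.prems(2) by simp
    then obtain cs' b where cs: "cs = cs' @ [b]" by (cases cs rule: rev_cases) auto
    then have "i = length cs'" using i by simp
    then show ?thesis using snoc.prems(1) cs by (simp add: nth_append)
  qed
qed simp

definition alternates :: "'a list set \<Rightarrow> nat \<Rightarrow> bool \<Rightarrow> 'a list \<Rightarrow> bool" where
  "alternates \<Phi> k t y \<longleftrightarrow> (\<exists>Is cs. length Is = k \<and> (\<forall>c \<in> set Is. length c = m) \<and>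
    Morley N cs \<and> length cs = k \<and> (concat cs, concat Is) \<in> Ls (k * m) \<and> alt \<Phi> t y (rev Is))"

lemma blocks_tuples:
  assumes "concat Is \<in> tuples C q" "\<forall>c \<in> set Is. length c = m" "c \<in> set Is"
  shows "c \<in> tuples C m"
  using assms by (auto simp: tuples_iff)

lemma concat_blocks_eq:
  "length xs = length ys \<Longrightarrow> (\<And>c. c \<in> set xs \<union> set ys \<Longrightarrow> length c = m) \<Longrightarrow>
    concat xs = concat ys \<Longrightarrow> xs = ys"
proof (induction xs ys rule: list_induct2)
  case (Cons x xs y ys)
  have "length x = length y" using Cons.prems(1) by simp
  then show ?case using Cons by simp
qed simp

lemma alternates_Morley_rel:
  assumes \<Phi>: "dset {} (m + n) \<Phi>" and R: "(y, y') \<in> Morley_rel k n" and y: "alternates \<Phi> k t y"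
  shows "alternates \<Phi> k t y'"
proof -
  obtain Is cs where Is: "length Is = k" "\<forall>c \<in> set Is. length c = m" "Morley N cs" "length cs = k"
    "(concat cs, concat Is) \<in> Ls (k * m)" "alt \<Phi> t y (rev Is)"
    using y unfolding alternates_def by blast
  have yt: "y \<in> tuples C n" using R unfolding Morley_rel_def by blast
  have "concat cs \<in> conj_Morley k" unfolding conj_Morley_def using Is(3,4) orb_refl by blast
  then have I: "concat Is \<in> conj_Morley k" using conj_Morley_Ls Is(5) by blast
  then have "simulates k (concat Is) y y'" using R unfolding Morley_rel_def by blast
  then obtain I' g where g: "(concat Is, I') \<in> Ls (k * m)" "g \<in> Auts A" "I' @ y' = map g (concat Is @ y)"
    unfolding simulates_def orb_def by blast
  have "length I' = length (concat Is)" using Ls_tuples[OF g(1)] by (simp add: tuples_iff)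
  then have g': "I' = map g (concat Is)" "y' = map g y" using g(3) by simp_all
  let ?Is = "map (map g) Is"
  have c': "concat ?Is = I'" unfolding g'(1) by (simp add: map_concat)
  have "alt \<Phi> t (map g y) (map (map g) (rev Is)) \<longleftrightarrow> alt \<Phi> t y (rev Is)"
    by (rule alt_Auts[OF \<Phi> g(2) yt]) (use blocks_tuples[OF conj_Morley_tuples[OF I] Is(2)] in simp)
  then have "alt \<Phi> t y' (rev ?Is)" using Is(6) g'(2) by (simp add: rev_map)
  moreover have "(concat cs, concat ?Is) \<in> Ls (k * m)" unfolding c' by (rule Ls_trans[OF Is(5) g(1)])
  moreover have "length ?Is = k" "\<forall>c \<in> set ?Is. length c = m" using Is(1,2) by simp_all
  ultimately show ?thesis unfolding alternates_def using Is(3,4) by blast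
qed

text \<open>A realization of the invariant type over everything in sight continues the sequence \<open>Is\<close>, and at \<open>y\<close> in
  \<open>N\<close> it has the truth value that \<open>d\<close> has. If \<open>Is\<close> ends with the opposite value, the alternation gets longer.\<close>

lemma alternates_extend:
  assumes \<Phi>: "dset {} (m + n) \<Phi>" and y: "set y \<subseteq> N" "length y = n"
    and alt: "alternates \<Phi> k (d @ y \<notin> \<Phi>) y"
  shows "alternates \<Phi> (Suc k) (d @ y \<in> \<Phi>) y"
proof -
  obtain Is cs where Is: "length Is = k" "\<forall>c \<in> set Is. length c = m" "Morley N cs" "length cs = k"
    "(concat cs, concat Is) \<in> Ls (k * m)" "alt \<Phi> (d @ y \<notin> \<Phi>) y (rev Is)"
    using alt unfolding alternates_def by blast
  have yt: "y \<in> tuples C n" using y N_univ by (auto simp: tuples_iff)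
  let ?B = "N \<union> set (concat cs) \<union> set (concat Is)"
  have B: "?B \<subseteq> univ C" using N_univ Ls_tuples[OF Is(5)] by (simp only: tuples_iff) blast
  have "|?B| <o \<kappa>" using N_Un_less[of "set (concat cs) \<union> set (concat Is)"] by (simp add: Un_assoc)
  then obtain c where c: "realizes ?B c" using realizes_exists[OF B] by blast
  have ct: "c \<in> tuples C m" by (rule realizes_tuple[OF c])
  have "orb {} (c @ y) (d @ y)"
    by (rule realizesD[OF c _ y(1)]) (use y Ls_refl[OF yt] in auto)
  moreover have "c @ y \<in> tuples C (m + n)" using ct yt by (simp add: tuples_iff)
  ultimately have cy: "c @ y \<in> \<Phi> \<longleftrightarrow> d @ y \<in> \<Phi>" using dset_orb[OF \<Phi> empty_subsetI] by blast
  have "realizes (N \<union> set (concat cs)) c" by (rule realizes_mono[OF c]) blast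
  then have "Morley N (cs @ [c])" using Is(3) Morley_snoc by blast
  moreover have "(concat cs @ c, concat Is @ c) \<in> Ls (k * m + m)" by (rule Ls_realizes[OF Is(5) c])
  then have "(concat (cs @ [c]), concat (Is @ [c])) \<in> Ls (Suc k * m)" by (simp add: add.commute)
  moreover have "alt \<Phi> (d @ y \<in> \<Phi>) y (rev (Is @ [c]))" using cy Is(6) by simp
  moreover have "length (Is @ [c]) = Suc k" "length (cs @ [c]) = Suc k" using Is(1,4) by simp_all
  moreover have "\<forall>e \<in> set (Is @ [c]). length e = m" using Is(2) ct by (simp add: tuples_iff)
  ultimately show ?thesis unfolding alternates_def by blast
qed

text \<open>Alternations travel freely between \<open>a\<close> and \<open>b\<close>, as these are Kim--Pillay equivalent. One that ends
  with the value true is lengthened at \<open>b\<close>, one that ends with the value false at \<open>a\<close>.\<close>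

lemma KP_split_imp_alternates:
  assumes \<Phi>: "dset {} (m + n) \<Phi>" and a: "set a \<subseteq> N" "length a = n" and b: "set b \<subseteq> N" "length b = n"
    and ab: "(a, b) \<in> KP_equiv L C \<kappa> A n" and da: "d @ a \<in> \<Phi>" and db: "d @ b \<notin> \<Phi>"
  shows "alternates \<Phi> (2 * j) True b"
proof (induction j)
  case 0
  have "alternates \<Phi> 0 True b" unfolding alternates_def
    by (intro exI[of _ "[]"]) (simp add: Ls_refl tuples_iff)
  then show ?case by simp
next
  case (Suc j)
  have R: "(a, b) \<in> Morley_rel k n" "(b, a) \<in> Morley_rel k n" for k
  proof -
    show ab': "(a, b) \<in> Morley_rel k n" using KP_subset_Morley_rel ab by blast
    show "(b, a) \<in> Morley_rel k n" by (rule symD[OF _ ab']) (use equiv_Morley_rel in \<open>blast elim: equivE\<close>)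
  qed
  have "alternates \<Phi> (Suc (2 * j)) False b"
    using alternates_extend[OF \<Phi> b, of "2 * j"] Suc.IH db by simp
  then have "alternates \<Phi> (Suc (2 * j)) False a" by (rule alternates_Morley_rel[OF \<Phi> R(2)])
  then have "alternates \<Phi> (Suc (Suc (2 * j))) True a"
    using alternates_extend[OF \<Phi> a, of "Suc (2 * j)"] da by simp
  then have "alternates \<Phi> (Suc (Suc (2 * j))) True b" by (rule alternates_Morley_rel[OF \<Phi> R(1)])
  then show ?case by simp
qed

text \<open>Among the terms \<open>2 * i\<close> and \<open>Suc (2 * i)\<close> of an alternating Morley sequence exactly one has the
  desired truth value \<open>s i\<close>. The subsequence of these is conjugate to the given Morley sequence.\<close>

lemma alternates_imp_all_patterns:
  assumes \<Phi>: "dset {} (m + n) \<Phi>" and b: "b \<in> tuples C n" and alt: "alternates \<Phi> (2 * j) t b"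
    and ds: "Morley N ds" "length ds = j"
  shows "\<exists>y \<in> tuples C n. \<forall>i < j. (ds ! i @ y \<in> \<Phi>) = s i"
proof -
  obtain Is cs where Is: "length Is = 2 * j" "\<forall>c \<in> set Is. length c = m" "Morley N cs" "length cs = 2 * j"
    "(concat cs, concat Is) \<in> Ls (2 * j * m)" "alt \<Phi> t b (rev Is)"
    using alt unfolding alternates_def by blast
  obtain g where g: "g \<in> Auts A" "concat cs = map g (concat Is)"
    using Ls_orb_A[OF Ls_sym[OF Is(5)]] unfolding orb_def by blast
  let ?y = "map g b"
  have yt: "?y \<in> tuples C n" by (rule Auts_tuples[OF g(1) b])
  have It: "concat Is \<in> tuples C (2 * j * m)" using Ls_tuples[OF Is(5)] by blast
  have "cs = map (map g) Is"
    by (rule concat_blocks_eq) (use Is Morley_length[OF Is(3)] g(2) in \<open>auto simp: map_concat\<close>)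
  moreover have "alt \<Phi> t ?y (map (map g) (rev Is)) \<longleftrightarrow> alt \<Phi> t b (rev Is)"
    by (rule alt_Auts[OF \<Phi> g(1) b]) (use blocks_tuples[OF It Is(2)] in simp)
  ultimately have alt_cs: "alt \<Phi> t ?y (rev cs)" using Is(6) by (simp add: rev_map)
  define ix where "ix i = (if (cs ! (2 * i) @ ?y \<in> \<Phi>) = s i then 2 * i else Suc (2 * i))" for i
  have ix: "(cs ! ix i @ ?y \<in> \<Phi>) = s i" if "i < j" for i
    using alt_rev_nth[OF alt_cs, of "2 * i"] Is(4) that unfolding ix_def by auto
  have ix_bound: "2 * i \<le> ix i" "ix i \<le> Suc (2 * i)" for i unfolding ix_def by auto
  let ?es = "map ((!) cs) (map ix [0..<j])"
  have M: "Morley N ?es"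
  proof (rule Morley_subsequence[OF Is(3)])
    show "sorted_wrt (<) (map ix [0..<j])" unfolding sorted_wrt_iff_nth_less
    proof (intro allI impI)
      fix i i' assume i: "i < i'" "i' < length (map ix [0..<j])"
      then have "ix i < ix i'" using ix_bound(2)[of i] ix_bound(1)[of i'] by linarith
      then show "map ix [0..<j] ! i < map ix [0..<j] ! i'" using i by simp
    qed
    fix q assume "q \<in> set (map ix [0..<j])"
    then obtain i where "i < j" "q = ix i" by auto
    then show "q < length cs" using ix_bound(2)[of i] Is(4) by linarith
  qed
  have "orb N (concat ?es) (concat ds)" by (rule Morley_unique[OF M ds(1)]) (simp add: ds(2))
  then obtain h where h: "h \<in> Auts N" "concat ds = map h (concat ?es)" unfolding orb_def by blast
  have ds_eq: "ds = map (map h) ?es"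
  proof (rule concat_blocks_eq)
    show "length ds = length (map (map h) ?es)" by (simp add: ds(2))
    show "concat ds = concat (map (map h) ?es)" using h(2) by (simp only: map_concat)
    fix c assume "c \<in> set ds \<union> set (map (map h) ?es)"
    then show "length c = m" using Morley_length[OF ds(1)] Morley_length[OF M]
      by (auto simp del: map_map)
  qed
  have "(ds ! i @ map h ?y \<in> \<Phi>) = s i" if i: "i < j" for i
  proof -
    have e: "cs ! ix i \<in> tuples C m" by (rule Morley_tuple[OF Is(3)]) (use ix_bound(2)[of i] Is(4) i in linarith)
    then have "cs ! ix i @ ?y \<in> tuples C (m + n)" using yt by (simp add: tuples_iff)
    then have "map h (cs ! ix i @ ?y) \<in> \<Phi> \<longleftrightarrow> cs ! ix i @ ?y \<in> \<Phi>" by (rule dset_Auts0[OF \<Phi> h(1)])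
    moreover have "ds ! i = map h (cs ! ix i)" unfolding ds_eq using i by simp
    ultimately show ?thesis using ix[OF i] by simp
  qed
  then show ?thesis using Auts_tuples[OF h(1) yt] by blast
qed

lemma infinite_Morley_sequence: "\<exists>c :: nat \<Rightarrow> 'a list. \<forall>j. Morley N (map c [0..<j])"
proof -
  define pick where "pick cs = (SOME e. realizes (N \<union> set (concat cs)) e)" for cs
  define M where "M = rec_nat [] (\<lambda>_ cs. cs @ [pick cs])"
  have M: "M 0 = []" "\<And>j. M (Suc j) = M j @ [pick (M j)]" unfolding M_def by simp_all
  have Morley_M: "Morley N (M j)" for j
  proof (induction j)
    case (Suc j)
    have "N \<union> set (concat (M j)) \<subseteq> univ C" using N_univ Morley_concat[OF Suc] by (simp add: tuples_iff)
    from realizes_exists[OF this N_Un_less[OF finite_set]]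
    have "realizes (N \<union> set (concat (M j))) (pick (M j))" unfolding pick_def by (rule someI_ex)
    then show ?case using Suc unfolding M(2) Morley_snoc by blast
  qed (simp add: M)
  have M_map: "M j = map (\<lambda>i. pick (M i)) [0..<j]" for j by (induction j) (simp_all add: M)
  have "Morley N (map (\<lambda>i. pick (M i)) [0..<j])" for j
    by (rule subst[OF M_map, of "Morley N"]) (rule Morley_M)
  then show ?thesis by (intro exI allI)
qed

end

section \<open>Splitting\<close>

context monster_model
begin

lemma dset_of_formula:
  fixes \<phi> :: "('f, 'r, 'v, 'a) form"
  assumes \<phi>: "wf_form L \<phi>" "pars \<phi> \<subseteq> B" "fv \<phi> \<subseteq> set vs"
  obtains D where "dset B (length vs) D" "\<And>e. e \<in> vals C \<Longrightarrow> sat C e \<phi> \<longleftrightarrow> map e vs \<in> D"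
proof -
  define ix where "ix v = (SOME i. i < length vs \<and> vs ! i = v)" for v
  have ix: "ix v < length vs \<and> vs ! ix v = v" if "v \<in> fv \<phi>" for v
  proof -
    have "\<exists>i. i < length vs \<and> vs ! i = v" using subsetD[OF \<phi>(3) that] by (simp add: in_set_conv_nth)
    then show ?thesis unfolding ix_def by (rule someI_ex)
  qed
  let ?D = "{a \<in> tuples C (length vs). sat C (\<lambda>v. eval C (nenv a) (Var (ix v))) \<phi>}"
  have D: "dset B (length vs) ?D" by (rule dset_formula[OF \<phi>(1,2)]) (use ix in auto)
  have "sat C e \<phi> \<longleftrightarrow> map e vs \<in> ?D" if e: "e \<in> vals C" for e
  proof -
    have "map e vs \<in> tuples C (length vs)" using e by (auto simp: vals_def tuples_def)
    moreover have "sat C (\<lambda>v. eval C (nenv (map e vs)) (Var (ix v))) \<phi> \<longleftrightarrow> sat C e \<phi>"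
      by (rule sat_cong) (use ix in simp)
    ultimately show ?thesis by simp
  qed
  then show ?thesis using that[OF D] by blast
qed

lemma formula_of_dset:
  fixes vs :: "'v list"
  assumes D: "dset {} (length vs) D" and inf: "infinite (UNIV :: 'v set)"
  obtains \<psi> :: "('f, 'r, 'v, 'a) form" where "\<psi> \<in> formulas L {} (set vs)"
    "\<And>e. e \<in> vals C \<Longrightarrow> sat C e \<psi> \<longleftrightarrow> map e vs \<in> D"
proof -
  obtain \<phi> :: "('f, 'r, nat, 'a) form" where
    \<phi>: "\<phi> \<in> formulas L {} {..<length vs}" "D = {a \<in> tuples C (length vs). sat C (nenv a) \<phi>}"
    using D unfolding dset_def by blast
  have "infinite (- set vs)" using inf by (simp add: Compl_eq_Diff_UNIV)
  from inj_on_into[OF finite_avars[of \<phi>] this] obtain g :: "nat \<Rightarrow> 'v" where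
    g: "inj_on g (avars \<phi>)" "g ` avars \<phi> \<subseteq> - set vs" by (elim exE conjE)
  let ?\<sigma> = "\<lambda>i. Var (vs ! i) :: ('f, 'v, 'a) trm"
  let ?\<psi> = "subst g ?\<sigma> Par \<phi>"
  have fv: "i < length vs" if "i \<in> fv \<phi>" for i using \<phi>(1) that by (auto simp: formulas_def)
  have wf: "wf_form L ?\<psi>" by (rule wf_subst) (use \<phi>(1) in \<open>auto simp: formulas_def\<close>)
  have "pars ?\<psi> \<subseteq> {}" using pars_subst[of g ?\<sigma> Par \<phi>] \<phi>(1) by (auto simp: formulas_def)
  moreover have "fv ?\<psi> \<subseteq> set vs" using fv_subst[of g ?\<sigma> Par \<phi>] fv by fastforce
  ultimately have \<psi>: "?\<psi> \<in> formulas L {} (set vs)" using wf by (simp add: formulas_def)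
  have "sat C e ?\<psi> \<longleftrightarrow> map e vs \<in> D" if e: "e \<in> vals C" for e
  proof -
    have "sat C e ?\<psi> \<longleftrightarrow> sat C (\<lambda>v. eval C e (?\<sigma> v)) \<phi>"
    proof (rule sat_subst[OF g(1) order_refl])
      fix v assume "v \<in> fv \<phi>"
      then have "vs ! v \<in> set vs" using fv by simp
      then have "vs ! v \<notin> g ` avars \<phi>" using g(2) by blast
      then show "?\<sigma> v = Var (g v) \<or> tvars (?\<sigma> v) \<inter> g ` avars \<phi> = {}" by simp
    qed simp
    also have "\<dots> \<longleftrightarrow> sat C (nenv (map e vs)) \<phi>" by (rule sat_cong) (use fv in simp)
    also have "\<dots> \<longleftrightarrow> map e vs \<in> D" unfolding \<phi>(2) using e by (auto simp: vals_def tuples_def)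
    finally show ?thesis .
  qed
  then show ?thesis using that[OF \<psi>] by blast
qed

lemma upds_None: "v \<notin> set xs \<Longrightarrow> [xs [\<mapsto>] ys] v = None"
  by (simp add: map_upds_apply_nontin)

lemma sat_inst_upds:
  fixes \<phi> :: "('f, 'r, 'v, 'a) form"
  assumes D: "\<And>e. e \<in> vals C \<Longrightarrow> sat C e \<phi> \<longleftrightarrow> map e (xs @ ys) \<in> D"
    and ys: "distinct ys" "set ys \<inter> set xs = {}" "length c = length ys" "set c \<subseteq> univ C"
    and e: "e \<in> vals C"
  shows "sat C e (inst [ys [\<mapsto>] c] \<phi>) \<longleftrightarrow> map e xs @ c \<in> D"
proof -
  let ?e = "\<lambda>v. case [ys [\<mapsto>] c] v of None \<Rightarrow> e v | Some a \<Rightarrow> a"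
  have nth: "?e (ys ! i) = c ! i" if "i < length ys" for i
    using upds_nth[OF ys(1,3) that] by simp
  have out: "?e v = e v" if "v \<notin> set ys" for v by (simp add: upds_None[OF that])
  have "?e v \<in> univ C" for v
  proof (cases "v \<in> set ys")
    case True
    then obtain i where i: "i < length ys" "v = ys ! i" by (auto simp: in_set_conv_nth)
    have "c ! i \<in> set c" using i(1) ys(3) by simp
    then show ?thesis using nth[OF i(1)] i(2) ys(4) by auto
  next
    case False
    then show ?thesis using out[OF False] e by (auto simp: vals_def)
  qed
  then have "?e \<in> vals C" unfolding vals_def by blast
  then have "sat C ?e \<phi> \<longleftrightarrow> map ?e (xs @ ys) \<in> D" by (rule D)
  moreover have "map ?e xs = map e xs"
  proof (rule map_cong[OF refl])
    fix v assume "v \<in> set xs"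
    then show "?e v = e v" using ys(2) by (intro out) blast
  qed
  moreover have "map ?e ys = c" by (rule nth_equalityI) (use ys(3) nth in simp_all)
  ultimately show ?thesis unfolding sat_inst by simp
qed

end

context small_submodel
begin

text \<open>Let \<open>\<alpha>\<close> realize \<open>p\<close> and let \<open>d\<close> be its values at the variables of \<open>X\<close> in the splitting formula. The sequence
  witnessing IP consists of the terms of an infinite Morley sequence, which are conjugate to
  \<open>d\<close> over \<open>N\<close>; the automorphisms carry \<open>\<alpha>\<close> to realizations of all of \<open>p\<close> extending them.\<close>

lemma Lascar_nonsplitting_imp_KP_nonsplitting:
  fixes X :: "'v set" and p :: "('f, 'r, 'v, 'a) form set"
  assumes complete: "Lascar_complete L C \<kappa> A N"
    and X: "|X| <o \<kappa>" "infinite (- X)"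
    and p: "p \<in> complete_types L C X N"
    and NIP: "NIP_type L C X p"
    and nonsplit: "\<not> Lascar_splits L C \<kappa> X A N p"
  shows "\<not> KP_splits L C \<kappa> X A N p"
proof
  assume "KP_splits L C \<kappa> X A N p"
  then obtain ys a b \<phi> where ys: "distinct ys" "set ys \<inter> X = {}"
    and \<phi>: "\<phi> \<in> formulas L {} (X \<union> set ys)"
    and ab: "length a = length ys" "length b = length ys" "set a \<subseteq> N" "set b \<subseteq> N"
    and KP: "(a, b) \<in> KP_equiv L C \<kappa> A (length ys)"
    and pa: "inst [ys [\<mapsto>] a] \<phi> \<in> p" and pb: "Neg (inst [ys [\<mapsto>] b] \<phi>) \<in> p"
    unfolding KP_splits_def splits_wrt_def by blast
  have pN: "p \<subseteq> formulas L N X" "consistent_in C p" and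
    p_complete: "\<And>\<psi>. \<psi> \<in> formulas L N X \<Longrightarrow> \<psi> \<in> p \<or> Neg \<psi> \<in> p"
    using p unfolding complete_types_def by blast+
  have inf: "infinite (UNIV :: 'v set)" using X(2) by (metis finite_subset subset_UNIV)
  from realize_partial_type[OF N_univ N_less X(1) pN] obtain \<alpha> where
    \<alpha>: "\<alpha> \<in> vals C" "\<And>\<psi>. \<psi> \<in> p \<Longrightarrow> sat C \<alpha> \<psi>" by blast
  have "finite (fv \<phi> \<inter> X)" by simp
  from finite_distinct_list[OF this] obtain xs where xs: "set xs = fv \<phi> \<inter> X" "distinct xs" by blast
  define m where "m = length xs"
  define n where "n = length ys"
  define d where "d = map \<alpha> xs"
  have d: "d \<in> tuples C m" using \<alpha>(1) by (auto simp: d_def m_def tuples_def vals_def)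
  have inst_mem: "inst [zs [\<mapsto>] c] \<psi> \<in> formulas L N X"
    if "\<psi> \<in> formulas L {} (set (xs @ zs))" "length c = length zs" "set c \<subseteq> N"
    for \<psi> :: "('f, 'r, 'v, 'a) form" and zs c
  proof -
    have "ran [zs [\<mapsto>] c] \<subseteq> set c"
    proof
      fix x assume "x \<in> ran [zs [\<mapsto>] c]"
      then show "x \<in> set c" by (auto simp: map_upds_def ran_def dest!: map_of_SomeD in_set_zipE)
    qed
    moreover have "dom [zs [\<mapsto>] c] = set zs" using that(2) by (simp add: dom_map_upds)
    ultimately show ?thesis
      using that wf_inst[of L \<psi>] pars_inst[of "[zs [\<mapsto>] c]" \<psi>] xs(1)
      by (fastforce simp: formulas_def fv_inst)
  qed
  have nonsplit_d: "orb {} (d @ c) (d @ c')"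
    if c: "set c \<subseteq> N" and c': "set c' \<subseteq> N" and cc': "(c, c') \<in> Ls (length c)" for c c'
  proof -
    have len: "length c' = length c" using Ls_tuples[OF cc'] by (simp add: tuples_def)
    have t: "d @ c \<in> tuples C (m + length c)" "d @ c' \<in> tuples C (m + length c)"
      using d c c' N_univ len by (auto simp: tuples_def)
    \<comment> \<open>Variables outside \<open>X\<close> to carry the parameters \<open>c\<close> and \<open>c'\<close>.\<close>
    obtain Z where Z: "finite Z" "card Z = length c" "Z \<subseteq> - X"
      using infinite_arbitrarily_large[OF X(2)] by blast
    from finite_distinct_list[OF Z(1)] obtain zs where zs: "set zs = Z" "distinct zs" by blast
    have lz: "length c = length zs" using zs Z(2) distinct_card by metis
    have disj: "set zs \<inter> set xs = {}" "set zs \<inter> X = {}" using zs(1) Z(3) xs(1) by auto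
    show ?thesis
    proof (rule homogeneity[OF empty_subsetI finite_less t])
      fix D assume D: "dset {} (m + length c) D" "d @ c \<in> D"
      have D': "dset {} (length (xs @ zs)) D" using D(1) lz by (simp add: m_def)
      obtain \<psi> :: "('f, 'r, 'v, 'a) form" where \<psi>: "\<psi> \<in> formulas L {} (set (xs @ zs))"
        "\<And>e. e \<in> vals C \<Longrightarrow> sat C e \<psi> \<longleftrightarrow> map e (xs @ zs) \<in> D"
        using formula_of_dset[OF D' inf] by blast
      have ic: "inst [zs [\<mapsto>] c] \<psi> \<in> formulas L N X" by (rule inst_mem[OF \<psi>(1) lz c])
      have ic': "inst [zs [\<mapsto>] c'] \<psi> \<in> formulas L N X" by (rule inst_mem[OF \<psi>(1) _ c']) (simp add: len lz)
      have sc: "sat C \<alpha> (inst [zs [\<mapsto>] c] \<psi>) \<longleftrightarrow> d @ c \<in> D" unfolding d_def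
        by (rule sat_inst_upds[OF \<psi>(2) zs(2) disj(1) lz _ \<alpha>(1)]) (use c N_univ in auto)
      have sc': "sat C \<alpha> (inst [zs [\<mapsto>] c'] \<psi>) \<longleftrightarrow> d @ c' \<in> D" unfolding d_def
        by (rule sat_inst_upds[OF \<psi>(2) zs(2) disj(1) _ _ \<alpha>(1)]) (use c' N_univ len lz in auto)
      show "d @ c' \<in> D"
      proof (rule ccontr)
        assume no: "d @ c' \<notin> D"
        have "inst [zs [\<mapsto>] c'] \<psi> \<notin> p" using \<alpha>(2) sc' no by blast
        then have 1: "Neg (inst [zs [\<mapsto>] c'] \<psi>) \<in> p" using p_complete[OF ic'] by blast
        have "Neg (inst [zs [\<mapsto>] c] \<psi>) \<notin> p" using \<alpha>(2)[of "Neg (inst [zs [\<mapsto>] c] \<psi>)"] sc D(2) by auto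
        then have 2: "inst [zs [\<mapsto>] c] \<psi> \<in> p" using p_complete[OF ic] by blast
        have "\<psi> \<in> formulas L {} (X \<union> set zs)" using \<psi>(1) xs(1) by (auto simp: formulas_def)
        moreover have "(c, c') \<in> Lascar_equiv L C \<kappa> A (length zs)"
          unfolding Lascar_equiv_eq_Ls using cc' lz by simp
        ultimately have "Lascar_splits L C \<kappa> X A N p"
          unfolding Lascar_splits_def splits_wrt_def
          using zs(2) disj(2) lz len c c' 1 2
          by (intro exI[of _ zs] exI[of _ c] exI[of _ c'] exI[of _ \<psi>]) simp
        then show False using nonsplit by blast
      qed
    qed simp
  qed
  interpret Lascar_invariant_type L C \<kappa> N A d m
  proof
    show "d \<in> tuples C m" by (rule d)
    show "\<exists>a'. set a' \<subseteq> N \<and> (a, a') \<in> Ls n" if "a \<in> tuples C n" for a n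
      using complete that unfolding Lascar_complete_def Lascar_equiv_eq_Ls by blast
  qed (rule nonsplit_d)
  have \<phi>': "wf_form L \<phi>" "pars \<phi> \<subseteq> {}" "fv \<phi> \<subseteq> set (xs @ ys)"
    using \<phi> xs(1) by (auto simp: formulas_def)
  obtain \<Phi> where "dset {} (length (xs @ ys)) \<Phi>"
    and \<Phi>_sat: "\<And>e. e \<in> vals C \<Longrightarrow> sat C e \<phi> \<longleftrightarrow> map e (xs @ ys) \<in> \<Phi>"
    using dset_of_formula[OF \<phi>'] by blast
  then have \<Phi>: "dset {} (m + n) \<Phi>" by (simp add: m_def n_def)
  have disj: "set ys \<inter> set xs = {}" using ys(2) xs(1) by blast
  have ab_univ: "set a \<subseteq> univ C" "set b \<subseteq> univ C" using ab N_univ by blast+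
  have da: "d @ a \<in> \<Phi>"
    using \<alpha>(2)[OF pa] sat_inst_upds[OF \<Phi>_sat ys(1) disj ab(1) ab_univ(1) \<alpha>(1)] unfolding d_def by blast
  have db: "d @ b \<notin> \<Phi>"
    using \<alpha>(2)[OF pb] sat_inst_upds[OF \<Phi>_sat ys(1) disj ab(2) ab_univ(2) \<alpha>(1)] unfolding d_def by simp
  have bt: "b \<in> tuples C n" using ab(2) ab_univ(2) by (simp add: tuples_def n_def)
  have alt: "alternates \<Phi> (2 * j) True b" for j
    by (rule KP_split_imp_alternates[OF \<Phi> ab(3) _ ab(4) _ _ da db]) (use ab KP in \<open>simp_all add: n_def\<close>)
  obtain c :: "nat \<Rightarrow> 'a list" where c: "\<And>j. Morley N (map c [0..<j])"
    using infinite_Morley_sequence by blast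
  have "\<exists>g. g \<in> Auts N \<and> c i = map g d" for i
  proof -
    have "Morley N (map c [0..<i] @ [c i])" using c[of "Suc i"] by simp
    then have "realizes N (c i)" unfolding Morley_snoc using realizes_mono by blast
    then show ?thesis using realizes_N unfolding orb_def by blast
  qed
  then have "\<exists>g. \<forall>i. g i \<in> Auts N \<and> c i = map (g i) d" by (rule choice[OF allI])
  then obtain g where g: "\<And>i. g i \<in> Auts N" "\<And>i. c i = map (g i) d" by blast
  define \<beta> where "\<beta> i = (\<lambda>v. g i (\<alpha> v))" for i
  have \<beta>_vals: "\<beta> i \<in> vals C" for i
    using \<alpha>(1) Auts_univ[OF g(1)] by (auto simp: \<beta>_def vals_def)
  have \<beta>_xs: "map (\<beta> i) xs = c i" for i unfolding g(2) d_def \<beta>_def by simp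
  have \<beta>_p: "sat C (\<beta> i) \<psi>" if "\<psi> \<in> p" for i \<psi>
  proof -
    from finite_list[OF finite_fv[of \<psi>]] obtain vs where vs: "set vs = fv \<psi>" ..
    have \<psi>: "wf_form L \<psi>" "pars \<psi> \<subseteq> N" "fv \<psi> \<subseteq> set vs"
      using subsetD[OF pN(1) that] vs by (simp_all add: formulas_def)
    obtain D where D: "dset N (length vs) D" "\<And>e. e \<in> vals C \<Longrightarrow> sat C e \<psi> \<longleftrightarrow> map e vs \<in> D"
      using dset_of_formula[OF \<psi>] by blast
    have t: "map \<alpha> vs \<in> tuples C (length vs)" using \<alpha>(1) by (auto simp: vals_def tuples_def)
    have "map (\<beta> i) vs = map (g i) (map \<alpha> vs)" by (simp add: \<beta>_def)
    then have "orb N (map \<alpha> vs) (map (\<beta> i) vs)" unfolding orb_def using g(1) by blast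
    then have "map (\<beta> i) vs \<in> D \<longleftrightarrow> map \<alpha> vs \<in> D" by (rule dset_orb[OF D(1) N_univ _ t])
    then show ?thesis using D(2)[OF \<beta>_vals] D(2)[OF \<alpha>(1)] \<alpha>(2)[OF that] by simp
  qed
  let ?f = "\<lambda>s i. let \<phi>i = inst (\<lambda>v. if v \<in> X then Some (\<beta> i v) else None) \<phi>
    in if i \<in> s then \<phi>i else Neg \<phi>i"
  have "consistent_in C (range (?f s))" for s :: "nat set"
    unfolding consistent_in_def
  proof (intro allI impI)
    fix F assume F: "finite F \<and> F \<subseteq> range (?f s)"
    obtain J where J: "finite J" "F = ?f s ` J"
      using finite_subset_image[OF conjunct1[OF F] conjunct2[OF F]] by blast
    define j where "j = Suc (Max (insert 0 J))"
    have j: "i < j" if "i \<in> J" for i unfolding j_def using J(1) that by (simp add: less_Suc_eq_le)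
    obtain y where y: "y \<in> tuples C n" "\<And>i. i < j \<Longrightarrow> (map c [0..<j] ! i @ y \<in> \<Phi>) = (i \<in> s)"
      using alternates_imp_all_patterns[OF \<Phi> bt alt c, of j j "\<lambda>i. i \<in> s"] by auto
    have ylen: "length y = length ys" "set y \<subseteq> univ C" using y(1) by (simp_all add: tuples_def n_def)
    define e where "e v = (case [ys [\<mapsto>] y] v of None \<Rightarrow> \<alpha> v | Some x \<Rightarrow> x)" for v
    have e_nth: "e (ys ! i) = y ! i" if "i < length ys" for i
      unfolding e_def using upds_nth[OF ys(1) ylen(1) that] by simp
    have e_out: "e v = \<alpha> v" if "v \<notin> set ys" for v by (simp add: e_def upds_None[OF that])
    have "e v \<in> univ C" for v
    proof (cases "v \<in> set ys")
      case True
      then obtain i where i: "i < length ys" "v = ys ! i" by (auto simp: in_set_conv_nth)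
      have "y ! i \<in> set y" using i(1) ylen(1) by simp
      then show ?thesis using e_nth[OF i(1)] i(2) ylen(2) by auto
    next
      case False
      then show ?thesis using e_out[OF False] \<alpha>(1) by (auto simp: vals_def)
    qed
    then have e: "e \<in> vals C" unfolding vals_def by blast
    have key: "sat C e (inst (\<lambda>v. if v \<in> X then Some (\<beta> i v) else None) \<phi>) \<longleftrightarrow> c i @ y \<in> \<Phi>" for i
    proof -
      let ?e = "\<lambda>v. case (if v \<in> X then Some (\<beta> i v) else None) of None \<Rightarrow> e v | Some a \<Rightarrow> a"
      have "?e v = (if v \<in> X then \<beta> i v else e v)" for v by simp
      then have "?e v \<in> univ C" for v using \<beta>_vals[of i] e by (auto simp: vals_def)
      then have "?e \<in> vals C" unfolding vals_def by blast
      then have "sat C ?e \<phi> \<longleftrightarrow> map ?e (xs @ ys) \<in> \<Phi>" by (rule \<Phi>_sat)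
      moreover have "map ?e xs = c i"
      proof -
        have "map ?e xs = map (\<beta> i) xs" by (rule map_cong[OF refl]) (use xs(1) in simp)
        then show ?thesis unfolding \<beta>_xs .
      qed
      moreover have "map ?e ys = y"
      proof (rule nth_equalityI)
        fix l assume "l < length (map ?e ys)"
        then have l: "l < length ys" by simp
        then have "ys ! l \<notin> X" using ys(2) nth_mem by blast
        then show "map ?e ys ! l = y ! l" using l e_nth by simp
      qed (simp add: ylen)
      ultimately show ?thesis unfolding sat_inst by simp
    qed
    have "sat C e \<psi>" if "\<psi> \<in> F" for \<psi>
    proof -
      obtain i where i: "i \<in> J" "\<psi> = ?f s i" using \<open>\<psi> \<in> F\<close> J(2) by blast
      have "(c i @ y \<in> \<Phi>) = (i \<in> s)" using y(2)[OF j[OF i(1)]] j[OF i(1)] by simp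
      then show ?thesis unfolding i(2) using key[of i] by (simp add: Let_def)
    qed
    then show "\<exists>e\<in>vals C. \<forall>\<psi>\<in>F. sat C e \<psi>" using e by blast
  qed
  moreover have "\<phi> \<in> formulas L {} UNIV" using \<phi> by (simp add: formulas_def)
  ultimately have "has_IP L C X p" unfolding has_IP_def
    using \<beta>_vals \<beta>_p by (intro bexI[of _ \<phi>] exI[of _ \<beta>]) auto
  then show False using NIP unfolding NIP_type_def by blast
qed

lemma Lascar_splits_imp_KP_splits:
  "Lascar_splits L C \<kappa> X A N p \<Longrightarrow> KP_splits L C \<kappa> X A N p"
  using Ls_subset_KP unfolding Lascar_splits_def KP_splits_def splits_wrt_def Lascar_equiv_eq_Ls
  by blast

end

theorem corollary3p13:
  fixes L :: "('f, 'r) language"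
    and T :: "('f, 'r, nat, 'a) form set"
    and C :: "('f, 'r, 'a) struct"
    and \<kappa> :: "'k rel"
    and A N :: "'a set"
    and X :: "'v set"
    and p :: "('f, 'r, 'v, 'a) form set"
  assumes "complete_theory L T"
    and "monster L T C \<kappa>"
    and "elementary_sub L C N"
    and "small L C \<kappa> N"
    and "A \<subseteq> N"
    and "Lascar_complete L C \<kappa> A N"
    and "|X| <o \<kappa>"
    and "infinite (- X)"
    and "p \<in> complete_types L C X N"
    and "NIP_type L C X p"
  shows "\<not> Lascar_splits L C \<kappa> X A N p \<longleftrightarrow> \<not> KP_splits L C \<kappa> X A N p"
proof -
  interpret small_submodel L C \<kappa> N A
    using assms(2-5) unfolding monster_def by unfold_locales auto
  show ?thesis
    using Lascar_nonsplitting_imp_KP_nonsplitting[OF assms(6-10)]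
      Lascar_splits_imp_KP_splits by blast
qed

end
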